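(* For real numbers $q\le0\le p$ and $g\in C^\delta(V)$ with $\delta>0$, $$\rho^{p,q}(T,g)\le\inf_{t\in[1,\infty]}R^{p,q,t}(T,g).$$
   Context: $X$ is a $d$-dimensional $C^\infty$ Riemannian manifold and $T:X\to X$ is a diffeomorphism of class $C^r$ for some $r>1$. $\Lambda\subset X$ is a hyperbolic basic set for $T$: compact, $T$-invariant, hyperbolic, isolated and transitive. $V$ is a compact isolating neighbourhood, so $\Lambda=\bigcap_{m\in\mathbb{Z}}T^m(V)$. $T_\Lambda X=E^u\oplus E^s$ is the invariant decomposition, with $\|DT^m|_{E^s}\|\le C\lambda^m$ and $\|DT^{-m}|_{E^u}\|\le C\lambda^m$ for all $m\ge0$, some $C>0$, $0<\lambda<1$; $E^u,E^s$ have nonzero dimensions. $C^s(V)$ is the set of complex $C^s$ functions on $X$ with support in the interior of $V$. For $m\ge1$ put $g^{(m)}(x)=\prod_{k=0}^{m-1}g(T^k(x))$, $$\lambda_x(T^m)=\sup\Bigl\{\tfrac{\|DT^m_x(v)\|}{\|v\|}: DT^m_x(v)\in E^s(T^m(x))\setminus\{0\}\Bigr\},\qquad \nu_x(T^m)=\inf\Bigl\{\tfrac{\|DT^m_x(v)\|}{\|v\|}: v\in E^u(x)\setminus\{0\}\Bigr\},$$ $$\lambda^{(p,q,m)}(x)=\max\{(\lambda_x(T^m))^p,(\nu_x(T^m))^q\}.$$ One fixes an extension of $E^s,E^u$ to continuous (not necessarily invariant) bundles on a neighbourhood of $\Lambda$ containing $V$ and all points where these quantities are evaluated, such that $\lambda_x(T^m)\le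 C\lambda^m$ and $\nu_x(T^m)\ge C^{-1}\lambda^{-m}$ hold, for some constant $C$, for all $m\ge0$ and $x\in\bigcap_{k=0}^{m-1}T^{-k}(V)$. With $dx$ the normalised Lebesgue (Riemannian) measure on $X$, $$\rho^{p,q}(T,g)=\lim_{m\to\infty}\Bigl(\int_X|g^{(m)}(x)|\,\lambda^{(p,q,m)}(x)\,dx\Bigr)^{1/m}$$ (the limit is known to exist for $q\le0\le p$, $g\in C^\delta(V)$, $\delta>0$), and for $t\in[1,\infty]$ (with $1/\infty=0$) $$R^{p,q,t}(T,g)=\lim_{m\to\infty}\Bigl(\sup_{x\in\Lambda}|\det DT^m|^{-1/t}(x)\,|g^{(m)}(x)|\,\lambda^{(p,q,m)}(x)\Bigr)^{1/m}.$$ *)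

theory Defs
  imports "HOL-Analysis.Analysis"
begin

section \<open>Functions of class \<open>C\<^sup>r\<close> on open subsets of Euclidean space\<close>

definition locally_holder_on ::
  "real \<Rightarrow> 'a::real_normed_vector set \<Rightarrow> ('a \<Rightarrow> 'b::real_normed_vector) \<Rightarrow> bool" where
  "locally_holder_on \<alpha> S f \<longleftrightarrow>
     (\<forall>x\<in>S. \<exists>W K. open W \<and> x \<in> W \<and>
        (\<forall>y\<in>W \<inter> S. \<forall>z\<in>W \<inter> S. norm (f y - f z) \<le> K * norm (y - z) powr \<alpha>))"

text \<open>\<open>Ck_holder_on k \<alpha> S f\<close>: all iterated directional derivatives of \<open>f\<close> up to order \<open>k\<close> exist and
  are continuous on the open set \<open>S\<close>, and those of order \<open>k\<close> are locally \<open>\<alpha>\<close>-Hoelder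
  (no condition if \<open>\<alpha> = 0\<close>).\<close>

primrec Ck_holder_on ::
  "nat \<Rightarrow> real \<Rightarrow> 'a::euclidean_space set \<Rightarrow> ('a \<Rightarrow> 'b::real_normed_vector) \<Rightarrow> bool" where
  "Ck_holder_on 0 \<alpha> S f \<longleftrightarrow>
     continuous_on S f \<and> (0 < \<alpha> \<longrightarrow> locally_holder_on \<alpha> S f)"
| "Ck_holder_on (Suc k) \<alpha> S f \<longleftrightarrow>
     (\<forall>x\<in>S. f differentiable (at x)) \<and>
     (\<forall>v. Ck_holder_on k \<alpha> S (\<lambda>x. frechet_derivative f (at x) v))"

definition Cr_on :: "real \<Rightarrow> 'a::euclidean_space set \<Rightarrow> ('a \<Rightarrow> 'b::real_normed_vector) \<Rightarrow> bool" where
  "Cr_on r S f \<longleftrightarrow> Ck_holder_on (nat \<lfloor>r\<rfloor>) (frac r) S f"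

definition smooth_on :: "'a::euclidean_space set \<Rightarrow> ('a \<Rightarrow> 'b::real_normed_vector) \<Rightarrow> bool" where
  "smooth_on S f \<longleftrightarrow> (\<forall>k. Ck_holder_on k 0 S f)"


section \<open>Smooth manifolds\<close>

text \<open>The manifold is the whole type \<open>'x\<close>, and its dimension is \<open>CARD('d)\<close>. A chart is a pair of a
  domain and a coordinate map; values of the coordinate map off the domain are irrelevant.\<close>

type_synonym ('x, 'd) chart = "'x set \<times> ('x \<Rightarrow> real ^ 'd)"

definition chart_inv :: "('x, 'd::finite) chart \<Rightarrow> real ^ 'd \<Rightarrow> 'x" where
  "chart_inv c = inv_into (fst c) (snd c)"

definition smooth_atlas :: "('x::topological_space, 'd::finite) chart set \<Rightarrow> bool" where
  "smooth_atlas A \<longleftrightarrow>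
     (\<Union>c\<in>A. fst c) = UNIV \<and>
     (\<forall>c\<in>A. open (fst c) \<and> open (snd c ` fst c) \<and>
        homeomorphism (fst c) (snd c ` fst c) (snd c) (chart_inv c)) \<and>
     (\<forall>c\<in>A. \<forall>c'\<in>A. smooth_on (snd c ` (fst c \<inter> fst c')) (snd c' \<circ> chart_inv c))"

definition charts_at :: "('x, 'd::finite) chart set \<Rightarrow> 'x \<Rightarrow> ('x, 'd) chart set" where
  "charts_at A x = {c \<in> A. x \<in> fst c}"

definition Cr_map :: "('x::topological_space, 'd::finite) chart set \<Rightarrow> real \<Rightarrow> ('x \<Rightarrow> 'x) \<Rightarrow> bool" where
  "Cr_map A r f \<longleftrightarrow> continuous_on UNIV f \<and>
     (\<forall>c\<in>A. \<forall>c'\<in>A. Cr_on r (snd c ` (fst c \<inter> f -` fst c')) (snd c' \<circ> f \<circ> chart_inv c))"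

definition Cr_diffeomorphism ::
  "('x::topological_space, 'd::finite) chart set \<Rightarrow> real \<Rightarrow> ('x \<Rightarrow> 'x) \<Rightarrow> bool" where
  "Cr_diffeomorphism A r f \<longleftrightarrow> bij f \<and> Cr_map A r f \<and> Cr_map A r (inv f)"

definition Cr_functions_supported_in ::
  "('x::topological_space, 'd::finite) chart set \<Rightarrow> real \<Rightarrow> 'x set \<Rightarrow> ('x \<Rightarrow> complex) set" where
  "Cr_functions_supported_in A s V =
     {g. (\<forall>c\<in>A. Cr_on s (snd c ` fst c) (g \<circ> chart_inv c)) \<and>
         closure {x. g x \<noteq> 0} \<subseteq> interior V}"


section \<open>Tangent vectors\<close>

text \<open>A tangent vector at \<open>x\<close> is the family of its coordinate vectors in all charts around \<open>x\<close>, related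
  by the derivatives of the changes of charts. It is set to zero at all other arguments, so that
  equality of tangent vectors is equality of functions and all operations are pointwise.\<close>

type_synonym ('x, 'd) tangent = "('x, 'd) chart \<Rightarrow> real ^ 'd"

definition tangent_space :: "('x, 'd::finite) chart set \<Rightarrow> 'x \<Rightarrow> ('x, 'd) tangent set" where
  "tangent_space A x =
     {v. (\<forall>c\<in>charts_at A x. \<forall>c'\<in>charts_at A x.
            v c' = frechet_derivative (snd c' \<circ> chart_inv c) (at (snd c x)) (v c)) \<and>
         (\<forall>c. c \<notin> charts_at A x \<longrightarrow> v c = 0)}"

text \<open>The tangent vector at \<open>x\<close> whose coordinate vector in the chart \<open>c\<close> is \<open>u\<close>:\<close>

definition tangent_of ::
  "('x, 'd::finite) chart set \<Rightarrow> 'x \<Rightarrow> ('x, 'd) chart \<Rightarrow> real ^ 'd \<Rightarrow> ('x, 'd) tangent" where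
  "tangent_of A x c u =
     (\<lambda>c'. if c' \<in> charts_at A x
           then frechet_derivative (snd c' \<circ> chart_inv c) (at (snd c x)) u else 0)"

text \<open>By the chain rule the choice of chart in the next definition does not matter.\<close>

definition tangent_map ::
  "('x, 'd::finite) chart set \<Rightarrow> ('x \<Rightarrow> 'x) \<Rightarrow> 'x \<Rightarrow> ('x, 'd) tangent \<Rightarrow> ('x, 'd) tangent" where
  "tangent_map A f x v =
     (let c = (SOME c. c \<in> charts_at A x)
      in (\<lambda>c'. if c' \<in> charts_at A (f x)
               then frechet_derivative (snd c' \<circ> f \<circ> chart_inv c) (at (snd c x)) (v c) else 0))"

definition tangent_subspace ::
  "('x, 'd::finite) chart set \<Rightarrow> 'x \<Rightarrow> ('x, 'd) tangent set \<Rightarrow> bool" where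
  "tangent_subspace A x F \<longleftrightarrow>
     F \<subseteq> tangent_space A x \<and> (\<lambda>_. 0) \<in> F \<and>
     (\<forall>v\<in>F. \<forall>w\<in>F. (\<lambda>c. v c + w c) \<in> F) \<and> (\<forall>a::real. \<forall>v\<in>F. (\<lambda>c. a *\<^sub>R v c) \<in> F)"

text \<open>A continuous subbundle over \<open>U\<close> locally has a frame of continuous vector fields, here written in
  the coordinates of a chart.\<close>

definition continuous_subbundle ::
  "('x::topological_space, 'd::finite) chart set \<Rightarrow> 'x set \<Rightarrow> ('x \<Rightarrow> ('x, 'd) tangent set) \<Rightarrow> bool"
  where
  "continuous_subbundle A U E \<longleftrightarrow>
     (\<forall>x\<in>U. tangent_subspace A x (E x)) \<and>
     (\<forall>x\<in>U. \<forall>c\<in>charts_at A x. \<exists>W k. \<exists>e :: nat \<Rightarrow> 'x \<Rightarrow> real ^ 'd.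
        open W \<and> x \<in> W \<and> W \<subseteq> fst c \<and>
        (\<forall>i<k. continuous_on (W \<inter> U) (e i)) \<and>
        (\<forall>y\<in>W \<inter> U. (\<lambda>v. v c) ` E y = span ((\<lambda>i. e i y) ` {..<k}) \<and>
                    dim ((\<lambda>v. v c) ` E y) = k))"


section \<open>Riemannian metrics\<close>

type_synonym ('x, 'd) metric = "'x \<Rightarrow> ('x, 'd) tangent \<Rightarrow> ('x, 'd) tangent \<Rightarrow> real"

definition gram ::
  "('x, 'd::finite) chart set \<Rightarrow> ('x, 'd) metric \<Rightarrow> ('x, 'd) chart \<Rightarrow> 'x \<Rightarrow> real ^ 'd ^ 'd" where
  "gram A h c x = (\<chi> i j. h x (tangent_of A x c (axis i 1)) (tangent_of A x c (axis j 1)))"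

definition riemannian_manifold ::
  "('x::{t2_space, second_countable_topology}, 'd::finite) chart set \<Rightarrow> ('x, 'd) metric \<Rightarrow> bool" where
  "riemannian_manifold A h \<longleftrightarrow>
     smooth_atlas A \<and>
     (\<forall>x. \<forall>c\<in>charts_at A x. bilinear (\<lambda>u w. h x (tangent_of A x c u) (tangent_of A x c w))) \<and>
     (\<forall>x. \<forall>v\<in>tangent_space A x. \<forall>w\<in>tangent_space A x. h x v w = h x w v) \<and>
     (\<forall>x. \<forall>v\<in>tangent_space A x. v \<noteq> (\<lambda>_. 0) \<longrightarrow> 0 < h x v v) \<and>
     (\<forall>c\<in>A. smooth_on (snd c ` fst c) (\<lambda>y. gram A h c (chart_inv c y)))"

definition tnorm :: "('x, 'd) metric \<Rightarrow> 'x \<Rightarrow> ('x, 'd) tangent \<Rightarrow> real" where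
  "tnorm h x v = sqrt (h x v v)"

text \<open>\<open>|det Df\<^sub>x|\<close> with respect to the metric, i.e. for orthonormal bases of the tangent spaces at \<open>x\<close>
  and \<open>f x\<close>, expressed in arbitrary charts around these points.\<close>

definition abs_det ::
  "('x, 'd::finite) chart set \<Rightarrow> ('x, 'd) metric \<Rightarrow> ('x \<Rightarrow> 'x) \<Rightarrow> 'x \<Rightarrow> real" where
  "abs_det A h f x =
     (let c = (SOME c. c \<in> charts_at A x); c' = (SOME c'. c' \<in> charts_at A (f x))
      in \<bar>det (matrix (frechet_derivative (snd c' \<circ> f \<circ> chart_inv c) (at (snd c x))))\<bar>
         * sqrt (det (gram A h c' (f x))) / sqrt (det (gram A h c x)))"

text \<open>The following conditions determine the Riemannian volume measure uniquely.\<close>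

definition riemannian_volume ::
  "('x::topological_space, 'd::finite) chart set \<Rightarrow> ('x, 'd) metric \<Rightarrow> 'x measure \<Rightarrow> bool" where
  "riemannian_volume A h M \<longleftrightarrow>
     sets M = sets borel \<and>
     (\<forall>c\<in>A. \<forall>B\<in>sets borel. B \<subseteq> fst c \<longrightarrow>
        emeasure M B =
          (\<integral>\<^sup>+ y. ennreal (sqrt (det (gram A h c (chart_inv c y)))) * indicator (snd c ` B) y \<partial>lborel))"

text \<open>Total mass one, except that a measure of infinite total mass is left as it is.\<close>

definition normalised :: "'x measure \<Rightarrow> 'x measure" where
  "normalised M =
     (if emeasure M (space M) = \<infinity> then M else scale_measure (inverse (emeasure M (space M))) M)"


section \<open>Hyperbolic basic sets\<close>

definition int_iterate :: "('x \<Rightarrow> 'x) \<Rightarrow> int \<Rightarrow> 'x \<Rightarrow> 'x" where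
  "int_iterate T k = (if 0 \<le> k then T ^^ nat k else inv T ^^ nat (- k))"

definition isolating_neighbourhood ::
  "('x::topological_space \<Rightarrow> 'x) \<Rightarrow> 'x set \<Rightarrow> 'x set \<Rightarrow> bool" where
  "isolating_neighbourhood T \<Lambda> V \<longleftrightarrow>
     compact V \<and> \<Lambda> \<subseteq> interior V \<and> \<Lambda> = (\<Inter>k::int. int_iterate T k ` V)"

definition hyperbolic_splitting ::
  "('x, 'd::finite) chart set \<Rightarrow> ('x, 'd) metric \<Rightarrow> ('x \<Rightarrow> 'x) \<Rightarrow> 'x set \<Rightarrow> real \<Rightarrow>
   ('x \<Rightarrow> ('x, 'd) tangent set) \<Rightarrow> ('x \<Rightarrow> ('x, 'd) tangent set) \<Rightarrow> bool" where
  "hyperbolic_splitting A h T \<Lambda> \<theta> Eu Es \<longleftrightarrow>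
     0 < \<theta> \<and> \<theta> < 1 \<and>
     (\<forall>x\<in>\<Lambda>.
        tangent_subspace A x (Eu x) \<and> tangent_subspace A x (Es x) \<and>
        Eu x \<noteq> {\<lambda>_. 0} \<and> Es x \<noteq> {\<lambda>_. 0} \<and>
        (\<forall>v\<in>tangent_space A x. \<exists>!(a, b). a \<in> Eu x \<and> b \<in> Es x \<and> v = (\<lambda>c. a c + b c)) \<and>
        tangent_map A T x ` Eu x = Eu (T x) \<and> tangent_map A T x ` Es x = Es (T x)) \<and>
     (\<exists>C>0. \<forall>x\<in>\<Lambda>. \<forall>m.
        (\<forall>v\<in>Es x. tnorm h ((T ^^ m) x) (tangent_map A (T ^^ m) x v) \<le> C * \<theta> ^ m * tnorm h x v) \<and>
        (\<forall>v\<in>Eu x. tnorm h ((inv T ^^ m) x) (tangent_map A (inv T ^^ m) x v)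
                     \<le> C * \<theta> ^ m * tnorm h x v))"

definition hyperbolic_basic_set ::
  "('x::topological_space, 'd::finite) chart set \<Rightarrow> ('x, 'd) metric \<Rightarrow> ('x \<Rightarrow> 'x) \<Rightarrow> 'x set \<Rightarrow> real \<Rightarrow>
   ('x \<Rightarrow> ('x, 'd) tangent set) \<Rightarrow> ('x \<Rightarrow> ('x, 'd) tangent set) \<Rightarrow> bool" where
  "hyperbolic_basic_set A h T \<Lambda> \<theta> Eu Es \<longleftrightarrow>
     compact \<Lambda> \<and> T ` \<Lambda> = \<Lambda> \<and>
     hyperbolic_splitting A h T \<Lambda> \<theta> Eu Es \<and>
     (\<exists>V. isolating_neighbourhood T \<Lambda> V) \<and>
     (\<exists>x\<in>\<Lambda>. \<Lambda> \<subseteq> closure (range (\<lambda>k. int_iterate T k x)))"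


section \<open>Local expansion and contraction rates\<close>

definition stable_rate ::
  "('x, 'd::finite) chart set \<Rightarrow> ('x, 'd) metric \<Rightarrow> ('x \<Rightarrow> 'x) \<Rightarrow> ('x \<Rightarrow> ('x, 'd) tangent set) \<Rightarrow>
   nat \<Rightarrow> 'x \<Rightarrow> real" where
  "stable_rate A h T Es m x =
     Sup {tnorm h ((T ^^ m) x) (tangent_map A (T ^^ m) x v) / tnorm h x v | v.
            v \<in> tangent_space A x \<and> tangent_map A (T ^^ m) x v \<in> Es ((T ^^ m) x) - {\<lambda>_. 0}}"

definition unstable_rate ::
  "('x, 'd::finite) chart set \<Rightarrow> ('x, 'd) metric \<Rightarrow> ('x \<Rightarrow> 'x) \<Rightarrow> ('x \<Rightarrow> ('x, 'd) tangent set) \<Rightarrow>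
   nat \<Rightarrow> 'x \<Rightarrow> real" where
  "unstable_rate A h T Eu m x =
     Inf {tnorm h ((T ^^ m) x) (tangent_map A (T ^^ m) x v) / tnorm h x v | v.
            v \<in> Eu x - {\<lambda>_. 0}}"

text \<open>The bundles are defined on a neighbourhood \<open>U\<close> of \<open>V\<close> and \<open>T V\<close>: for a point \<open>x\<close> whose first \<open>m\<close>
  iterates \<open>x, \<dots>, T\<^sup>m\<^sup>-\<^sup>1 x\<close> lie in \<open>V\<close>, they are evaluated at \<open>x\<close> and at \<open>T\<^sup>m x\<close>. Intersecting with \<open>U\<close>
  below only matters for \<open>m = 0\<close>.\<close>

definition extended_splitting ::
  "('x::topological_space, 'd::finite) chart set \<Rightarrow> ('x, 'd) metric \<Rightarrow> ('x \<Rightarrow> 'x) \<Rightarrow> 'x set \<Rightarrow> 'x set \<Rightarrow>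
   real \<Rightarrow> ('x \<Rightarrow> ('x, 'd) tangent set) \<Rightarrow> ('x \<Rightarrow> ('x, 'd) tangent set) \<Rightarrow> bool" where
  "extended_splitting A h T V U \<theta> Eu Es \<longleftrightarrow>
     open U \<and> V \<union> T ` V \<subseteq> U \<and>
     continuous_subbundle A U Eu \<and> continuous_subbundle A U Es \<and>
     (\<forall>x\<in>U. Eu x \<noteq> {\<lambda>_. 0} \<and> Es x \<noteq> {\<lambda>_. 0}) \<and>
     (\<exists>C>0. \<forall>m. \<forall>x\<in>U \<inter> (\<Inter>k<m. (T ^^ k) -` V).
        stable_rate A h T Es m x \<le> C * \<theta> ^ m \<and>
        unstable_rate A h T Eu m x \<ge> inverse C * inverse \<theta> ^ m)"

definition rate_weight ::
  "('x, 'd::finite) chart set \<Rightarrow> ('x, 'd) metric \<Rightarrow> ('x \<Rightarrow> 'x) \<Rightarrow> ('x \<Rightarrow> ('x, 'd) tangent set) \<Rightarrow>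
   ('x \<Rightarrow> ('x, 'd) tangent set) \<Rightarrow> real \<Rightarrow> real \<Rightarrow> nat \<Rightarrow> 'x \<Rightarrow> real" where
  "rate_weight A h T Eu Es p q m x =
     max (stable_rate A h T Es m x powr p) (unstable_rate A h T Eu m x powr q)"

definition birkhoff_prod :: "('x \<Rightarrow> 'x) \<Rightarrow> ('x \<Rightarrow> complex) \<Rightarrow> nat \<Rightarrow> 'x \<Rightarrow> complex" where
  "birkhoff_prod T g m x = (\<Prod>k<m. g ((T ^^ k) x))"


section \<open>The quantities \<open>\<rho>\<close> and \<open>R\<close>\<close>

definition rho_seq ::
  "('x, 'd::finite) chart set \<Rightarrow> ('x, 'd) metric \<Rightarrow> 'x measure \<Rightarrow> ('x \<Rightarrow> ('x, 'd) tangent set) \<Rightarrow>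
   ('x \<Rightarrow> ('x, 'd) tangent set) \<Rightarrow> real \<Rightarrow> real \<Rightarrow> ('x \<Rightarrow> 'x) \<Rightarrow> ('x \<Rightarrow> complex) \<Rightarrow> nat \<Rightarrow> real" where
  "rho_seq A h vol Eu Es p q T g m =
     (\<integral>x. norm (birkhoff_prod T g m x) * rate_weight A h T Eu Es p q m x \<partial>(normalised vol))
       powr (1 / real m)"

definition rho ::
  "('x, 'd::finite) chart set \<Rightarrow> ('x, 'd) metric \<Rightarrow> 'x measure \<Rightarrow> ('x \<Rightarrow> ('x, 'd) tangent set) \<Rightarrow>
   ('x \<Rightarrow> ('x, 'd) tangent set) \<Rightarrow> real \<Rightarrow> real \<Rightarrow> ('x \<Rightarrow> 'x) \<Rightarrow> ('x \<Rightarrow> complex) \<Rightarrow> real" where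
  "rho A h vol Eu Es p q T g = lim (rho_seq A h vol Eu Es p q T g)"

definition R_bound ::
  "('x, 'd::finite) chart set \<Rightarrow> ('x, 'd) metric \<Rightarrow> 'x set \<Rightarrow> ('x \<Rightarrow> ('x, 'd) tangent set) \<Rightarrow>
   ('x \<Rightarrow> ('x, 'd) tangent set) \<Rightarrow> real \<Rightarrow> real \<Rightarrow> ereal \<Rightarrow> ('x \<Rightarrow> 'x) \<Rightarrow> ('x \<Rightarrow> complex) \<Rightarrow> real" where
  "R_bound A h \<Lambda> Eu Es p q t T g =
     lim (\<lambda>m. (SUP x\<in>\<Lambda>. abs_det A h (T ^^ m) x powr (- real_of_ereal (1 / t))
                          * norm (birkhoff_prod T g m x) * rate_weight A h T Eu Es p q m x)
                powr (1 / real m))"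

end

(* Over \<Lambda> the weights |det DT^m|^(-1/t) |g^(m)| \<lambda>^(p,q,m) are submultiplicative, so by Fekete's
   lemma R^(p,q,t) is the infimum of the n-th roots of their suprema S_n over \<Lambda>. An orbit segment of
   length M in V is close to \<Lambda> except near its two ends, and the vectors that are mapped into the extended
   E^s at its end (or that start in the extended E^u) are close to the invariant bundle over \<Lambda> in the
   middle of the segment: along the segment their norms are controlled by those at one end, and limits
   of such vectors have bounded forward (backward) orbits, which characterises E^s (E^u) over \<Lambda>. Cutting
   the segment into blocks of length n thus bounds the weight on V by K a^M whenever S_n < a^n.
   Finally |det DT^m|^(1/t) \<le> 1 + |det DT^m|, and the integral of the latter over the points that stay
   in V for m steps is bounded, by the change of variables formula. *)

theory Submission
  imports Defs
begin

section \<open>Maps of class C1 on a manifold\<close>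

text \<open>The obstacle: the extended bundles are not invariant, so off \<open>\<Lambda>\<close> a
  long rate cannot be split into short rates of the same kind. What is multiplied instead are norm
  ratios of one transported vector over consecutive blocks; only each single ratio is compared with
  a rate at a point of \<open>\<Lambda>\<close>. The comparison is by compactness of the unit sphere
  bundle: counterexamples ever farther from both ends of their segments converge to a unit vector
  over \<open>\<Lambda>\<close> with bounded half-orbit. The ends cost a constant factor, which
  disappears in the M-th root. In each block one point of \<open>\<Lambda>\<close> must serve for
  the stable rate, the unstable rate and the cocycle at once, since S_n controls only their
  combination. The error of the cocycle is additive because \<open>g\<close> may vanish, so that
  quotients make no sense. The exponent \<open>p - q\<close> bounds both \<open>p\<close> and
  \<open>- q\<close> and thus measures all errors in the weight. Fekete's lemma has a second
  purpose: R is defined by \<open>lim\<close>, which says nothing until convergence is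
  proved.\<close>

lemma Ck_holder_on_imp_continuous_on: "Ck_holder_on k \<alpha> S f \<Longrightarrow> continuous_on S f"
proof (cases k)
  case (Suc j)
  assume "Ck_holder_on k \<alpha> S f"
  then have "f differentiable_on S"
    using Suc differentiable_at_withinI unfolding differentiable_on_def by fastforce
  then show ?thesis by (rule differentiable_imp_continuous_on)
qed simp

lemma Ck_holder_on_Suc_imp_C1:
  assumes "Ck_holder_on (Suc k) \<alpha> S f"
  shows "x \<in> S \<Longrightarrow> f differentiable (at x)"
    and "continuous_on S (\<lambda>x. frechet_derivative f (at x) v)"
  using assms by (auto intro: Ck_holder_on_imp_continuous_on)

text \<open>In finite dimension pointwise convergence of linear maps is already joint convergence:
  after expanding the argument in a basis only finitely many sequences are left. Linearity of
  \<open>L n\<close> is required only eventually, because coordinate expressions make sense only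
  once the base points have entered the chart.\<close>

lemma tendsto_linear_apply:
  fixes L :: "nat \<Rightarrow> 'a::euclidean_space \<Rightarrow> 'b::real_normed_vector"
  assumes "\<And>u. (\<lambda>n. L n u) \<longlonglongrightarrow> L' u" and "u \<longlonglongrightarrow> u'"
    and lin: "eventually (\<lambda>n. linear (L n)) sequentially" and "linear L'"
  shows "(\<lambda>n. L n (u n)) \<longlonglongrightarrow> L' u'"
proof -
  have expand: "M w = (\<Sum>b\<in>Basis. (w \<bullet> b) *\<^sub>R M b)" if "linear M"
    for M :: "'a \<Rightarrow> 'b" and w
    using linear_sum[OF that, of "\<lambda>b. (w \<bullet> b) *\<^sub>R b" Basis]
    by (simp add: euclidean_representation linear_scale[OF that])
  have "(\<lambda>n. \<Sum>b\<in>Basis. (u n \<bullet> b) *\<^sub>R L n b) \<longlonglongrightarrow> (\<Sum>b\<in>Basis. (u' \<bullet> b) *\<^sub>R L' b)"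
    by (intro tendsto_sum tendsto_scaleR tendsto_inner assms tendsto_const)
  then have "(\<lambda>n. \<Sum>b\<in>Basis. (u n \<bullet> b) *\<^sub>R L n b) \<longlonglongrightarrow> L' u'"
    unfolding expand[OF \<open>linear L'\<close>, of u', symmetric] .
  then show ?thesis
    by (rule Lim_transform_eventually) (use lin in \<open>auto elim!: eventually_mono simp: expand[symmetric]\<close>)
qed

text \<open>For \<open>f = id\<close> this is the derivative of a change of charts, so the
  transformation rules for tangent vectors become instances of the chain rule for maps of the
  manifold.\<close>

definition local_deriv ::
  "('x \<Rightarrow> 'x) \<Rightarrow> ('x, 'd::finite) chart \<Rightarrow> ('x, 'd) chart \<Rightarrow> 'x \<Rightarrow> real ^ 'd \<Rightarrow> real ^ 'd" where
  "local_deriv f c c' x = frechet_derivative (snd c' \<circ> f \<circ> chart_inv c) (at (snd c x))"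

text \<open>Continuity of the derivative is expressed at points of the manifold and for one fixed
  coordinate vector at a time, the form in which it passes to limits along sequences of
  points.\<close>

definition C1_map :: "('x::t2_space, 'd::finite) chart set \<Rightarrow> ('x \<Rightarrow> 'x) \<Rightarrow> bool" where
  "C1_map A f \<longleftrightarrow> continuous_on UNIV f \<and>
     (\<forall>x. \<forall>c\<in>charts_at A x. \<forall>c'\<in>charts_at A (f x).
        (snd c' \<circ> f \<circ> chart_inv c) differentiable (at (snd c x)) \<and>
        (\<forall>u. isCont (\<lambda>y. local_deriv f c c' y u) x))"

locale manifold =
  fixes A :: "('x::{t2_space, second_countable_topology}, 'd::finite) chart set"
  assumes atlas: "smooth_atlas A"
begin

lemma charts_at_iff: "c \<in> charts_at A x \<longleftrightarrow> c \<in> A \<and> x \<in> fst c"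
  by (simp add: charts_at_def)

lemma charts_at_nonempty: "\<exists>c. c \<in> charts_at A x"
proof -
  have "x \<in> (\<Union>c\<in>A. fst c)" using atlas unfolding smooth_atlas_def by blast
  then show ?thesis by (auto simp: charts_at_def)
qed

lemma some_chart: "(SOME c. c \<in> charts_at A x) \<in> charts_at A x"
  using charts_at_nonempty by (rule someI_ex)

lemma open_chart: "c \<in> A \<Longrightarrow> open (fst c)"
  and open_chart_image: "c \<in> A \<Longrightarrow> open (snd c ` fst c)"
  and homeomorphism_chart: "c \<in> A \<Longrightarrow> homeomorphism (fst c) (snd c ` fst c) (snd c) (chart_inv c)"
  using atlas by (auto simp: smooth_atlas_def)

lemma inj_on_chart: "c \<in> A \<Longrightarrow> inj_on (snd c) (fst c)"
  using homeomorphism_chart by (metis homeomorphism_apply1 inj_on_inverseI)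

lemma chart_inv_chart [simp]: "c \<in> A \<Longrightarrow> x \<in> fst c \<Longrightarrow> chart_inv c (snd c x) = x"
  using homeomorphism_chart by (metis homeomorphism_apply1)

lemma chart_inv_in: "c \<in> A \<Longrightarrow> y \<in> snd c ` fst c \<Longrightarrow> chart_inv c y \<in> fst c"
  by auto

lemma chart_chart_inv [simp]: "c \<in> A \<Longrightarrow> y \<in> snd c ` fst c \<Longrightarrow> snd c (chart_inv c y) = y"
  by auto

lemma continuous_on_chart: "c \<in> A \<Longrightarrow> continuous_on (fst c) (snd c)"
  and continuous_on_chart_inv: "c \<in> A \<Longrightarrow> continuous_on (snd c ` fst c) (chart_inv c)"
  using homeomorphism_chart by (auto simp: homeomorphism_def)

lemma isCont_chart: "c \<in> A \<Longrightarrow> x \<in> fst c \<Longrightarrow> isCont (snd c) x"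
  using continuous_on_chart open_chart continuous_on_eq_continuous_at by blast

lemma open_chart_subset_image:
  assumes "c \<in> A" "open W" "W \<subseteq> fst c" shows "open (snd c ` W)"
proof -
  have "openin (top_of_set (fst c)) W"
    using assms open_chart by (simp add: openin_open_eq)
  then have "openin (top_of_set (snd c ` fst c)) (snd c ` W)"
    using homeomorphism_imp_open_map homeomorphism_chart assms by blast
  then show ?thesis using open_chart_image assms by (simp add: openin_open_eq)
qed

lemma eventually_chart:
  "x \<longlonglongrightarrow> z \<Longrightarrow> c \<in> charts_at A z \<Longrightarrow> eventually (\<lambda>n. x n \<in> fst c) sequentially"
  unfolding charts_at_iff using open_chart by (blast intro: topological_tendstoD)

lemma open_preimage_chart:
  "continuous_on UNIV f \<Longrightarrow> c \<in> A \<Longrightarrow> c' \<in> A \<Longrightarrow> open (fst c \<inter> f -` fst c')"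
  by (intro open_Int open_chart open_vimage) auto

lemma C1_mapI:
  assumes "continuous_on UNIV f"
    and "\<And>c c'. c \<in> A \<Longrightarrow> c' \<in> A \<Longrightarrow>
      \<exists>k \<alpha>. Ck_holder_on (Suc k) \<alpha> (snd c ` (fst c \<inter> f -` fst c')) (snd c' \<circ> f \<circ> chart_inv c)"
  shows "C1_map A f"
  unfolding C1_map_def
proof (intro conjI allI ballI assms(1))
  fix x c c' u assume c: "c \<in> charts_at A x" "c' \<in> charts_at A (f x)"
  let ?S = "snd c ` (fst c \<inter> f -` fst c')"
  obtain k \<alpha> where k: "Ck_holder_on (Suc k) \<alpha> ?S (snd c' \<circ> f \<circ> chart_inv c)"
    using assms(2) c by (meson charts_at_iff)
  have x: "snd c x \<in> ?S" and "c \<in> A" "x \<in> fst c" using c by (auto simp: charts_at_iff)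
  have "open ?S" using c assms(1)
    by (intro open_chart_subset_image open_preimage_chart) (auto simp: charts_at_iff)
  show "(snd c' \<circ> f \<circ> chart_inv c) differentiable (at (snd c x))"
    using Ck_holder_on_Suc_imp_C1(1)[OF k x] .
  have "isCont (\<lambda>y. frechet_derivative (snd c' \<circ> f \<circ> chart_inv c) (at y) u) (snd c x)"
    using Ck_holder_on_Suc_imp_C1(2)[OF k] \<open>open ?S\<close> x continuous_on_eq_continuous_at by blast
  then show "isCont (\<lambda>y. local_deriv f c c' y u) x"
    unfolding local_deriv_def using isCont_o2[OF isCont_chart] \<open>c \<in> A\<close> \<open>x \<in> fst c\<close> by fast
qed

text \<open>This is the smoothness of the changes of charts. Through it every statement about C1
  maps also yields one about the coordinates of tangent vectors.\<close>

lemma C1_map_id: "C1_map A id"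
proof (rule C1_mapI)
  fix c c' assume "c \<in> A" "c' \<in> A"
  then have "Ck_holder_on (Suc 0) 0 (snd c ` (fst c \<inter> fst c')) (snd c' \<circ> chart_inv c)"
    using atlas unfolding smooth_atlas_def smooth_on_def by blast
  then show "\<exists>k \<alpha>. Ck_holder_on (Suc k) \<alpha> (snd c ` (fst c \<inter> id -` fst c')) (snd c' \<circ> id \<circ> chart_inv c)"
    by (auto simp del: Ck_holder_on.simps)
qed (simp add: continuous_on_id)

lemma Cr_map_imp_C1_map:
  assumes "Cr_map A r f" "1 \<le> r" shows "C1_map A f"
proof (rule C1_mapI)
  obtain k where k: "nat \<lfloor>r\<rfloor> = Suc k"
  proof -
    have "1 \<le> \<lfloor>r\<rfloor>" using assms(2) by simp
    then have "nat \<lfloor>r\<rfloor> = Suc (nat (\<lfloor>r\<rfloor> - 1))" by linarith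
    then show ?thesis using that by blast
  qed
  fix c c' assume "c \<in> A" "c' \<in> A"
  then show "\<exists>k \<alpha>. Ck_holder_on (Suc k) \<alpha> (snd c ` (fst c \<inter> f -` fst c')) (snd c' \<circ> f \<circ> chart_inv c)"
    using assms(1) unfolding Cr_map_def Cr_on_def k by (auto simp del: Ck_holder_on.simps)
qed (use assms in \<open>auto simp: Cr_map_def\<close>)

lemma C1_map_continuous: "C1_map A f \<Longrightarrow> isCont f x"
  by (auto simp: C1_map_def continuous_on_eq_continuous_at)

lemma local_has_derivative:
  assumes "C1_map A f" "c \<in> charts_at A x" "c' \<in> charts_at A (f x)"
  shows "((snd c' \<circ> f \<circ> chart_inv c) has_derivative local_deriv f c c' x) (at (snd c x))"
  using assms unfolding C1_map_def local_deriv_def by (simp add: frechet_derivative_works[symmetric])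

lemma linear_local_deriv:
  assumes "C1_map A f" "c \<in> charts_at A x" "c' \<in> charts_at A (f x)"
  shows "linear (local_deriv f c c' x)"
  using local_has_derivative[OF assms] has_derivative_linear by blast

text \<open>The chain rule in charts. The coordinate expressions compose to that of
  \<open>k \<circ> f\<close> only where \<open>f\<close> lands in the domain of \<open>c'\<close>,
  hence the passage to the open set \<open>?S\<close>.\<close>

lemma local_deriv_comp:
  assumes "C1_map A f" "C1_map A k" "c \<in> charts_at A x" "c' \<in> charts_at A (f x)"
    "c'' \<in> charts_at A (k (f x))"
  shows "((snd c'' \<circ> (k \<circ> f) \<circ> chart_inv c) has_derivative
      (local_deriv k c' c'' (f x) \<circ> local_deriv f c c' x)) (at (snd c x))"
    and "local_deriv (k \<circ> f) c c'' x = local_deriv k c' c'' (f x) \<circ> local_deriv f c c' x"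
proof -
  let ?S = "snd c ` (fst c \<inter> f -` fst c')"
  have cA: "c \<in> A" "c' \<in> A" "x \<in> fst c" "f x \<in> fst c'" using assms by (auto simp: charts_at_iff)
  have "open ?S" using cA assms(1)
    by (intro open_chart_subset_image open_preimage_chart) (auto simp: charts_at_iff C1_map_def)
  have "(snd c' \<circ> f \<circ> chart_inv c) (snd c x) = snd c' (f x)" using cA by simp
  then have "((snd c'' \<circ> k \<circ> chart_inv c') \<circ> (snd c' \<circ> f \<circ> chart_inv c) has_derivative
      (local_deriv k c' c'' (f x) \<circ> local_deriv f c c' x)) (at (snd c x))"
    using assms by (intro diff_chain_at local_has_derivative)
      (auto intro!: local_has_derivative simp del: o_apply)
  then show *: "((snd c'' \<circ> (k \<circ> f) \<circ> chart_inv c) has_derivative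
      (local_deriv k c' c'' (f x) \<circ> local_deriv f c c' x)) (at (snd c x))"
    by (rule has_derivative_transform_within_open[OF _ \<open>open ?S\<close>]) (use cA in auto)
  show "local_deriv (k \<circ> f) c c'' x = local_deriv k c' c'' (f x) \<circ> local_deriv f c c' x"
    using frechet_derivative_at[OF *] by (simp add: local_deriv_def)
qed

lemma local_deriv_tendsto:
  assumes f: "C1_map A f" and c: "c \<in> charts_at A z" "c' \<in> charts_at A (f z)"
    and x: "x \<longlonglongrightarrow> z" and u: "u \<longlonglongrightarrow> u'"
  shows "(\<lambda>n. local_deriv f c c' (x n) (u n)) \<longlonglongrightarrow> local_deriv f c c' z u'"
proof (rule tendsto_linear_apply[OF _ u _ linear_local_deriv[OF f c]])
  show "(\<lambda>n. local_deriv f c c' (x n) w) \<longlonglongrightarrow> local_deriv f c c' z w" for w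
  proof (rule isCont_tendsto_compose[OF _ x])
    show "isCont (\<lambda>y. local_deriv f c c' y w) z"
      using f c unfolding C1_map_def by blast
  qed
  have "(\<lambda>n. f (x n)) \<longlonglongrightarrow> f z" using isCont_tendsto_compose[OF C1_map_continuous[OF f] x] .
  then have "eventually (\<lambda>n. x n \<in> fst c \<and> f (x n) \<in> fst c') sequentially"
    using eventually_conj[OF eventually_chart[OF x c(1)] eventually_chart[OF _ c(2)]] by blast
  then show "eventually (\<lambda>n. linear (local_deriv f c c' (x n))) sequentially"
    by eventually_elim (use c in \<open>auto intro!: linear_local_deriv[OF f] simp: charts_at_iff\<close>)
qed

text \<open>Continuity of the derivative of the composition needs joint convergence of the outer
  derivative in base point and vector, which is \<open>local_deriv_tendsto\<close>.\<close>

lemma C1_map_comp: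
  assumes "C1_map A f" "C1_map A k" shows "C1_map A (k \<circ> f)"
  unfolding C1_map_def
proof (intro conjI allI ballI)
  show "continuous_on UNIV (k \<circ> f)"
    using assms unfolding C1_map_def by (metis continuous_on_compose continuous_on_subset subset_UNIV)
  fix x c c'' u assume c: "c \<in> charts_at A x" "c'' \<in> charts_at A ((k \<circ> f) x)"
  obtain c' where c': "c' \<in> charts_at A (f x)" using charts_at_nonempty by blast
  show "(snd c'' \<circ> (k \<circ> f) \<circ> chart_inv c) differentiable (at (snd c x))"
    using local_deriv_comp(1)[OF assms c(1) c', of c''] c(2) unfolding differentiable_def o_apply
    by blast
  show "isCont (\<lambda>y. local_deriv (k \<circ> f) c c'' y u) x"
  proof (rule continuous_at_sequentiallyI)
    fix y assume y: "y \<longlonglongrightarrow> x"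
    have fy: "(\<lambda>n. f (y n)) \<longlonglongrightarrow> f x"
      using isCont_tendsto_compose[OF C1_map_continuous[OF assms(1)] y] .
    have kfy: "(\<lambda>n. k (f (y n))) \<longlonglongrightarrow> k (f x)"
      using isCont_tendsto_compose[OF C1_map_continuous[OF assms(2)] fy] .
    have "eventually (\<lambda>n. y n \<in> fst c \<and> f (y n) \<in> fst c' \<and> k (f (y n)) \<in> fst c'') sequentially"
      using c(2) unfolding o_apply
      by (intro eventually_conj eventually_chart[OF y c(1)] eventually_chart[OF fy c']
          eventually_chart[OF kfy])
    then have ev: "eventually (\<lambda>n. local_deriv k c' c'' (f (y n)) (local_deriv f c c' (y n) u)
        = local_deriv (k \<circ> f) c c'' (y n) u) sequentially"
      by eventually_elim (use c c' in \<open>auto simp: local_deriv_comp(2)[OF assms, of c _ c'] charts_at_iff\<close>)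
    have "(\<lambda>n. local_deriv k c' c'' (f (y n)) (local_deriv f c c' (y n) u))
       \<longlonglongrightarrow> local_deriv k c' c'' (f x) (local_deriv f c c' x u)"
      using c c' by (intro local_deriv_tendsto assms y fy tendsto_const) auto
    then have "(\<lambda>n. local_deriv (k \<circ> f) c c'' (y n) u)
       \<longlonglongrightarrow> local_deriv k c' c'' (f x) (local_deriv f c c' x u)"
      by (rule Lim_transform_eventually[OF _ ev])
    then show "(\<lambda>n. local_deriv (k \<circ> f) c c'' (y n) u) \<longlonglongrightarrow> local_deriv (k \<circ> f) c c'' x u"
      using c c' by (simp add: local_deriv_comp(2)[OF assms, of c _ c'])
  qed
qed

lemma C1_map_funpow: "C1_map A f \<Longrightarrow> C1_map A (f ^^ m)"
  by (induction m) (auto intro: C1_map_comp C1_map_id)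

lemma local_deriv_id: "c \<in> charts_at A x \<Longrightarrow> local_deriv id c c x = id"
proof -
  assume c: "c \<in> charts_at A x"
  have "((snd c \<circ> id \<circ> chart_inv c) has_derivative id) (at (snd c x))"
    by (rule has_derivative_transform_within_open[OF has_derivative_id open_chart_image[of c]])
      (use c in \<open>auto simp: charts_at_iff\<close>)
  then show ?thesis using frechet_derivative_at by (metis local_deriv_def)
qed

end

section \<open>Tangent vectors and their convergence\<close>

text \<open>Convergence in the tangent bundle. Tangent vectors vanish in charts that miss their base
  point, but only charts around the limit \<open>z\<close> are tested, and these eventually contain
  \<open>x n\<close>.\<close>

definition tendsto_tangent ::
  "('x::topological_space, 'd::finite) chart set \<Rightarrow> (nat \<Rightarrow> 'x) \<Rightarrow> (nat \<Rightarrow> ('x, 'd) tangent) \<Rightarrow>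
   'x \<Rightarrow> ('x, 'd) tangent \<Rightarrow> bool" where
  "tendsto_tangent A x v z w \<longleftrightarrow>
     x \<longlonglongrightarrow> z \<and> (\<forall>n. v n \<in> tangent_space A (x n)) \<and> w \<in> tangent_space A z \<and>
     (\<forall>c\<in>charts_at A z. (\<lambda>n. v n c) \<longlonglongrightarrow> w c)"

context manifold
begin

lemma tangent_space_iff:
  "v \<in> tangent_space A x \<longleftrightarrow>
     (\<forall>c\<in>charts_at A x. \<forall>c'\<in>charts_at A x. v c' = local_deriv id c c' x (v c)) \<and>
     (\<forall>c. c \<notin> charts_at A x \<longrightarrow> v c = 0)"
  by (simp add: tangent_space_def local_deriv_def del: split_paired_All)

lemma tangent_of_eq:
  "tangent_of A x c u = (\<lambda>c'. if c' \<in> charts_at A x then local_deriv id c c' x u else 0)"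
  by (rule ext) (simp add: tangent_of_def local_deriv_def)

lemma charts_at_other: "c \<in> charts_at A z \<Longrightarrow> y \<in> fst c \<Longrightarrow> c \<in> charts_at A y"
  by (simp add: charts_at_iff)

lemma local_deriv_id_comp:
  assumes "c \<in> charts_at A x" "c' \<in> charts_at A x" "c'' \<in> charts_at A x"
  shows "local_deriv id c' c'' x (local_deriv id c c' x u) = local_deriv id c c'' x u"
  using local_deriv_comp(2)[OF C1_map_id C1_map_id assms(1), of c' c''] assms by simp

lemma tangent_of_in: "c \<in> charts_at A x \<Longrightarrow> tangent_of A x c u \<in> tangent_space A x"
  unfolding tangent_space_iff tangent_of_eq by (simp add: local_deriv_id_comp del: split_paired_All)

lemma tangent_of_apply: "c \<in> charts_at A x \<Longrightarrow> tangent_of A x c u c = u"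
  by (simp add: tangent_of_eq local_deriv_id)

lemma tangent_eqI:
  assumes "v \<in> tangent_space A x" "w \<in> tangent_space A x" "c \<in> charts_at A x" "v c = w c"
  shows "v = w"
proof
  fix c' show "v c' = w c'"
    using assms unfolding tangent_space_iff by (cases "c' \<in> charts_at A x") metis+
qed

lemma tangent_of_coord:
  "v \<in> tangent_space A x \<Longrightarrow> c \<in> charts_at A x \<Longrightarrow> tangent_of A x c (v c) = v"
  by (rule tangent_eqI[OF tangent_of_in]) (auto simp: tangent_of_apply)

lemma tangent_space_zero: "(\<lambda>_. 0) \<in> tangent_space A x"
  unfolding tangent_space_iff using linear_local_deriv[OF C1_map_id] by (auto simp: linear_0)

lemma tangent_space_add:
  "v \<in> tangent_space A x \<Longrightarrow> w \<in> tangent_space A x \<Longrightarrow> (\<lambda>c. v c + w c) \<in> tangent_space A x"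
  unfolding tangent_space_iff
proof (intro conjI ballI allI impI)
  fix c c' assume "c \<in> charts_at A x" "c' \<in> charts_at A x"
  then have "linear (local_deriv id c c' x)" using linear_local_deriv[OF C1_map_id] by simp
  moreover assume "(\<forall>c\<in>charts_at A x. \<forall>c'\<in>charts_at A x. v c' = local_deriv id c c' x (v c)) \<and>
     (\<forall>c. c \<notin> charts_at A x \<longrightarrow> v c = 0)" "(\<forall>c\<in>charts_at A x. \<forall>c'\<in>charts_at A x. w c' = local_deriv id c c' x (w c)) \<and>
     (\<forall>c. c \<notin> charts_at A x \<longrightarrow> w c = 0)"
  then have "v c' = local_deriv id c c' x (v c)" "w c' = local_deriv id c c' x (w c)"
    using \<open>c \<in> _\<close> \<open>c' \<in> _\<close> by blast+
  ultimately show "v c' + w c' = local_deriv id c c' x (v c + w c)" by (simp add: linear_add)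
qed auto

lemma tangent_space_scale:
  "v \<in> tangent_space A x \<Longrightarrow> (\<lambda>c. a *\<^sub>R v c) \<in> tangent_space A x"
  unfolding tangent_space_iff
proof (intro conjI ballI allI impI)
  fix c c' assume "c \<in> charts_at A x" "c' \<in> charts_at A x"
  then have "linear (local_deriv id c c' x)" using linear_local_deriv[OF C1_map_id] by simp
  moreover assume "(\<forall>c\<in>charts_at A x. \<forall>c'\<in>charts_at A x. v c' = local_deriv id c c' x (v c)) \<and>
     (\<forall>c. c \<notin> charts_at A x \<longrightarrow> v c = 0)"
  then have "v c' = local_deriv id c c' x (v c)"
    using \<open>c \<in> _\<close> \<open>c' \<in> _\<close> by blast
  ultimately show "a *\<^sub>R v c' = local_deriv id c c' x (a *\<^sub>R v c)" by (simp add: linear_scale)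
qed auto

text \<open>The definition picks a source chart by \<open>SOME\<close>; factoring \<open>f\<close>
  as \<open>f \<circ> id\<close> and applying the chain rule shows that any chart gives the same
  value.\<close>

lemma tangent_map_apply:
  assumes f: "C1_map A f" and v: "v \<in> tangent_space A x"
    and c: "c \<in> charts_at A x" "c' \<in> charts_at A (f x)"
  shows "tangent_map A f x v c' = local_deriv f c c' x (v c)"
proof -
  let ?c = "SOME c. c \<in> charts_at A x"
  have "local_deriv (f \<circ> id) c c' x = local_deriv f ?c c' x \<circ> local_deriv id c ?c x"
    using local_deriv_comp(2)[OF C1_map_id f c(1), of ?c c'] c some_chart by simp
  moreover have "v ?c = local_deriv id c ?c x (v c)"
    using v c some_chart unfolding tangent_space_iff by blast
  ultimately show ?thesis
    using c by (simp add: tangent_map_def Let_def local_deriv_def)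
qed

lemma tangent_map_outside: "c' \<notin> charts_at A (f x) \<Longrightarrow> tangent_map A f x v c' = 0"
  by (simp add: tangent_map_def Let_def)

lemma tangent_map_in:
  assumes f: "C1_map A f" and v: "v \<in> tangent_space A x"
  shows "tangent_map A f x v \<in> tangent_space A (f x)"
  unfolding tangent_space_iff
proof (intro conjI ballI allI impI)
  fix c c' assume c: "c \<in> charts_at A (f x)" "c' \<in> charts_at A (f x)"
  obtain b where b: "b \<in> charts_at A x" using charts_at_nonempty by blast
  have "local_deriv (id \<circ> f) b c' x = local_deriv id c c' (f x) \<circ> local_deriv f b c x"
    using local_deriv_comp(2)[OF f C1_map_id b, of c c'] c by simp
  then show "tangent_map A f x v c' = local_deriv id c c' (f x) (tangent_map A f x v c)"
    using c by (simp add: tangent_map_apply[OF f v b])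
qed (simp add: tangent_map_outside)

lemma tangent_map_comp:
  assumes f: "C1_map A f" and k: "C1_map A k" and v: "v \<in> tangent_space A x"
  shows "tangent_map A (k \<circ> f) x v = tangent_map A k (f x) (tangent_map A f x v)"
proof -
  obtain c c' c'' where c: "c \<in> charts_at A x" "c' \<in> charts_at A (f x)" "c'' \<in> charts_at A (k (f x))"
    using charts_at_nonempty by blast
  show ?thesis
  proof (rule tangent_eqI[of _ "k (f x)" _ c''])
    show "tangent_map A (k \<circ> f) x v \<in> tangent_space A (k (f x))"
      using tangent_map_in[OF C1_map_comp[OF f k] v] by simp
    show "tangent_map A k (f x) (tangent_map A f x v) \<in> tangent_space A (k (f x))"
      using tangent_map_in f k v by blast
    show "tangent_map A (k \<circ> f) x v c'' = tangent_map A k (f x) (tangent_map A f x v) c''"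
      using c by (simp add: tangent_map_apply[OF C1_map_comp[OF f k] v c(1)]
          tangent_map_apply[OF k tangent_map_in[OF f v] c(2)] tangent_map_apply[OF f v c(1)]
          local_deriv_comp(2)[OF f k c])
  qed (use c in simp)
qed

lemma tangent_map_id: "v \<in> tangent_space A x \<Longrightarrow> tangent_map A id x v = v"
  using charts_at_nonempty[of x] tangent_map_in[OF C1_map_id, of v x]
  by (auto intro!: tangent_eqI[of _ x] simp: tangent_map_apply[OF C1_map_id] local_deriv_id)

lemma tangent_map_add:
  assumes "C1_map A f"
  shows "tangent_map A f x (\<lambda>c. v c + w c) = (\<lambda>c. tangent_map A f x v c + tangent_map A f x w c)"
  using linear_local_deriv[OF assms some_chart]
  by (auto simp: tangent_map_def Let_def local_deriv_def[symmetric] linear_add fun_eq_iff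
      simp del: split_paired_All)

lemma tangent_map_scale:
  assumes "C1_map A f"
  shows "tangent_map A f x (\<lambda>c. a *\<^sub>R v c) = (\<lambda>c. a *\<^sub>R tangent_map A f x v c)"
  using linear_local_deriv[OF assms some_chart]
  by (auto simp: tangent_map_def Let_def local_deriv_def[symmetric] linear_scale fun_eq_iff
      simp del: split_paired_All)

lemma tangent_map_zero:
  assumes "C1_map A f"
  shows "tangent_map A f x (\<lambda>_. 0) = (\<lambda>_. 0)"
  using tangent_map_scale[OF assms, of x 0 "\<lambda>_. 0"] by simp

text \<open>One chart suffices, since the derivatives of the changes of charts are jointly
  continuous in point and vector.\<close>

lemma tendsto_tangentI:
  assumes "x \<longlonglongrightarrow> z" and v: "\<And>n. v n \<in> tangent_space A (x n)" and w: "w \<in> tangent_space A z"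
    and c: "c \<in> charts_at A z" "(\<lambda>n. v n c) \<longlonglongrightarrow> w c"
  shows "tendsto_tangent A x v z w"
  unfolding tendsto_tangent_def
proof (intro conjI ballI allI assms)
  fix c' assume c': "c' \<in> charts_at A z"
  have "eventually (\<lambda>n. x n \<in> fst c \<and> x n \<in> fst c') sequentially"
    by (intro eventually_conj eventually_chart[OF assms(1)] c c')
  then have "eventually (\<lambda>n. local_deriv id c c' (x n) (v n c) = v n c') sequentially"
  proof eventually_elim
    case (elim n)
    then have "c \<in> charts_at A (x n)" "c' \<in> charts_at A (x n)"
      using c(1) c' charts_at_other by blast+
    with v[of n] show ?case unfolding tangent_space_iff by metis
  qed
  moreover have "(\<lambda>n. local_deriv id c c' (x n) (v n c)) \<longlonglongrightarrow> local_deriv id c c' z (w c)"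
    using c c' by (intro local_deriv_tendsto C1_map_id assms) auto
  moreover have "local_deriv id c c' z (w c) = w c'"
    using w c c' unfolding tangent_space_iff by metis
  ultimately show "(\<lambda>n. v n c') \<longlonglongrightarrow> w c'"
    by (auto elim: Lim_transform_eventually)
qed

lemma tendsto_tangent_map:
  assumes f: "C1_map A f" and "tendsto_tangent A x v z w"
  shows "tendsto_tangent A (\<lambda>n. f (x n)) (\<lambda>n. tangent_map A f (x n) (v n)) (f z) (tangent_map A f z w)"
proof -
  have x: "x \<longlonglongrightarrow> z" and v: "\<And>n. v n \<in> tangent_space A (x n)" and w: "w \<in> tangent_space A z"
    and vw: "\<And>c. c \<in> charts_at A z \<Longrightarrow> (\<lambda>n. v n c) \<longlonglongrightarrow> w c"
    using assms(2) by (simp_all add: tendsto_tangent_def)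
  obtain c c' where c: "c \<in> charts_at A z" "c' \<in> charts_at A (f z)"
    using charts_at_nonempty by blast
  have fx: "(\<lambda>n. f (x n)) \<longlonglongrightarrow> f z"
    using isCont_tendsto_compose[OF C1_map_continuous[OF f] x] .
  have "eventually (\<lambda>n. x n \<in> fst c \<and> f (x n) \<in> fst c') sequentially"
    by (intro eventually_conj eventually_chart[OF x] eventually_chart[OF fx] c)
  then have ev: "eventually (\<lambda>n. local_deriv f c c' (x n) (v n c) = tangent_map A f (x n) (v n) c') sequentially"
    by eventually_elim
      (simp add: tangent_map_apply[OF f v charts_at_other[OF c(1)] charts_at_other[OF c(2)]])
  have "(\<lambda>n. local_deriv f c c' (x n) (v n c)) \<longlonglongrightarrow> local_deriv f c c' z (w c)"
    by (intro local_deriv_tendsto f c x vw)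
  with ev have "(\<lambda>n. tangent_map A f (x n) (v n) c') \<longlonglongrightarrow> tangent_map A f z w c'"
    unfolding tangent_map_apply[OF f w c] by (auto elim: Lim_transform_eventually)
  then show ?thesis
    by (intro tendsto_tangentI[of _ _ _ _ c'] fx tangent_map_in f v w c)
qed

end

section \<open>Riemannian metrics\<close>

lemma norm_matrix_vector_mult_le:
  fixes M :: "real ^ 'n ^ 'm::finite"
  shows "norm (M *v u) \<le> real CARD('m) * norm M * norm u"
proof -
  have "norm (M *v u) \<le> (\<Sum>i\<in>UNIV. \<bar>(M *v u) $ i\<bar>)" by (rule norm_le_l1_cart)
  also have "\<dots> \<le> (\<Sum>i\<in>(UNIV::'m set). norm M * norm u)"
  proof (rule sum_mono)
    fix i
    have "\<bar>(M *v u) $ i\<bar> \<le> norm (M $ i) * norm u"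
      by (simp add: matrix_vector_mul_component Cauchy_Schwarz_ineq2)
    also have "\<dots> \<le> norm M * norm u" by (intro mult_right_mono Finite_Cartesian_Product.norm_nth_le) auto
    finally show "\<bar>(M *v u) $ i\<bar> \<le> norm M * norm u" .
  qed
  finally show ?thesis by simp
qed

lemma positive_definite_bound:
  fixes G :: "real ^ 'n ^ 'n"
  assumes "\<And>u. u \<noteq> 0 \<Longrightarrow> 0 < u \<bullet> (G *v u)"
  obtains e where "0 < e" "\<And>u. e * (norm u)\<^sup>2 \<le> u \<bullet> (G *v u)"
proof -
  have "continuous_on (sphere 0 1) (\<lambda>u. u \<bullet> (G *v u))"
    by (intro continuous_intros linear_continuous_on matrix_vector_mul_bounded_linear)
  moreover have "sphere (0::real^'n) 1 \<noteq> {}" by (simp add: sphere_eq_empty)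
  ultimately obtain s where s: "s \<in> sphere 0 1" "\<And>u. u \<in> sphere 0 1 \<Longrightarrow> s \<bullet> (G *v s) \<le> u \<bullet> (G *v u)"
    using continuous_attains_inf[OF compact_sphere] by meson
  define e where "e = s \<bullet> (G *v s)"
  have "s \<noteq> 0" using s(1) by auto
  then have "0 < e" using assms by (simp add: e_def)
  moreover have "e * (norm u)\<^sup>2 \<le> u \<bullet> (G *v u)" for u
  proof (cases "u = 0")
    case False
    define w where "w = u /\<^sub>R norm u"
    have u: "u = norm u *\<^sub>R w" and "norm w = 1" using False by (auto simp: w_def)
    then have "e \<le> w \<bullet> (G *v w)" using s(2) unfolding e_def by simp
    then have "e * (norm u)\<^sup>2 \<le> (w \<bullet> (G *v w)) * (norm u)\<^sup>2" by (intro mult_right_mono) auto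
    also have "\<dots> = (norm u *\<^sub>R w) \<bullet> (G *v (norm u *\<^sub>R w))"
      by (simp only: matrix_vector_mult_scaleR inner_scaleR_left inner_scaleR_right power2_eq_square
          mult.assoc mult.commute)
    finally show ?thesis using u by simp
  qed simp
  ultimately show thesis by (rule that)
qed

text \<open>A homotopy argument without eigenvalues: all matrices on the segment from the identity
  to \<open>G\<close> are positive definite, hence invertible, so the determinant has no zero on the
  way from 1 to \<open>det G\<close>.\<close>

lemma det_positive_definite:
  fixes G :: "real ^ 'n ^ 'n"
  assumes G: "\<And>u. u \<noteq> 0 \<Longrightarrow> 0 < u \<bullet> (G *v u)"
  shows "0 < det G"
proof (rule ccontr)
  assume "\<not> 0 < det G"
  define P where "P t = det (t *\<^sub>R G + (1 - t) *\<^sub>R mat 1)" for t :: real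
  have "continuous_on {0..1} P"
    unfolding P_def det_def by (intro continuous_intros)
  moreover have "P 0 = 1" "P 1 \<le> 0" using \<open>\<not> 0 < det G\<close> by (auto simp: P_def)
  ultimately obtain t where t: "0 \<le> t" "t \<le> 1" "P t = 0"
    using IVT2'[of P 1 0 0] by auto
  have "\<not> invertible (t *\<^sub>R G + (1 - t) *\<^sub>R mat 1)"
    using t(3) unfolding P_def invertible_det_nz by simp
  then obtain u where u: "(t *\<^sub>R G + (1 - t) *\<^sub>R mat 1) *v u = 0" "u \<noteq> 0"
    unfolding invertible_left_inverse matrix_left_invertible_ker by blast
  have "0 = u \<bullet> ((t *\<^sub>R G + (1 - t) *\<^sub>R mat 1) *v u)" using u by simp
  also have "\<dots> = t * (u \<bullet> (G *v u)) + (1 - t) * (u \<bullet> u)"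
    by (simp add: matrix_vector_mult_add_rdistrib scaleR_matrix_vector_assoc[symmetric] inner_add_right)
  also have "\<dots> > 0"
  proof (cases "t = 0")
    case False
    then show ?thesis using G[OF u(2)] t by (intro add_pos_nonneg mult_pos_pos mult_nonneg_nonneg) auto
  qed (use u in auto)
  finally show False by simp
qed

locale riemannian = manifold A
  for A :: "('x::{t2_space, second_countable_topology}, 'd::finite) chart set" +
  fixes h :: "('x, 'd) metric"
  assumes riem: "riemannian_manifold A h"
begin

lemma metric_coord:
  assumes "v \<in> tangent_space A x" "w \<in> tangent_space A x" "c \<in> charts_at A x"
  shows "h x v w = v c \<bullet> (gram A h c x *v w c)"
proof -
  define B where "B u w = h x (tangent_of A x c u) (tangent_of A x c w)" for u w
  have B: "bilinear B" using riem assms unfolding riemannian_manifold_def B_def by blast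
  have "h x v w = B (v c) (w c)" using assms by (simp add: B_def tangent_of_coord)
  also have "\<dots> = (\<Sum>i\<in>UNIV. \<Sum>j\<in>UNIV. B (v c $ i *\<^sub>R axis i 1) (w c $ j *\<^sub>R axis j 1))"
    using bilinear_sum[OF B, where f="\<lambda>i. v c $ i *\<^sub>R axis i 1" and g="\<lambda>i. w c $ i *\<^sub>R axis i 1" and S=UNIV and T=UNIV]
    using basis_expansion[of "v c"] basis_expansion[of "w c"]
    by (simp add: scalar_mult_eq_scaleR sum.cartesian_product)
  also have "\<dots> = (\<Sum>i\<in>UNIV. \<Sum>j\<in>UNIV. v c $ i * (gram A h c x $ i $ j * w c $ j))"
  proof -
    have "gram A h c x $ i $ j = B (axis i 1) (axis j 1)" for i j by (simp add: gram_def B_def)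
    then show ?thesis by (simp add: bilinear_lmul[OF B] bilinear_rmul[OF B] mult_ac)
  qed
  also have "\<dots> = v c \<bullet> (gram A h c x *v w c)"
    by (simp add: inner_vec_def matrix_vector_mult_def sum_distrib_left)
  finally show ?thesis .
qed

lemma metric_pos: "v \<in> tangent_space A x \<Longrightarrow> v \<noteq> (\<lambda>_. 0) \<Longrightarrow> 0 < h x v v"
  using riem unfolding riemannian_manifold_def by blast

lemma metric_zero: "h x (\<lambda>_. 0) (\<lambda>_. 0) = 0"
  using charts_at_nonempty[of x] by (auto simp: metric_coord[OF tangent_space_zero tangent_space_zero])

lemma metric_nonneg: "v \<in> tangent_space A x \<Longrightarrow> 0 \<le> h x v v"
  using metric_pos metric_zero by (metis less_eq_real_def)

lemma tnorm_nonneg: "v \<in> tangent_space A x \<Longrightarrow> 0 \<le> tnorm h x v"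
  by (simp add: tnorm_def metric_nonneg)

lemma tnorm_zero [simp]: "tnorm h x (\<lambda>_. 0) = 0"
  by (simp add: tnorm_def metric_zero)

lemma tnorm_pos: "v \<in> tangent_space A x \<Longrightarrow> v \<noteq> (\<lambda>_. 0) \<Longrightarrow> 0 < tnorm h x v"
  by (simp add: tnorm_def metric_pos)

lemma tnorm_scale:
  assumes "v \<in> tangent_space A x"
  shows "tnorm h x (\<lambda>c. a *\<^sub>R v c) = \<bar>a\<bar> * tnorm h x v"
proof -
  obtain c where c: "c \<in> charts_at A x" using charts_at_nonempty by blast
  have "h x (\<lambda>c. a *\<^sub>R v c) (\<lambda>c. a *\<^sub>R v c) = a\<^sup>2 * h x v v"
    using metric_coord[OF tangent_space_scale[OF assms] tangent_space_scale[OF assms] c, of a a]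
      metric_coord[OF assms assms c]
    by (simp add: matrix_vector_mult_scaleR power2_eq_square)
  then show ?thesis by (simp add: tnorm_def real_sqrt_mult)
qed

text \<open>The parallelogram identity, with the square of the norm of the difference dropped. It
  serves in place of the triangle inequality, as the cross terms cancel without
  Cauchy-Schwarz.\<close>

lemma tnorm_add_sq_le:
  assumes v: "v \<in> tangent_space A x" and w: "w \<in> tangent_space A x"
  shows "(tnorm h x (\<lambda>c. v c + w c))\<^sup>2 \<le> 2 * ((tnorm h x v)\<^sup>2 + (tnorm h x w)\<^sup>2)"
proof -
  obtain c where c: "c \<in> charts_at A x" using charts_at_nonempty by blast
  define w' where "w' = (\<lambda>c. (-1) *\<^sub>R w c)"
  have w': "w' \<in> tangent_space A x" unfolding w'_def by (rule tangent_space_scale[OF w])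
  let ?p = "\<lambda>c. v c + w c" and ?m = "\<lambda>c. v c + w' c"
  have p: "?p \<in> tangent_space A x" and m: "?m \<in> tangent_space A x"
    using tangent_space_add v w w' by auto
  have "h x ?p ?p + h x ?m ?m = 2 * (h x v v + h x w w)"
    unfolding metric_coord[OF p p c] metric_coord[OF m m c] metric_coord[OF v v c] metric_coord[OF w w c]
    by (simp add: w'_def matrix_vector_right_distrib inner_add_left inner_add_right
        matrix_vector_mult_diff_distrib inner_diff_left inner_diff_right)
  then show ?thesis
    using metric_nonneg[OF p] metric_nonneg[OF m] metric_nonneg[OF v] metric_nonneg[OF w]
    by (simp add: tnorm_def)
qed

lemma gram_tendsto:
  assumes c: "c \<in> charts_at A z" and x: "x \<longlonglongrightarrow> z"
  shows "(\<lambda>n. gram A h c (x n)) \<longlonglongrightarrow> gram A h c z"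
proof -
  have cA: "c \<in> A" "z \<in> fst c" using c by (auto simp: charts_at_iff)
  have "continuous_on (snd c ` fst c) (\<lambda>y. gram A h c (chart_inv c y))"
    using riem cA Ck_holder_on_imp_continuous_on unfolding riemannian_manifold_def smooth_on_def by blast
  then have "isCont (\<lambda>y. gram A h c (chart_inv c y)) (snd c z)"
    using cA open_chart_image continuous_on_eq_continuous_at by blast
  moreover have "(\<lambda>n. snd c (x n)) \<longlonglongrightarrow> snd c z"
    using isCont_tendsto_compose[OF isCont_chart x] cA by blast
  ultimately have "(\<lambda>n. gram A h c (chart_inv c (snd c (x n)))) \<longlonglongrightarrow> gram A h c (chart_inv c (snd c z))"
    by (rule isCont_tendsto_compose)
  moreover have "eventually (\<lambda>n. gram A h c (chart_inv c (snd c (x n))) = gram A h c (x n)) sequentially"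
    using eventually_chart[OF x c] by eventually_elim (use cA in simp)
  ultimately show ?thesis using cA by (auto intro: Lim_transform_eventually)
qed

lemma tendsto_tnorm:
  assumes "tendsto_tangent A x v z w"
  shows "(\<lambda>n. tnorm h (x n) (v n)) \<longlonglongrightarrow> tnorm h z w"
proof -
  have x: "x \<longlonglongrightarrow> z" and v: "\<And>n. v n \<in> tangent_space A (x n)" and w: "w \<in> tangent_space A z"
    and vw: "\<And>c. c \<in> charts_at A z \<Longrightarrow> (\<lambda>n. v n c) \<longlonglongrightarrow> w c"
    using assms by (simp_all add: tendsto_tangent_def)
  obtain c where c: "c \<in> charts_at A z" using charts_at_nonempty by blast
  have "(\<lambda>n. v n c \<bullet> (gram A h c (x n) *v v n c)) \<longlonglongrightarrow> w c \<bullet> (gram A h c z *v w c)"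
    using gram_tendsto[OF c x] vw[OF c]
    unfolding matrix_vector_mult_def inner_vec_def vec_lambda_beta
    by (intro tendsto_intros) auto
  moreover have "eventually (\<lambda>n. v n c \<bullet> (gram A h c (x n) *v v n c) = h (x n) (v n) (v n)) sequentially"
    using eventually_chart[OF x c] by eventually_elim (simp add: metric_coord[OF v v charts_at_other[OF c]])
  ultimately have "(\<lambda>n. h (x n) (v n) (v n)) \<longlonglongrightarrow> h z w w"
    unfolding metric_coord[OF w w c] by (rule Lim_transform_eventually)
  then show ?thesis unfolding tnorm_def by (rule tendsto_real_sqrt)
qed

lemma gram_pos_def:
  assumes "c \<in> charts_at A x" "u \<noteq> 0" shows "0 < u \<bullet> (gram A h c x *v u)"
proof -
  have "tangent_of A x c u \<noteq> (\<lambda>_. 0)"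
    using assms tangent_of_apply by metis
  then have "0 < h x (tangent_of A x c u) (tangent_of A x c u)"
    using assms by (intro metric_pos tangent_of_in) 
  then show ?thesis
    using assms by (simp add: metric_coord[OF tangent_of_in tangent_of_in] tangent_of_apply)
qed

text \<open>Sequential compactness of the unit sphere bundle over a convergent sequence of base
  points, the source of every limit vector below. It suffices to bound the coordinate vectors in a
  chart around \<open>z\<close>.\<close>

lemma unit_tangents_compact:
  assumes x: "x \<longlonglongrightarrow> z" and v: "\<And>n. v n \<in> tangent_space A (x n)"
    and "\<And>n. tnorm h (x n) (v n) = 1"
  obtains r w where "strict_mono r" "tendsto_tangent A (x \<circ> r) (v \<circ> r) z w" "tnorm h z w = 1"
proof -
  obtain c where c: "c \<in> charts_at A z" using charts_at_nonempty by blast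
  define G where "G = gram A h c z"
  obtain e where e: "0 < e" "\<And>u. e * (norm u)\<^sup>2 \<le> u \<bullet> (G *v u)"
    using positive_definite_bound[of G] gram_pos_def[OF c] unfolding G_def by blast
  let ?k = "real CARD('d)"
  \<comment> \<open>\<open>?k\<close> is the constant of \<open>norm_matrix_vector_mult_le\<close>.
    With this closeness the quadratic form at \<open>x n\<close> keeps at least half of the lower
    bound \<open>e\<close> of the form at \<open>z\<close>.\<close>
  have "eventually (\<lambda>n. dist (gram A h c (x n)) G < e / 2 / ?k) sequentially"
    using gram_tendsto[OF c x] e by (intro tendstoD) (auto simp: G_def)
  moreover note eventually_chart[OF x c]
  ultimately have "eventually (\<lambda>n. norm (v n c) \<le> sqrt (2 / e)) sequentially"
  proof eventually_elim
    case (elim n)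
    let ?u = "v n c" and ?H = "gram A h c (x n)"
    have "h (x n) (v n) (v n) = 1" using assms(3)[of n] by (simp add: tnorm_def)
    then have 1: "?u \<bullet> (?H *v ?u) = 1"
      using metric_coord[OF v v charts_at_other[OF c elim(2)]] by simp
    have "\<bar>?u \<bullet> ((?H - G) *v ?u)\<bar> \<le> norm ?u * norm ((?H - G) *v ?u)" by (rule Cauchy_Schwarz_ineq2)
    also have "\<dots> \<le> norm ?u * (?k * norm (?H - G) * norm ?u)"
      by (intro mult_left_mono norm_matrix_vector_mult_le) auto
    also have "\<dots> \<le> norm ?u * (e / 2 * norm ?u)"
      using elim(1) by (intro mult_left_mono mult_right_mono) (auto simp: dist_norm field_simps)
    finally have "\<bar>?u \<bullet> ((?H - G) *v ?u)\<bar> \<le> e / 2 * (norm ?u)\<^sup>2" by (simp add: power2_eq_square mult_ac)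
    moreover have "?u \<bullet> ((?H - G) *v ?u) = 1 - ?u \<bullet> (G *v ?u)"
      using 1 by (simp add: matrix_vector_mult_diff_rdistrib inner_diff_right)
    ultimately have "?u \<bullet> (G *v ?u) \<le> 1 + e / 2 * (norm ?u)\<^sup>2" by linarith
    then have "e / 2 * (norm ?u)\<^sup>2 \<le> 1" using e(2)[of ?u] by (simp add: field_simps)
    then have "(norm ?u)\<^sup>2 \<le> 2 / e" using e(1) by (simp add: field_simps)
    then show ?case by (simp add: real_le_rsqrt)
  qed
  then obtain N where N: "\<And>n. n \<ge> N \<Longrightarrow> norm (v n c) \<le> sqrt (2 / e)"
    unfolding eventually_sequentially by blast
  have "\<forall>n. v (n + N) c \<in> cball 0 (sqrt (2 / e))" using N by simp
  then obtain u q where q: "strict_mono (q :: nat \<Rightarrow> nat)" "((\<lambda>n. v (n + N) c) \<circ> q) \<longlonglongrightarrow> u"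
    using compact_imp_seq_compact[OF compact_cball] unfolding seq_compact_def by meson
  define r where "r n = q n + N" for n
  have r: "strict_mono r" using q(1) by (simp add: r_def strict_mono_def)
  have "tendsto_tangent A (x \<circ> r) (v \<circ> r) z (tangent_of A z c u)"
  proof (rule tendsto_tangentI[OF LIMSEQ_subseq_LIMSEQ[OF x r] _ tangent_of_in[OF c] c])
    show "(\<lambda>n. (v \<circ> r) n c) \<longlonglongrightarrow> tangent_of A z c u c"
      using q(2) by (simp add: r_def o_def tangent_of_apply[OF c])
  qed (use v in simp)
  moreover from tendsto_tnorm[OF this] have "tnorm h z (tangent_of A z c u) = 1"
    using assms(3) by (auto simp: LIMSEQ_const_iff)
  ultimately show thesis using r that by blast
qed

section \<open>The Jacobian\<close>

text \<open>The density of the Riemannian volume with respect to Lebesgue measure in the chart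
  \<open>c\<close>.\<close>

definition vol_density :: "('x, 'd) chart \<Rightarrow> 'x \<Rightarrow> real" where
  "vol_density c x = sqrt (det (gram A h c x))"

lemma vol_density_pos: "c \<in> charts_at A x \<Longrightarrow> 0 < vol_density c x"
  using det_positive_definite[OF gram_pos_def] by (simp add: vol_density_def)

lemma gram_change_chart:
  assumes c: "c \<in> charts_at A x" and c': "c' \<in> charts_at A x"
  defines "J \<equiv> matrix (local_deriv id c c' x)"
  shows "gram A h c x = transpose J ** gram A h c' x ** J"
proof -
  have J: "tangent_of A x c u c' = J *v u" for u
    using linear_local_deriv[OF C1_map_id c, of c'] c'
    by (simp add: tangent_of_eq J_def matrix_works del: split_paired_All)
  have "u \<bullet> (gram A h c x *v w) = u \<bullet> ((transpose J ** gram A h c' x ** J) *v w)" for u w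
  proof -
    have "u \<bullet> (gram A h c x *v w) = h x (tangent_of A x c u) (tangent_of A x c w)"
      using c by (simp add: metric_coord[OF tangent_of_in tangent_of_in] tangent_of_apply)
    also have "\<dots> = (J *v u) \<bullet> (gram A h c' x *v (J *v w))"
      using c c' by (simp add: metric_coord[OF tangent_of_in tangent_of_in c'] J)
    also have "\<dots> = u \<bullet> (transpose J *v (gram A h c' x *v (J *v w)))"
      by (metis dot_lmul_matrix vector_transpose_matrix)
    finally show ?thesis by (simp add: matrix_vector_mul_assoc matrix_mul_assoc)
  qed
  then show ?thesis unfolding matrix_eq using vector_eq_ldot by blast
qed

lemma vol_density_change_chart:
  assumes "c \<in> charts_at A x" "c' \<in> charts_at A x"
  shows "vol_density c x = \<bar>det (matrix (local_deriv id c c' x))\<bar> * vol_density c' x"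
  unfolding vol_density_def
  by (subst gram_change_chart[OF assms]) (simp add: det_mul real_sqrt_mult)

text \<open>The charts chosen by \<open>SOME\<close> may be replaced by any others: a change of
  charts multiplies the coordinate determinant by a factor that the quotient of the two densities
  cancels.\<close>

lemma abs_det_eq:
  assumes f: "C1_map A f" and c: "c \<in> charts_at A x" and c': "c' \<in> charts_at A (f x)"
  shows "abs_det A h f x =
    \<bar>det (matrix (local_deriv f c c' x))\<bar> * vol_density c' (f x) / vol_density c x"
proof -
  define b b' where "b = (SOME c. c \<in> charts_at A x)" and "b' = (SOME c. c \<in> charts_at A (f x))"
  have b: "b \<in> charts_at A x" and b': "b' \<in> charts_at A (f x)"
    unfolding b_def b'_def by (rule some_chart)+
  note lin = linear_local_deriv
  have "local_deriv (f \<circ> id) c c' x = local_deriv f b c' x \<circ> local_deriv id c b x"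
    using local_deriv_comp(2)[OF C1_map_id f c, of b c'] b c' by simp
  moreover have "local_deriv (id \<circ> f) b c' x = local_deriv id b' c' (f x) \<circ> local_deriv f b b' x"
    using local_deriv_comp(2)[OF f C1_map_id b b', of c'] c' by simp
  ultimately have "local_deriv f c c' x =
      local_deriv id b' c' (f x) \<circ> local_deriv f b b' x \<circ> local_deriv id c b x" by simp
  moreover have "linear (local_deriv id b' c' (f x))" "linear (local_deriv f b b' x)"
    "linear (local_deriv id c b x)"
    using lin[OF C1_map_id b'] lin[OF f b b'] lin[OF C1_map_id c] c' b by auto
  ultimately have D: "det (matrix (local_deriv f c c' x)) = det (matrix (local_deriv id b' c' (f x))) *
      det (matrix (local_deriv f b b' x)) * det (matrix (local_deriv id c b x))"
    by (simp add: matrix_compose linear_compose det_mul)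
  have "abs_det A h f x = \<bar>det (matrix (local_deriv f b b' x))\<bar> * vol_density b' (f x) / vol_density b x"
    unfolding abs_det_def Let_def b_def b'_def local_deriv_def vol_density_def ..
  moreover have "vol_density b' (f x) = \<bar>det (matrix (local_deriv id b' c' (f x)))\<bar> * vol_density c' (f x)"
    by (rule vol_density_change_chart[OF b' c'])
  moreover have "vol_density c x = \<bar>det (matrix (local_deriv id c b x))\<bar> * vol_density b x"
    by (rule vol_density_change_chart[OF c b])
  moreover have "0 < vol_density c x" "0 < vol_density b x" using vol_density_pos b c by auto
  ultimately show ?thesis unfolding D abs_mult by (auto simp: field_simps)
qed

lemma abs_det_comp:
  assumes f: "C1_map A f" and k: "C1_map A k"
  shows "abs_det A h (k \<circ> f) x = abs_det A h k (f x) * abs_det A h f x"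
proof -
  obtain c c' c'' where c: "c \<in> charts_at A x" "c' \<in> charts_at A (f x)" "c'' \<in> charts_at A (k (f x))"
    using charts_at_nonempty by blast
  have "vol_density c' (f x) > 0" using vol_density_pos c by auto
  moreover have "det (matrix (local_deriv (k \<circ> f) c c'' x)) =
      det (matrix (local_deriv k c' c'' (f x))) * det (matrix (local_deriv f c c' x))"
    by (simp add: local_deriv_comp(2)[OF f k c] matrix_compose linear_local_deriv f k c det_mul)
  ultimately show ?thesis
    using c by (simp add: abs_det_eq[OF C1_map_comp[OF f k] c(1), of c''] abs_det_eq[OF k c(2,3)]
        abs_det_eq[OF f c(1,2)] abs_mult)
qed

lemma abs_det_nonneg: "C1_map A f \<Longrightarrow> 0 \<le> abs_det A h f x"
  using charts_at_nonempty[of x] charts_at_nonempty[of "f x"]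
  by (auto simp: abs_det_eq intro!: mult_nonneg_nonneg divide_nonneg_nonneg less_imp_le[OF vol_density_pos])

lemma abs_det_id: "abs_det A h id x = 1"
proof -
  obtain c where c: "c \<in> charts_at A x" using charts_at_nonempty by blast
  then show ?thesis
    using vol_density_pos[OF c] abs_det_eq[OF C1_map_id c, of c]
    by (simp add: local_deriv_id matrix_id_mat_1)
qed

text \<open>Multiplicativity applied to \<open>k \<circ> f = id\<close> excludes the value
  0.\<close>

lemma abs_det_pos:
  assumes "C1_map A f" "C1_map A k" "k \<circ> f = id"
  shows "0 < abs_det A h f x"
  using abs_det_comp[OF assms(1,2), of x] abs_det_nonneg[OF assms(1), of x] abs_det_id[of x]
  unfolding assms(3) by (cases "abs_det A h f x = 0") auto

lemma isCont_abs_det: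
  assumes f: "C1_map A f" shows "isCont (abs_det A h f) z"
proof (rule continuous_at_sequentiallyI)
  fix x assume x: "x \<longlonglongrightarrow> z"
  obtain c c' where c: "c \<in> charts_at A z" "c' \<in> charts_at A (f z)" using charts_at_nonempty by blast
  have fx: "(\<lambda>n. f (x n)) \<longlonglongrightarrow> f z"
    using isCont_tendsto_compose[OF C1_map_continuous[OF f] x] .
  have "eventually (\<lambda>n. x n \<in> fst c \<and> f (x n) \<in> fst c') sequentially"
    by (intro eventually_conj eventually_chart[OF x] eventually_chart[OF fx] c)
  then have ev: "eventually (\<lambda>n. \<bar>det (matrix (local_deriv f c c' (x n)))\<bar> * vol_density c' (f (x n))
      / vol_density c (x n) = abs_det A h f (x n)) sequentially"
    by eventually_elim (use c in \<open>simp add: abs_det_eq[OF f, of c _ c'] charts_at_iff\<close>)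
  have det: "(\<lambda>n. det (M n)) \<longlonglongrightarrow> det M'" if "M \<longlonglongrightarrow> M'" for M :: "nat \<Rightarrow> real^'d^'d" and M'
    unfolding det_def by (intro tendsto_intros that)
  have "(\<lambda>n. matrix (local_deriv f c c' (x n))) \<longlonglongrightarrow> matrix (local_deriv f c c' z)"
    unfolding matrix_def
    by (intro vec_tendstoI) (auto intro!: tendsto_vec_nth local_deriv_tendsto f c x)
  then have "(\<lambda>n. \<bar>det (matrix (local_deriv f c c' (x n)))\<bar> * vol_density c' (f (x n))
      / vol_density c (x n)) \<longlonglongrightarrow> \<bar>det (matrix (local_deriv f c c' z))\<bar> * vol_density c' (f z) / vol_density c z"
    using vol_density_pos[OF c(1)] unfolding vol_density_def
    by (intro tendsto_intros det gram_tendsto c x fx) auto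
  then show "(\<lambda>n. abs_det A h f (x n)) \<longlonglongrightarrow> abs_det A h f z"
    unfolding abs_det_eq[OF f c] by (rule Lim_transform_eventually[OF _ ev])
qed

end

section \<open>Change of variables\<close>

text \<open>The change of variables theorem for absolutely integrable functions, restated for
  nonnegative integrals. Finiteness of the integral over the image provides the integrability from
  which that theorem starts.\<close>

lemma nn_integral_change_of_variables_wellorder:
  fixes \<phi> :: "real ^ 'm::{finite,wellorder} \<Rightarrow> real ^ 'm::_" and f :: "real ^ 'm::_ \<Rightarrow> real"
  assumes S: "S \<in> sets lebesgue"
    and der: "\<And>x. x \<in> S \<Longrightarrow> (\<phi> has_derivative \<phi>' x) (at x within S)"
    and inj: "inj_on \<phi> S"
    and f: "\<And>y. y \<in> \<phi> ` S \<Longrightarrow> 0 \<le> f y" "(\<lambda>y. indicator (\<phi> ` S) y * f y) \<in> borel_measurable lebesgue"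
    and fin: "(\<integral>\<^sup>+ y. ennreal (indicator (\<phi> ` S) y * f y) \<partial>lborel) < \<infinity>"
  shows "(\<integral>\<^sup>+ x. ennreal (indicator S x * (\<bar>det (matrix (\<phi>' x))\<bar> * f (\<phi> x))) \<partial>lborel) =
         (\<integral>\<^sup>+ y. ennreal (indicator (\<phi> ` S) y * f y) \<partial>lborel)"
proof -
  have indicator_times: "(\<lambda>x. indicator W x * k x) = (\<lambda>x. if x \<in> W then k x else 0)"
    for W and k :: "real ^ 'm::_ \<Rightarrow> real" by (auto simp: indicator_def)
  obtain b where b: "(\<integral>\<^sup>+ y. ennreal (indicator (\<phi> ` S) y * f y) \<partial>lborel) = ennreal b" "0 \<le> b"
    using fin by (cases "\<integral>\<^sup>+ y. ennreal (indicator (\<phi> ` S) y * f y) \<partial>lborel") auto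
  have "((\<lambda>y. indicator (\<phi> ` S) y * f y) has_integral b) UNIV"
    using b f by (subst has_integral_iff_nn_integral_lebesgue) (auto simp: nn_integral_completion indicator_def)
  then have fb: "(f has_integral b) (\<phi> ` S)"
    unfolding indicator_times has_integral_restrict_UNIV .
  then have "f absolutely_integrable_on (\<phi> ` S)"
    using f(1) by (intro nonnegative_absolutely_integrable_1) auto
  then have "(\<lambda>x. \<bar>det (matrix (\<phi>' x))\<bar> * f (\<phi> x)) absolutely_integrable_on S \<and>
      integral S (\<lambda>x. \<bar>det (matrix (\<phi>' x))\<bar> * f (\<phi> x)) = b"
    \<comment> \<open>The theorem speaks of vector-valued integrands, so the real function is read
      as a map into \<open>real^1\<close>.\<close>
    using has_absolute_integral_change_of_variables[OF S der inj, of "\<lambda>y. vec (f y) :: real^1" "vec b"] fb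
    unfolding absolutely_integrable_on_1_iff integral_on_1_eq
    by (auto simp: has_integral_iff)
  then have "((\<lambda>x. \<bar>det (matrix (\<phi>' x))\<bar> * f (\<phi> x)) has_integral b) S"
    by (simp add: has_integral_iff absolutely_integrable_on_def)
  then have "((\<lambda>x. indicator S x * (\<bar>det (matrix (\<phi>' x))\<bar> * f (\<phi> x))) has_integral b) UNIV"
    unfolding indicator_times has_integral_restrict_UNIV .
  then show ?thesis
    using f(1) b by (subst (asm) has_integral_iff_nn_integral_lebesgue)
      (auto simp: nn_integral_completion indicator_def)
qed

text \<open>The change of variables theorem of the library needs a linearly ordered index type; every
  finite type can be replaced by a well-ordered copy of itself.\<close>

typedef (overloaded) ('a::finite) ordered_copy = "UNIV :: 'a set" by simp

instantiation ordered_copy :: (finite) wellorder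
begin

definition less_eq_ordered_copy :: "'a ordered_copy \<Rightarrow> 'a ordered_copy \<Rightarrow> bool" where
  "x \<le> y \<longleftrightarrow> to_nat (Rep_ordered_copy x) \<le> to_nat (Rep_ordered_copy y)"

definition less_ordered_copy :: "'a ordered_copy \<Rightarrow> 'a ordered_copy \<Rightarrow> bool" where
  "x < y \<longleftrightarrow> to_nat (Rep_ordered_copy x) < to_nat (Rep_ordered_copy y)"

instance
proof
  fix P :: "'a ordered_copy \<Rightarrow> bool" and a
  assume step: "\<And>x. (\<And>y. y < x \<Longrightarrow> P y) \<Longrightarrow> P x"
  show "P a"
    by (induction "to_nat (Rep_ordered_copy a)" arbitrary: a rule: less_induct)
      (rule step, simp add: less_ordered_copy_def)
qed (auto simp: less_eq_ordered_copy_def less_ordered_copy_def Rep_ordered_copy_inject)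

end

instance ordered_copy :: (finite) finite
proof
  show "finite (UNIV :: 'a ordered_copy set)"
    using finite_imageI[OF finite[of UNIV], of Abs_ordered_copy]
    by (metis Abs_ordered_copy_cases surj_def)
qed

definition reindex :: "('b \<Rightarrow> 'a) \<Rightarrow> real ^ 'a::finite \<Rightarrow> real ^ 'b::finite" where
  "reindex \<sigma> x = (\<chi> i. x $ \<sigma> i)"

lemma linear_reindex: "linear (reindex \<sigma>)"
  by (rule linearI) (auto simp: reindex_def vec_eq_iff)

lemma continuous_on_reindex: "continuous_on S (reindex \<sigma>)"
  by (simp add: linear_continuous_on linear_conv_bounded_linear[symmetric] linear_reindex)

lemma reindex_reindex [simp]:
  "\<sigma> \<circ> \<tau> = id \<Longrightarrow> reindex \<tau> (reindex \<sigma> x) = x"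
  by (simp add: reindex_def vec_eq_iff fun_eq_iff)

text \<open>Relabelling coordinates carries boxes to boxes with the same side lengths, and Lebesgue
  measure is determined by its values on boxes.\<close>

lemma distr_reindex:
  fixes \<sigma> :: "'b::finite \<Rightarrow> 'a::finite"
  assumes "bij \<sigma>"
  shows "distr lborel borel (reindex \<sigma>) = lborel"
proof (rule lborel_eqI[symmetric])
  fix l u :: "real ^ 'b" assume le: "\<And>b. b \<in> Basis \<Longrightarrow> l \<bullet> b \<le> u \<bullet> b"
  have sum_Basis: "(\<Prod>b\<in>Basis. w \<bullet> b) = (\<Prod>i\<in>UNIV. w $ i)" for w :: "real ^ 'n::finite"
  proof -
    have "bij_betw (\<lambda>i::'n. axis i (1::real)) UNIV Basis"
      by (auto simp: bij_betw_def inj_on_def axis_eq_axis Basis_vec_def)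
    then show ?thesis by (subst prod.reindex_bij_betw[symmetric]) (auto simp: inner_axis)
  qed
  let ?inv = "reindex (inv \<sigma>)"
  have inv: "\<sigma> (inv \<sigma> i) = i" "inv \<sigma> (\<sigma> j) = j" for i j
    using assms by (simp_all add: bij_is_surj surj_f_inv_f bij_is_inj)
  have "l $ j \<le> u $ j" for j using le[of "axis j 1"] by (simp add: inner_axis)
  then have le': "?inv l \<bullet> b \<le> ?inv u \<bullet> b" if "b \<in> Basis" for b
    using that by (auto simp: Basis_vec_def inner_axis reindex_def)
  have "reindex \<sigma> -` box l u = box (?inv l) (?inv u)"
    by (auto simp: mem_box_cart reindex_def) (metis inv)+
  then have "emeasure (distr lborel borel (reindex \<sigma>)) (box l u) = emeasure lborel (box (?inv l) (?inv u))"
    by (subst emeasure_distr) (auto intro: borel_measurable_continuous_onI continuous_on_reindex)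
  also have "\<dots> = ennreal (\<Prod>b\<in>Basis. (?inv u - ?inv l) \<bullet> b)"
    by (rule emeasure_lborel_box) (rule le')
  also have "(\<Prod>b\<in>Basis. (?inv u - ?inv l) \<bullet> b) = (\<Prod>i\<in>UNIV. (u - l) $ (inv \<sigma> i))"
    by (simp add: sum_Basis reindex_def)
  also have "\<dots> = (\<Prod>b\<in>Basis. (u - l) \<bullet> b)"
    unfolding sum_Basis using bij_imp_bij_inv[OF assms] by (rule prod.reindex_bij_betw)
  finally show "emeasure (distr lborel borel (reindex \<sigma>)) (box l u) = (\<Prod>b\<in>Basis. (u - l) \<bullet> b)" .
qed simp

text \<open>In the Leibniz formula the terms correspond under conjugation of permutations by
  \<open>\<sigma>\<close>, which preserves signs.\<close>

lemma det_reindex: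
  fixes M :: "real ^ 'a ^ 'a" and \<sigma> :: "'b::finite \<Rightarrow> 'a::finite"
  assumes "bij \<sigma>"
  shows "det (\<chi> i j. M $ \<sigma> i $ \<sigma> j) = det M"
proof -
  have inv: "\<sigma> (inv \<sigma> i) = i" "inv \<sigma> (\<sigma> j) = j" for i j
    using assms by (simp_all add: bij_is_surj surj_f_inv_f bij_is_inj)
  let ?m = "\<lambda>p x. \<sigma> (p (inv \<sigma> x))"
  have bij: "bij_betw ?m {p. p permutes UNIV} {p. p permutes UNIV}"
    using bij_betw_permutations[OF assms] by simp
  have "det (\<chi> i j. M $ \<sigma> i $ \<sigma> j) =
      (\<Sum>p\<in>{p. p permutes UNIV}. of_int (sign p) * (\<Prod>i\<in>UNIV. M $ \<sigma> i $ \<sigma> (p i)))"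
    by (simp add: det_def)
  also have "\<dots> = (\<Sum>p\<in>{p. p permutes UNIV}. of_int (sign (?m p)) * (\<Prod>i\<in>UNIV. M $ i $ ?m p i))"
  proof (intro sum.cong refl)
    fix p :: "'b \<Rightarrow> 'b" assume "p \<in> {p. p permutes UNIV}"
    then have "sign (map_permutation UNIV \<sigma> p) = sign p"
      using assms by (intro sign_map_permutation) (auto simp: bij_is_inj)
    moreover have "map_permutation UNIV \<sigma> p = ?m p"
      using assms by (auto simp: map_permutation_def restrict_id_def fun_eq_iff bij_is_surj)
    moreover have "(\<Prod>i\<in>UNIV. M $ \<sigma> i $ \<sigma> (p i)) = (\<Prod>i\<in>UNIV. M $ i $ ?m p i)"
      by (subst prod.reindex_bij_betw[OF assms, symmetric]) (simp add: inv)
    ultimately show "of_int (sign p) * (\<Prod>i\<in>UNIV. M $ \<sigma> i $ \<sigma> (p i)) =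
        of_int (sign (?m p)) * (\<Prod>i\<in>UNIV. M $ i $ ?m p i)" by simp
  qed
  also have "\<dots> = det M"
    unfolding det_def by (rule sum.reindex_bij_betw[OF bij])
  finally show ?thesis .
qed

lemma nn_integral_change_of_variables:
  fixes \<phi> :: "real ^ 'd::finite \<Rightarrow> real ^ 'd" and f :: "real ^ 'd \<Rightarrow> real"
  assumes S: "S \<in> sets borel"
    and der: "\<And>x. x \<in> S \<Longrightarrow> (\<phi> has_derivative \<phi>' x) (at x within S)"
    and inj: "inj_on \<phi> S"
    and f: "\<And>y. y \<in> \<phi> ` S \<Longrightarrow> 0 \<le> f y" "(\<lambda>y. indicator (\<phi> ` S) y * f y) \<in> borel_measurable borel"
    and det: "(\<lambda>x. indicator S x * (\<bar>det (matrix (\<phi>' x))\<bar> * f (\<phi> x))) \<in> borel_measurable borel"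
    and fin: "(\<integral>\<^sup>+ y. ennreal (indicator (\<phi> ` S) y * f y) \<partial>lborel) < \<infinity>"
  shows "(\<integral>\<^sup>+ x. ennreal (indicator S x * (\<bar>det (matrix (\<phi>' x))\<bar> * f (\<phi> x))) \<partial>lborel) =
         (\<integral>\<^sup>+ y. ennreal (indicator (\<phi> ` S) y * f y) \<partial>lborel)"
proof -
  define \<sigma> where "\<sigma> = (Rep_ordered_copy :: 'd ordered_copy \<Rightarrow> 'd)"
  define \<tau> where "\<tau> = (Abs_ordered_copy :: 'd \<Rightarrow> 'd ordered_copy)"
  \<comment> \<open>\<open>I\<close> and \<open>J\<close> are inverse relabellings between the
    original coordinates and those with ordered index type. Conjugating \<open>\<phi>\<close> by
    them changes neither integrals nor determinants.\<close>
  define I where "I = reindex \<sigma>"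
  define J where "J = reindex \<tau>"
  have inv: "\<sigma> \<circ> \<tau> = id" "\<tau> \<circ> \<sigma> = id"
    by (auto simp: \<sigma>_def \<tau>_def Abs_ordered_copy_inverse Rep_ordered_copy_inverse)
  then have bij: "bij \<sigma>" "bij \<tau>" using o_bij by blast+
  have JI [simp]: "J (I x) = x" and IJ [simp]: "I (J y) = y" for x y
    using inv by (simp_all add: I_def J_def)
  have [measurable]: "I \<in> borel_measurable borel" "J \<in> borel_measurable borel"
    unfolding I_def J_def by (auto intro: borel_measurable_continuous_onI continuous_on_reindex)
  have dJ: "distr lborel borel J = lborel" unfolding J_def by (rule distr_reindex[OF bij(2)])
  have transport: "(\<integral>\<^sup>+ x. ennreal (k x) \<partial>lborel) = (\<integral>\<^sup>+ x. ennreal (k (J x)) \<partial>lborel)"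
    if "k \<in> borel_measurable borel" for k
    by (subst dJ[symmetric], subst nn_integral_distr) (use that in auto)
  define S' where "S' = J -` S"
  define \<psi> where "\<psi> = I \<circ> \<phi> \<circ> J"
  define \<psi>' where "\<psi>' y = I \<circ> \<phi>' (J y) \<circ> J" for y
  have S'_eq: "S' = I ` S" by (force simp: S'_def)
  have S': "S' \<in> sets borel" unfolding S'_def using measurable_sets[of J borel borel S] S by simp
  have ind: "indicator (\<psi> ` S') y = (indicator (\<phi> ` S) (J y) :: real)" for y
  proof -
    have "y \<in> \<psi> ` S' \<longleftrightarrow> y \<in> I ` \<phi> ` S" by (simp add: \<psi>_def S'_eq image_comp o_def)
    also have "\<dots> \<longleftrightarrow> J y \<in> \<phi> ` S" by (metis JI IJ image_iff)
    finally show ?thesis by (simp add: indicator_def)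
  qed
  have bl: "bounded_linear I" "bounded_linear J"
    unfolding I_def J_def by (simp_all add: linear_conv_bounded_linear[symmetric] linear_reindex)
  have "(\<integral>\<^sup>+ x. ennreal (indicator S' x * (\<bar>det (matrix (\<psi>' x))\<bar> * (f \<circ> J) (\<psi> x))) \<partial>lborel) =
         (\<integral>\<^sup>+ y. ennreal (indicator (\<psi> ` S') y * (f \<circ> J) y) \<partial>lborel)"
  proof (rule nn_integral_change_of_variables_wellorder)
    show "S' \<in> sets lebesgue" using S' by simp
    show "(\<psi> has_derivative \<psi>' y) (at y within S')" if "y \<in> S'" for y
    proof -
      have "(\<phi> has_derivative \<phi>' (J y)) (at (J y) within J ` S')"
        using der[of "J y"] that by (auto simp: S'_eq image_comp o_def)
      then show ?thesis unfolding \<psi>_def \<psi>'_def o_assoc[symmetric]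
        by (intro diff_chain_within bounded_linear_imp_has_derivative bl)
    qed
    show "inj_on \<psi> S'"
      using inj unfolding inj_on_def \<psi>_def S'_eq by (auto) (metis JI)
    show "0 \<le> (f \<circ> J) y" if "y \<in> \<psi> ` S'" for y
      using that f(1) by (auto simp: \<psi>_def S'_eq)
    have "(\<lambda>y. indicator (\<phi> ` S) (J y) * f (J y)) \<in> borel_measurable borel"
      by (rule measurable_compose[OF _ f(2)]) simp
    then show "(\<lambda>y. indicator (\<psi> ` S') y * (f \<circ> J) y) \<in> borel_measurable lebesgue"
      by (simp add: ind o_def borel_measurable_if_I measurable_completion)
    show "(\<integral>\<^sup>+ y. ennreal (indicator (\<psi> ` S') y * (f \<circ> J) y) \<partial>lborel) < \<infinity>"
      using fin transport[OF f(2)] by (simp add: ind)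
  qed
  moreover have "det (matrix (\<psi>' x)) = det (matrix (\<phi>' (J x)))" if "x \<in> S'" for x
  proof -
    have "matrix (\<psi>' x) = (\<chi> i j. matrix (\<phi>' (J x)) $ \<sigma> i $ \<sigma> j)"
    proof -
      have J: "J (axis j 1) = axis (\<sigma> j) 1" for j
        using inv by (auto simp: J_def reindex_def axis_def vec_eq_iff fun_eq_iff)
      show ?thesis unfolding matrix_def \<psi>'_def by (simp add: J I_def reindex_def)
    qed
    then show ?thesis using det_reindex[OF bij(1)] by metis
  qed
  then have "(\<integral>\<^sup>+ x. ennreal (indicator S' x * (\<bar>det (matrix (\<psi>' x))\<bar> * (f \<circ> J) (\<psi> x))) \<partial>lborel)
      = (\<integral>\<^sup>+ x. ennreal (indicator S (J x) * (\<bar>det (matrix (\<phi>' (J x)))\<bar> * f (\<phi> (J x)))) \<partial>lborel)"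
    by (intro nn_integral_cong) (auto simp: \<psi>_def S'_def indicator_def)
  ultimately show ?thesis using transport[OF f(2)] transport[OF det] by (simp add: ind)
qed

section \<open>The Riemannian volume\<close>

locale riemannian_vol = riemannian A h
  for A :: "('x::{t2_space, second_countable_topology}, 'd::finite) chart set" and h +
  fixes vol :: "'x measure"
  assumes volume: "riemannian_volume A h vol"
begin

lemma sets_vol [measurable_cong, simp]: "sets vol = sets borel"
  using volume by (simp add: riemannian_volume_def)

lemma space_vol [simp]: "space vol = UNIV"
  using sets_eq_imp_space_eq[OF sets_vol] by simp

lemma continuous_on_vol_density:
  "c \<in> A \<Longrightarrow> continuous_on (snd c ` fst c) (\<lambda>y. vol_density c (chart_inv c y))"
proof -
  assume "c \<in> A"
  then have "continuous_on (snd c ` fst c) (\<lambda>y. gram A h c (chart_inv c y))"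
    using riem Ck_holder_on_imp_continuous_on unfolding riemannian_manifold_def smooth_on_def by blast
  then show ?thesis
    unfolding vol_density_def det_def by (intro continuous_intros)
qed

text \<open>Off the chart image \<open>chart_inv\<close> is not controlled. Fixing a constant value
  there gives a Borel function on the whole space; \<open>density_total\<close> below follows the
  same pattern.\<close>

definition chart_inv_total :: "('x, 'd) chart \<Rightarrow> real ^ 'd \<Rightarrow> 'x" where
  "chart_inv_total c y = (if y \<in> snd c ` fst c then chart_inv c y else undefined)"

lemma measurable_chart_inv_total:
  assumes "c \<in> A" shows "chart_inv_total c \<in> borel_measurable borel"
  unfolding chart_inv_total_def[abs_def]
  by (rule borel_measurable_continuous_on_if)
    (use assms open_chart_image continuous_on_chart_inv in auto)

definition density_total :: "('x, 'd) chart \<Rightarrow> real ^ 'd \<Rightarrow> real" where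
  "density_total c y = (if y \<in> snd c ` fst c then vol_density c (chart_inv c y) else 0)"

lemma measurable_density_total:
  assumes "c \<in> A" shows "density_total c \<in> borel_measurable borel"
  unfolding density_total_def[abs_def]
  by (rule borel_measurable_continuous_on_if)
    (use assms open_chart_image continuous_on_vol_density in auto)

lemma chart_image_eq:
  "c \<in> A \<Longrightarrow> B \<subseteq> fst c \<Longrightarrow> snd c ` B = snd c ` fst c \<inter> chart_inv_total c -` B"
  by (auto simp: chart_inv_total_def)

lemma borel_chart_image:
  assumes "c \<in> A" "B \<in> sets borel" "B \<subseteq> fst c" shows "snd c ` B \<in> sets borel"
  unfolding chart_image_eq[OF assms(1,3)]
  using measurable_sets[OF measurable_chart_inv_total[OF assms(1)] assms(2)]
    open_chart_image[OF assms(1)] by (intro sets.Int) auto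

lemma emeasure_vol_chart:
  assumes "c \<in> A" "B \<in> sets borel" "B \<subseteq> fst c"
  shows "emeasure vol B = (\<integral>\<^sup>+ y. ennreal (density_total c y) * indicator (snd c ` B) y \<partial>lborel)"
proof -
  have "emeasure vol B =
      (\<integral>\<^sup>+ y. ennreal (vol_density c (chart_inv c y)) * indicator (snd c ` B) y \<partial>lborel)"
    using volume assms unfolding riemannian_volume_def vol_density_def by blast
  also have "\<dots> = (\<integral>\<^sup>+ y. ennreal (density_total c y) * indicator (snd c ` B) y \<partial>lborel)"
  proof (intro nn_integral_cong)
    fix y
    have "y \<in> snd c ` B \<Longrightarrow> y \<in> snd c ` fst c" using assms(3) by blast
    then show "ennreal (vol_density c (chart_inv c y)) * indicator (snd c ` B) y =
        ennreal (density_total c y) * indicator (snd c ` B) y"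
      by (cases "y \<in> snd c ` B") (simp_all add: density_total_def)
  qed
  finally show ?thesis .
qed

text \<open>The volume is specified only on sets inside a chart. Its restriction to
  \<open>fst c\<close> therefore coincides, as a measure, with the image under the inverse chart of
  the measure with density \<open>density_total\<close>, and integrals follow.\<close>

lemma nn_integral_vol_chart:
  assumes c: "c \<in> A" and B: "B \<in> sets borel" "B \<subseteq> fst c" and k: "k \<in> borel_measurable borel"
  shows "(\<integral>\<^sup>+ x. k x * indicator B x \<partial>vol) =
    (\<integral>\<^sup>+ y. k (chart_inv_total c y) * ennreal (density_total c y) * indicator (snd c ` B) y \<partial>lborel)"
proof -
  note [measurable] = measurable_chart_inv_total[OF c] measurable_density_total[OF c] k B(1)
  have [measurable]: "fst c \<in> sets borel" using open_chart[OF c] by simp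
  define \<nu> where "\<nu> = distr (density lborel (\<lambda>y. ennreal (density_total c y))) borel (chart_inv_total c)"
  have eq: "density vol (indicator (fst c)) = \<nu>"
  proof (rule measure_eqI)
    fix C assume "C \<in> sets (density vol (indicator (fst c)))"
    then have C [measurable]: "C \<in> sets borel" by simp
    have "emeasure (density vol (indicator (fst c))) C = emeasure vol (fst c \<inter> C)"
      by (subst emeasure_density) (auto simp: nn_integral_indicator[symmetric] indicator_inter_arith simp del: nn_integral_indicator)
    also have "\<dots> = (\<integral>\<^sup>+ y. ennreal (density_total c y) * indicator (snd c ` (fst c \<inter> C)) y \<partial>lborel)"
      by (rule emeasure_vol_chart[OF c]) auto
    also have "\<dots> = (\<integral>\<^sup>+ y. ennreal (density_total c y) * indicator (chart_inv_total c -` C) y \<partial>lborel)"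
      unfolding chart_image_eq[OF c Int_lower1]
      by (intro nn_integral_cong)
        (auto simp: density_total_def chart_inv_total_def indicator_def chart_inv_in[OF c])
    also have "\<dots> = emeasure \<nu> C"
      unfolding \<nu>_def
     
      using measurable_sets[OF measurable_chart_inv_total[OF c] C]
      by (subst emeasure_distr, simp, simp, subst emeasure_density) auto
    finally show "emeasure (density vol (indicator (fst c))) C = emeasure \<nu> C" .
  qed (simp add: \<nu>_def)
  have "(\<integral>\<^sup>+ x. k x * indicator B x \<partial>vol) = (\<integral>\<^sup>+ x. indicator (fst c) x * (k x * indicator B x) \<partial>vol)"
    using B by (intro nn_integral_cong) (auto simp: indicator_def)
  also have "\<dots> = (\<integral>\<^sup>+ x. k x * indicator B x \<partial>density vol (indicator (fst c)))"
    by (rule nn_integral_density[symmetric]) auto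
  also have "\<dots> = (\<integral>\<^sup>+ y. k (chart_inv_total c y) * indicator B (chart_inv_total c y)
      \<partial>density lborel (\<lambda>y. ennreal (density_total c y)))"
    unfolding eq \<nu>_def by (rule nn_integral_distr) auto
  also have "\<dots> = (\<integral>\<^sup>+ y. ennreal (density_total c y) *
      (k (chart_inv_total c y) * indicator B (chart_inv_total c y)) \<partial>lborel)"
    by (rule nn_integral_density) auto
  also have "\<dots> = (\<integral>\<^sup>+ y. k (chart_inv_total c y) * ennreal (density_total c y) * indicator (snd c ` B) y \<partial>lborel)"
    by (intro nn_integral_cong, subst chart_image_eq[OF c B(2)])
      (auto simp: density_total_def indicator_def mult_ac)
  finally show ?thesis .
qed

text \<open>Change of variables on the manifold for a set that lies in one chart and whose image
  lies in one chart; it is reduced to the Euclidean formula for the coordinate expression of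
  \<open>f\<close>.\<close>

lemma nn_integral_abs_det_chart:
  assumes f: "C1_map A f" and fi: "C1_map A f'" "f' \<circ> f = id" "f \<circ> f' = id"
    and c: "c \<in> A" "c' \<in> A" and B: "B \<in> sets borel" "B \<subseteq> fst c" "f ` B \<subseteq> fst c'"
    and fin: "emeasure vol (f ` B) < \<infinity>"
  shows "(\<integral>\<^sup>+ x. ennreal (abs_det A h f x) * indicator B x \<partial>vol) = emeasure vol (f ` B)"
proof -
  have f'f: "f' (f x) = x" and ff': "f (f' x) = x" for x using fi(2,3) by (metis comp_apply id_apply)+
  have [measurable]: "f \<in> borel_measurable borel" "f' \<in> borel_measurable borel"
    using f fi(1) unfolding C1_map_def by (auto intro: borel_measurable_continuous_onI)
  have "f ` B = f' -` B"
  proof (intro equalityI subsetI)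
    fix y assume "y \<in> f' -` B"
    then show "y \<in> f ` B" using ff'[of y] by (metis image_eqI vimageD)
  qed (auto simp: f'f)
  then have fB: "f ` B \<in> sets borel"
    using measurable_sets[OF _ B(1), of f' borel] by simp
  have [measurable]: "abs_det A h f \<in> borel_measurable borel"
    using isCont_abs_det[OF f] by (intro borel_measurable_continuous_onI)
      (simp add: continuous_on_eq_continuous_at)
  note [measurable] = measurable_chart_inv_total[OF c(1)] measurable_density_total[OF c(1)] B(1)
    measurable_density_total[OF c(2)]
  define S where "S = snd c ` B"
  have S [measurable]: "S \<in> sets borel" unfolding S_def by (rule borel_chart_image) (use c B in auto)
  define \<phi> where "\<phi> = snd c' \<circ> f \<circ> chart_inv c"
  define \<phi>' where "\<phi>' y = local_deriv f c c' (chart_inv c y)" for y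
  have \<phi>S: "\<phi> ` S = snd c' ` f ` B"
    using B c by (auto simp: \<phi>_def S_def image_comp subset_iff image_iff)
  have Sc: "y \<in> snd c ` fst c" if "y \<in> S" for y using that B by (auto simp: S_def)
  have inS: "chart_inv c y \<in> B" if "y \<in> S" for y using that B c by (auto simp: S_def subset_iff)
  have at: "c \<in> charts_at A x" "c' \<in> charts_at A (f x)" if "x \<in> B" for x
    using that B c by (auto simp: charts_at_iff)
  \<comment> \<open>The density at the source cancels the denominator of \<open>abs_det\<close>;
    what remains is the Euclidean Jacobian times the density at the target, the integrand of the
    Euclidean formula.\<close>
  have chart_rule: "abs_det A h f (chart_inv_total c y) * density_total c y =
      \<bar>det (matrix (\<phi>' y))\<bar> * density_total c' (\<phi> y)" if "y \<in> S" for y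
  proof -
    let ?x = "chart_inv c y"
    have x: "?x \<in> B" using inS that by blast
    have "0 < vol_density c ?x" using vol_density_pos at x by blast
    moreover have "density_total c' (\<phi> y) = vol_density c' (f ?x)"
    proof -
      have "f ?x \<in> fst c'" using x B by blast
      then show ?thesis using c by (simp add: \<phi>_def density_total_def)
    qed
    ultimately show ?thesis
      using Sc[OF that] by (simp add: abs_det_eq[OF f at[OF x]] chart_inv_total_def density_total_def \<phi>'_def)
  qed
  have ind_eq: "ennreal (density_total c' y) * indicator (\<phi> ` S) y =
      ennreal (indicator (\<phi> ` S) y * density_total c' y)" for y
    by (auto simp: indicator_def)
  have fin': "emeasure vol (f ` B) = (\<integral>\<^sup>+ y. ennreal (indicator (\<phi> ` S) y * density_total c' y) \<partial>lborel)"
    unfolding emeasure_vol_chart[OF c(2) fB B(3)] \<phi>S[symmetric] ind_eq ..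
  have "(\<integral>\<^sup>+ x. ennreal (abs_det A h f x) * indicator B x \<partial>vol) =
      (\<integral>\<^sup>+ y. ennreal (abs_det A h f (chart_inv_total c y)) * ennreal (density_total c y) * indicator S y \<partial>lborel)"
    unfolding S_def by (rule nn_integral_vol_chart[OF c(1) B(1,2)]) simp
  also have "\<dots> = (\<integral>\<^sup>+ y. ennreal (indicator S y * (abs_det A h f (chart_inv_total c y) * density_total c y)) \<partial>lborel)"
    using abs_det_nonneg[OF f] by (intro nn_integral_cong) (auto simp: indicator_def ennreal_mult')
  also have "\<dots> = (\<integral>\<^sup>+ y. ennreal (indicator S y * (\<bar>det (matrix (\<phi>' y))\<bar> * density_total c' (\<phi> y))) \<partial>lborel)"
    using chart_rule by (intro nn_integral_cong) (auto simp: indicator_def)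
  also have "\<dots> = (\<integral>\<^sup>+ y. ennreal (indicator (\<phi> ` S) y * density_total c' y) \<partial>lborel)"
  proof (rule nn_integral_change_of_variables[OF S])
    show "(\<phi> has_derivative \<phi>' y) (at y within S)" if "y \<in> S" for y
    proof -
      have "(\<phi> has_derivative \<phi>' y) (at (snd c (chart_inv c y)))"
        unfolding \<phi>_def \<phi>'_def by (rule local_has_derivative[OF f]) (use at inS that in auto)
      then show ?thesis using Sc[OF that] c by (auto intro: has_derivative_at_withinI)
    qed
    show "inj_on \<phi> S"
    proof (rule inj_onI)
      fix y y' assume y: "y \<in> S" "y' \<in> S" and "\<phi> y = \<phi> y'"
      then have "f (chart_inv c y) = f (chart_inv c y')"
        using inj_on_chart[OF c(2)] inS B(3) unfolding \<phi>_def o_def inj_on_def by blast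
      then have "chart_inv c y = chart_inv c y'" using f'f by metis
      then show "y = y'" using Sc y c by (metis chart_chart_inv)
    qed
    have "density_total c' y \<ge> 0" for y
      using vol_density_pos[of c'] c chart_inv_in[of c']
      by (auto simp: density_total_def charts_at_iff intro!: less_imp_le[OF vol_density_pos])
    then show "0 \<le> density_total c' y" for y .
    have [measurable]: "\<phi> ` S \<in> sets borel" unfolding \<phi>S by (rule borel_chart_image) (use c fB B in auto)
    show "(\<lambda>y. indicator (\<phi> ` S) y * density_total c' y) \<in> borel_measurable borel" by measurable
    have "(\<lambda>y. indicator S y * (abs_det A h f (chart_inv_total c y) * density_total c y)) \<in> borel_measurable borel"
      by measurable
    then show "(\<lambda>y. indicator S y * (\<bar>det (matrix (\<phi>' y))\<bar> * density_total c' (\<phi> y))) \<in> borel_measurable borel"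
      by (rule measurable_cong[THEN iffD1, rotated]) (use chart_rule in \<open>auto simp: indicator_def\<close>)
    show "(\<integral>\<^sup>+ y. ennreal (indicator (\<phi> ` S) y * density_total c' y) \<partial>lborel) < \<infinity>"
      using fin unfolding fin' .
  qed
  finally show ?thesis unfolding fin' .
qed

text \<open>Each point has a neighbourhood that a chart maps into a closed ball inside its image.
  The density is bounded on this compact ball, and finitely many such neighbourhoods cover
  \<open>K\<close>.\<close>

lemma emeasure_vol_compact_finite:
  assumes K: "compact K" shows "emeasure vol K < \<infinity>"
proof -
  have "\<exists>W. open W \<and> x \<in> W \<and> emeasure vol W < \<infinity>" for x
  proof -
    obtain c where c: "c \<in> A" "x \<in> fst c" using charts_at_nonempty[of x] unfolding charts_at_iff by blast
    obtain e where e: "0 < e" "cball (snd c x) e \<subseteq> snd c ` fst c"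
      using open_chart_image[OF c(1)] c(2) by (meson image_eqI open_contains_cball)
    define W where "W = fst c \<inter> snd c -` ball (snd c x) e"
    have W: "open W" unfolding W_def
      using continuous_on_open_vimage[OF open_chart[OF c(1)]] continuous_on_chart[OF c(1)]
      by (metis Int_commute open_ball)
    obtain m where m: "\<And>y. y \<in> cball (snd c x) e \<Longrightarrow> norm (vol_density c (chart_inv c y)) \<le> m"
      using compact_imp_bounded[OF compact_continuous_image[OF
          continuous_on_subset[OF continuous_on_vol_density[OF c(1)] e(2)] compact_cball]]
      unfolding bounded_iff by blast
    have "emeasure vol W = (\<integral>\<^sup>+ y. ennreal (density_total c y) * indicator (snd c ` W) y \<partial>lborel)"
      using W by (intro emeasure_vol_chart c) (auto simp: W_def)
    also have "\<dots> \<le> (\<integral>\<^sup>+ y. ennreal m * indicator (cball (snd c x) e) y \<partial>lborel)"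
    proof (intro nn_integral_mono)
      fix y
      show "ennreal (density_total c y) * indicator (snd c ` W) y \<le> ennreal m * indicator (cball (snd c x) e) y"
      proof (cases "y \<in> snd c ` W")
        case True
        then have y: "y \<in> cball (snd c x) e" by (auto simp: W_def)
        then have "density_total c y \<le> m" using m[OF y] e by (auto simp: density_total_def)
        then show ?thesis using True y by (auto intro: ennreal_leI)
      qed simp
    qed
    also have "\<dots> = ennreal m * emeasure lborel (cball (snd c x) e)" by (simp add: nn_integral_cmult_indicator)
    also have "\<dots> < \<infinity>"
      using emeasure_lborel_cball_finite[of "snd c x" e] by (simp add: ennreal_mult_less_top)
    finally have "emeasure vol W < \<infinity>" .
    then show ?thesis using W c e by (auto simp: W_def)
  qed
  then obtain W where W: "\<And>x. open (W x)" "\<And>x. x \<in> W x" "\<And>x. emeasure vol (W x) < \<infinity>"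
    by metis
  obtain F where F: "F \<subseteq> K" "finite F" "K \<subseteq> (\<Union>x\<in>F. W x)"
    by (rule compactE_image[OF K, of K W]) (use W in blast)+
  have "emeasure vol K \<le> emeasure vol (\<Union>x\<in>F. W x)"
    by (rule emeasure_mono[OF F(3)]) (use W F in auto)
  also have "\<dots> \<le> (\<Sum>x\<in>F. emeasure vol (W x))"
    by (rule emeasure_subadditive_finite) (use W F in auto)
  also have "\<dots> < \<infinity>" using W F by (simp add: less_top)
  finally show ?thesis .
qed

lemma compact_finite_charts:
  assumes "compact K"
  obtains C where "finite C" "C \<subseteq> A" "K \<subseteq> (\<Union>c\<in>C. fst c)"
proof -
  have cover: "K \<subseteq> (\<Union>c\<in>A. fst c)" using atlas by (simp add: smooth_atlas_def)
  show thesis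
    by (rule compactE_image[OF assms _ cover]) (auto intro: open_chart that)
qed

text \<open>The point is that \<open>K\<close> depends only on \<open>V\<close> and
  \<open>V'\<close>, so it serves for all iterates at once. The set \<open>B\<close> is covered by
  pieces, one for each pair of charts from fixed finite covers, and each piece contributes at most
  the volume of \<open>V'\<close>; counting overlaps repeatedly does no harm.\<close>

lemma nn_integral_abs_det_bound:
  assumes V: "compact V" "compact V'"
  obtains K where "K < \<infinity>"
    "\<And>f f' B. \<lbrakk>C1_map A f; C1_map A f'; f' \<circ> f = id; f \<circ> f' = id; B \<in> sets borel; B \<subseteq> V; f ` B \<subseteq> V'\<rbrakk> \<Longrightarrow>
       (\<integral>\<^sup>+ x. ennreal (abs_det A h f x) * indicator B x \<partial>vol) \<le> K"
proof -
  obtain C where C: "finite C" "C \<subseteq> A" "V \<subseteq> (\<Union>c\<in>C. fst c)" using compact_finite_charts V by blast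
  obtain C' where C': "finite C'" "C' \<subseteq> A" "V' \<subseteq> (\<Union>c\<in>C'. fst c)" using compact_finite_charts V by blast
  define K where "K = (\<Sum>p\<in>C \<times> C'. emeasure vol V')"
  have V'_sets: "V' \<in> sets vol" using V by (simp add: compact_imp_closed)
  show thesis
  proof (rule that[of K])
    show "K < \<infinity>"
      using emeasure_vol_compact_finite[OF V(2)] C C' unfolding K_def
      by (simp add: ennreal_mult_less_top of_nat_less_top)
    fix f f' B assume f: "C1_map A f" "C1_map A f'" "f' \<circ> f = id" "f \<circ> f' = id"
      and B [measurable]: "B \<in> sets borel" and BV: "B \<subseteq> V" "f ` B \<subseteq> V'"
    have [measurable]: "abs_det A h f \<in> borel_measurable borel"
      using isCont_abs_det[OF f(1)] by (intro borel_measurable_continuous_onI)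
        (simp add: continuous_on_eq_continuous_at)
    define P where "P p = B \<inter> (fst (fst p) \<inter> f -` fst (snd p))" for p :: "('x, 'd) chart \<times> ('x, 'd) chart"
    have P [measurable]: "P p \<in> sets borel" if "p \<in> C \<times> C'" for p
      unfolding P_def using that C C' f
      by (intro sets.Int B borel_open open_preimage_chart) (auto simp: C1_map_def)
    have "(\<integral>\<^sup>+ x. ennreal (abs_det A h f x) * indicator B x \<partial>vol) \<le>
        (\<integral>\<^sup>+ x. (\<Sum>p\<in>C \<times> C'. ennreal (abs_det A h f x) * indicator (P p) x) \<partial>vol)"
    proof (intro nn_integral_mono)
      fix x
      show "ennreal (abs_det A h f x) * indicator B x \<le>
        (\<Sum>p\<in>C \<times> C'. ennreal (abs_det A h f x) * indicator (P p) x)"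
      proof (cases "x \<in> B")
        case True
        then obtain c c' where "c \<in> C" "x \<in> fst c" "c' \<in> C'" "f x \<in> fst c'"
          using BV C(3) C'(3) by blast
        then have "(c, c') \<in> C \<times> C'" "x \<in> P (c, c')" using True by (auto simp: P_def)
        then have "ennreal (abs_det A h f x) * indicator B x = ennreal (abs_det A h f x) * indicator (P (c, c')) x"
          using True by simp
        also have "\<dots> \<le> (\<Sum>p\<in>C \<times> C'. ennreal (abs_det A h f x) * indicator (P p) x)"
          using C(1) C'(1) \<open>(c, c') \<in> _\<close> by (intro member_le_sum) auto
        finally show ?thesis .
      qed simp
    qed
    also have "\<dots> = (\<Sum>p\<in>C \<times> C'. \<integral>\<^sup>+ x. ennreal (abs_det A h f x) * indicator (P p) x \<partial>vol)"
      by (rule nn_integral_sum) auto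
    also have "\<dots> \<le> K" unfolding K_def
    proof (intro sum_mono)
      fix p assume p: "p \<in> C \<times> C'"
      have sub: "f ` P p \<subseteq> V'" using BV by (auto simp: P_def)
      then have le: "emeasure vol (f ` P p) \<le> emeasure vol V'" by (intro emeasure_mono V'_sets)
      have "(\<integral>\<^sup>+ x. ennreal (abs_det A h f x) * indicator (P p) x \<partial>vol) = emeasure vol (f ` P p)"
        by (rule nn_integral_abs_det_chart[OF f, of "fst p" "snd p"])
          (use p C C' P le emeasure_vol_compact_finite[OF V(2)] in \<open>auto simp: P_def\<close>)
      with le show "(\<integral>\<^sup>+ x. ennreal (abs_det A h f x) * indicator (P p) x \<partial>vol) \<le> emeasure vol V'" by simp
    qed
    finally show "(\<integral>\<^sup>+ x. ennreal (abs_det A h f x) * indicator B x \<partial>vol) \<le> K" .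
  qed
qed

lemma nn_integral_normalised:
  obtains a where "a < \<infinity>"
    "\<And>k. k \<in> borel_measurable borel \<Longrightarrow> (\<integral>\<^sup>+ x. k x \<partial>normalised vol) = a * (\<integral>\<^sup>+ x. k x \<partial>vol)"
proof (cases "emeasure vol UNIV = \<infinity>")
  case True
  then show thesis by (intro that[of 1]) (auto simp: normalised_def)
next
  case False
  show thesis
  proof (cases "emeasure vol UNIV = 0")
    case True
    \<comment> \<open>For total mass 0 the normalising factor is infinite, but all integrals vanish,
      so the finite factor 0 is correct as well.\<close>
    have z: "(\<integral>\<^sup>+ x. k x \<partial>vol) = 0" if "k \<in> borel_measurable borel" for k :: "'x \<Rightarrow> ennreal"
    proof -
      have "UNIV \<in> null_sets vol" using True by (auto simp: null_sets_def)
      then have "AE x in vol. k x = 0" by (rule AE_I') auto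
      then show ?thesis using that by (simp add: nn_integral_0_iff_AE)
    qed
    show thesis
      by (rule that[of 0]) (use True z in \<open>auto simp: normalised_def nn_integral_scale_measure\<close>)
  next
    case nz: False
    show thesis
    proof (rule that[of "inverse (emeasure vol UNIV)"])
      show "inverse (emeasure vol UNIV) < \<infinity>" using nz
        by (metis ennreal_inverse_eq_top_iff infinity_ennreal_def top.not_eq_extremum)
    qed (use False in \<open>auto simp: normalised_def nn_integral_scale_measure\<close>)
  qed
qed

end

section \<open>Hyperbolic dynamics near the basic set\<close>

lemma geometric_bound_nonpos:
  fixes s c \<theta> :: real
  assumes "0 < \<theta>" "\<theta> < 1" "\<And>m. s \<le> c * \<theta> ^ m"
  shows "s \<le> 0"
proof -
  have "(\<lambda>m. c * \<theta> ^ m) \<longlonglongrightarrow> c * 0"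
    using assms by (intro tendsto_mult tendsto_const LIMSEQ_power_zero) auto
  then show ?thesis using assms(3) by (intro LIMSEQ_le_const[of "\<lambda>m. c * \<theta> ^ m"]) auto
qed

context riemannian
begin

definition unit_tangent :: "'x \<Rightarrow> ('x, 'd) tangent \<Rightarrow> ('x, 'd) tangent" where
  "unit_tangent x v = (\<lambda>c. (1 / tnorm h x v) *\<^sub>R v c)"

lemma unit_tangent_in: "v \<in> tangent_space A x \<Longrightarrow> unit_tangent x v \<in> tangent_space A x"
  unfolding unit_tangent_def by (rule tangent_space_scale)

lemma tnorm_unit_tangent:
  "v \<in> tangent_space A x \<Longrightarrow> v \<noteq> (\<lambda>_. 0) \<Longrightarrow> tnorm h x (unit_tangent x v) = 1"
  using tnorm_pos[of v x] by (simp add: unit_tangent_def tnorm_scale)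

lemma tnorm_map_unit_tangent:
  assumes "C1_map A f" "v \<in> tangent_space A x"
  shows "tnorm h (f x) (tangent_map A f x (unit_tangent x v)) =
    tnorm h (f x) (tangent_map A f x v) / tnorm h x v"
  using tnorm_nonneg[of v x] assms
  by (simp add: unit_tangent_def tangent_map_scale tnorm_scale tangent_map_in)

text \<open>By compactness of the unit sphere bundle over \<open>V\<close>: unit vectors stretched
  by more than \<open>Suc n\<close> would have a convergent subsequence, along which the stretching
  converges to a finite number.\<close>

lemma tangent_map_bounded:
  assumes f: "C1_map A f" and V: "compact V"
  obtains K where "1 \<le> K"
    "\<And>x v. x \<in> V \<Longrightarrow> v \<in> tangent_space A x \<Longrightarrow> tnorm h (f x) (tangent_map A f x v) \<le> K * tnorm h x v"
proof (rule ccontr)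
  assume "\<not> thesis"
  then have "\<exists>x v. x \<in> V \<and> v \<in> tangent_space A x \<and>
      real (Suc n) * tnorm h x v < tnorm h (f x) (tangent_map A f x v)" for n
    using that[of "real (Suc n)"] by (force simp: not_le)
  then obtain x v where x: "\<And>n. x n \<in> V" and v: "\<And>n. v n \<in> tangent_space A (x n)"
    and gt: "\<And>n. real (Suc n) * tnorm h (x n) (v n) < tnorm h (f (x n)) (tangent_map A f (x n) (v n))"
    by metis
  define u where "u n = unit_tangent (x n) (v n)" for n
  have nz: "v n \<noteq> (\<lambda>_. 0)" for n using gt[of n] by (auto simp: tangent_map_zero[OF f])
  have u: "u n \<in> tangent_space A (x n)" "tnorm h (x n) (u n) = 1" for n
    unfolding u_def using v nz by (auto intro: unit_tangent_in tnorm_unit_tangent)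
  have gt': "real (Suc n) < tnorm h (f (x n)) (tangent_map A f (x n) (u n))" for n
    using gt[of n] tnorm_pos[OF v nz, of n]
    unfolding u_def by (simp add: tnorm_map_unit_tangent[OF f v] field_simps)
  obtain z r where r: "strict_mono r" "(x \<circ> r) \<longlonglongrightarrow> z"
    using compact_imp_seq_compact[OF V] x unfolding seq_compact_def by meson
  obtain q w where q: "strict_mono q" "tendsto_tangent A (x \<circ> r \<circ> q) (u \<circ> r \<circ> q) z w"
    by (rule unit_tangents_compact[OF r(2), of "u \<circ> r"]) (use u in auto)
  define L where "L = tnorm h (f z) (tangent_map A f z w)"
  have "(\<lambda>n. tnorm h (f (x (r (q n)))) (tangent_map A f (x (r (q n))) (u (r (q n))))) \<longlonglongrightarrow> L"
    using tendsto_tnorm[OF tendsto_tangent_map[OF f q(2)]] by (simp add: L_def o_def)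
  then have "eventually (\<lambda>n. tnorm h (f (x (r (q n)))) (tangent_map A f (x (r (q n))) (u (r (q n)))) < L + 1) sequentially"
    by (rule order_tendstoD) simp
  moreover have "eventually (\<lambda>n. L + 1 \<le> real n) sequentially"
    using eventually_ge_at_top[of "nat \<lceil>L + 1\<rceil>"] by eventually_elim linarith
  ultimately have "eventually (\<lambda>n::nat. False) sequentially"
  proof eventually_elim
    case (elim n)
    have "n \<le> r (q n)" using seq_suble[OF r(1)] seq_suble[OF q(1)] le_trans by meson
    then show False using gt'[of "r (q n)"] elim by simp
  qed
  then show False by simp
qed

end

locale hyperbolic_dynamics = riemannian A h
  for A :: "('x::{t2_space, second_countable_topology}, 'd::finite) chart set" and h +
  fixes T :: "'x \<Rightarrow> 'x" and \<Lambda> V U :: "'x set" and Eu Es :: "'x \<Rightarrow> ('x, 'd) tangent set" and \<theta> :: real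
  assumes C1_T: "C1_map A T" and C1_inv: "C1_map A (inv T)" and bij_T: "bij T"
    and basic: "hyperbolic_basic_set A h T \<Lambda> \<theta> Eu Es"
    and iso: "isolating_neighbourhood T \<Lambda> V"
    and ext: "extended_splitting A h T V U \<theta> Eu Es"
begin

abbreviation TS where "TS \<equiv> tangent_space A"
abbreviation N where "N \<equiv> tnorm h"
abbreviation D where "D m \<equiv> tangent_map A (T ^^ m)"
abbreviation E where "E m \<equiv> tangent_map A (inv T ^^ m)"
abbreviation lam where "lam \<equiv> stable_rate A h T Es"
abbreviation nu where "nu \<equiv> unstable_rate A h T Eu"

text \<open>These are the points at which \<open>birkhoff_prod\<close> of length \<open>M\<close>
  can be nonzero. The endpoint \<open>(T ^^ M) x\<close> need not lie in \<open>V\<close>; for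
  positive \<open>M\<close> it lies in the image of \<open>V\<close> under \<open>T\<close>.\<close>

definition seg :: "nat \<Rightarrow> 'x set" where
  "seg M = {x. \<forall>k<M. (T ^^ k) x \<in> V}"

lemma inv_T [simp]: "inv T (T x) = x" "T (inv T x) = x"
  using bij_T by (auto simp: bij_is_inj bij_is_surj surj_f_inv_f)

lemma funpow_inv_T [simp]: "(inv T ^^ m) ((T ^^ m) x) = x" "(T ^^ m) ((inv T ^^ m) x) = x"
  by (induction m arbitrary: x) (simp_all add: funpow_swap1)

lemma inv_T_comp: "(inv T ^^ m) \<circ> (T ^^ m) = id" "(T ^^ m) \<circ> (inv T ^^ m) = id"
  by (auto simp: fun_eq_iff)

lemma C1_Tm: "C1_map A (T ^^ m)" and C1_invm: "C1_map A (inv T ^^ m)"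
  using C1_T C1_inv by (auto intro: C1_map_funpow)

lemma funpow_T_add: "(T ^^ (m + k)) x = (T ^^ k) ((T ^^ m) x)"
  by (metis add.commute comp_apply funpow_add)

lemma funpow_inv_T_diff: "i \<le> j \<Longrightarrow> (inv T ^^ i) ((T ^^ j) x) = (T ^^ (j - i)) x"
  using funpow_T_add[of "j - i" i x] by simp

lemma D_in: "v \<in> TS x \<Longrightarrow> D m x v \<in> TS ((T ^^ m) x)"
  by (rule tangent_map_in[OF C1_Tm])

lemma E_in: "v \<in> TS x \<Longrightarrow> E m x v \<in> TS ((inv T ^^ m) x)"
  by (rule tangent_map_in[OF C1_invm])

lemma D_add: "v \<in> TS x \<Longrightarrow> D (m + k) x v = D k ((T ^^ m) x) (D m x v)"
  using tangent_map_comp[OF C1_Tm C1_Tm, of v x k m] by (simp add: funpow_add[symmetric] add.commute)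

lemma D_0 [simp]: "v \<in> TS x \<Longrightarrow> D 0 x v = v"
  using tangent_map_id by (simp add: id_def[symmetric])

lemma ED [simp]: "v \<in> TS x \<Longrightarrow> E m ((T ^^ m) x) (D m x v) = v"
  using tangent_map_comp[OF C1_Tm C1_invm, of v x m m] by (simp add: inv_T_comp tangent_map_id)

lemma DE [simp]: "v \<in> TS x \<Longrightarrow> D m ((inv T ^^ m) x) (E m x v) = v"
  using tangent_map_comp[OF C1_invm C1_Tm, of v x m m] by (simp add: inv_T_comp tangent_map_id)

lemma E_D_diff: "v \<in> TS x \<Longrightarrow> i \<le> j \<Longrightarrow> E i ((T ^^ j) x) (D j x v) = D (j - i) x v"
  using D_add[of v x "j - i" i] ED[of "D (j - i) x v" "(T ^^ (j - i)) x" i] D_in[of v x "j - i"]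
    funpow_T_add[of "j - i" i x] by simp

lemma D_zero [simp]: "D m x (\<lambda>_. 0) = (\<lambda>_. 0)" and E_zero [simp]: "E m x (\<lambda>_. 0) = (\<lambda>_. 0)"
  using tangent_map_zero C1_Tm C1_invm by auto

lemma D_nonzero: "v \<in> TS x \<Longrightarrow> v \<noteq> (\<lambda>_. 0) \<Longrightarrow> D m x v \<noteq> (\<lambda>_. 0)"
  by (metis ED E_zero)

lemma compact_V: "compact V" and closed_V: "closed V"
  using iso compact_imp_closed by (auto simp: isolating_neighbourhood_def)

lemma \<theta>: "0 < \<theta>" "\<theta> < 1"
  using basic by (auto simp: hyperbolic_basic_set_def hyperbolic_splitting_def)

lemma \<theta>_power_le: "\<theta> ^ m \<le> 1"
  using \<theta> by (simp add: power_le_one)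

lemma compact_\<Lambda>: "compact \<Lambda>" and \<Lambda>_nonempty: "\<Lambda> \<noteq> {}"
  using basic by (auto simp: hyperbolic_basic_set_def)

lemma T_\<Lambda>: "z \<in> \<Lambda> \<Longrightarrow> (T ^^ m) z \<in> \<Lambda>"
proof (induction m)
  case (Suc m)
  then show ?case using basic by (auto simp: hyperbolic_basic_set_def)
qed simp

lemma inv_T_\<Lambda>: "z \<in> \<Lambda> \<Longrightarrow> (inv T ^^ m) z \<in> \<Lambda>"
proof (induction m)
  case (Suc m)
  then obtain y where "y \<in> \<Lambda>" "T y = (inv T ^^ m) z"
    using basic by (auto simp: hyperbolic_basic_set_def) (metis imageE)
  then show ?case by (metis comp_apply funpow.simps(2) inv_T(1))
qed simp

lemma \<Lambda>_seg: "z \<in> \<Lambda> \<Longrightarrow> z \<in> seg M"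
  using T_\<Lambda> iso interior_subset unfolding seg_def isolating_neighbourhood_def by blast

text \<open>\<open>V\<close> is closed, so the full orbit of the limit stays in \<open>V\<close>; as
  \<open>V\<close> is isolating, such an orbit belongs to \<open>\<Lambda>\<close>.\<close>

lemma \<Lambda>_limit:
  assumes p: "p \<longlonglongrightarrow> z"
    and fwd: "\<And>i. eventually (\<lambda>n. (T ^^ i) (p n) \<in> V) sequentially"
    and bwd: "\<And>i. eventually (\<lambda>n. (inv T ^^ i) (p n) \<in> V) sequentially"
  shows "z \<in> \<Lambda>"
proof -
  have "(T ^^ i) z \<in> V" for i
  proof (rule Lim_in_closed_set[OF closed_V fwd[of i]])
    show "(\<lambda>n. (T ^^ i) (p n)) \<longlonglongrightarrow> (T ^^ i) z"
      by (rule isCont_tendsto_compose[OF C1_map_continuous[OF C1_Tm] p])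
  qed simp
  moreover have "(inv T ^^ i) z \<in> V" for i
  proof (rule Lim_in_closed_set[OF closed_V bwd[of i]])
    show "(\<lambda>n. (inv T ^^ i) (p n)) \<longlonglongrightarrow> (inv T ^^ i) z"
      by (rule isCont_tendsto_compose[OF C1_map_continuous[OF C1_invm] p])
  qed simp
  ultimately have mem: "(T ^^ i) z \<in> V" "(inv T ^^ i) z \<in> V" for i by auto
  have "z \<in> int_iterate T k ` V" for k
  proof (cases "0 \<le> k")
    case True
    have "z = (T ^^ nat k) ((inv T ^^ nat k) z)" by simp
    then show ?thesis using mem(2)[of "nat k"] True unfolding int_iterate_def by force
  next
    case False
    have "z = (inv T ^^ nat (- k)) ((T ^^ nat (- k)) z)" by simp
    then show ?thesis using mem(1)[of "nat (- k)"] False unfolding int_iterate_def by force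
  qed
  then show ?thesis using iso by (auto simp: isolating_neighbourhood_def)
qed

lemma seg_diff: "x \<in> seg M \<Longrightarrow> i + m \<le> M \<Longrightarrow> (T ^^ i) x \<in> seg m"
  by (auto simp: seg_def funpow_T_add[symmetric])

lemma seg_V: "x \<in> seg M \<Longrightarrow> i < M \<Longrightarrow> (T ^^ i) x \<in> V"
  by (simp add: seg_def)

text \<open>Crude bounds used for the boundedly many steps near the ends of a segment and left over
  by the blocks. \<open>K\<close> bounds the derivative of \<open>T\<close> over \<open>V\<close>
  and that of \<open>inv T\<close> over the image of \<open>V\<close>.\<close>

lemma segment_growth:
  obtains K where "1 \<le> K"
    "\<And>M x v. x \<in> seg M \<Longrightarrow> v \<in> TS x \<Longrightarrow> N ((T ^^ M) x) (D M x v) \<le> K ^ M * N x v"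
    "\<And>M x v. x \<in> seg M \<Longrightarrow> v \<in> TS x \<Longrightarrow> N x v \<le> K ^ M * N ((T ^^ M) x) (D M x v)"
proof -
  obtain K1 where K1: "1 \<le> K1" "\<And>x v. x \<in> V \<Longrightarrow> v \<in> TS x \<Longrightarrow> N (T x) (tangent_map A T x v) \<le> K1 * N x v"
    using tangent_map_bounded[OF C1_T compact_V] by blast
  have "compact (T ` V)"
    using C1_T compact_V unfolding C1_map_def by (metis compact_continuous_image continuous_on_subset subset_UNIV)
  then obtain K2 where K2: "1 \<le> K2"
    "\<And>x v. x \<in> T ` V \<Longrightarrow> v \<in> TS x \<Longrightarrow> N (inv T x) (tangent_map A (inv T) x v) \<le> K2 * N x v"
    using tangent_map_bounded[OF C1_inv] by blast
  define K where "K = max K1 K2"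
  have K: "1 \<le> K" "0 \<le> K" using K1 by (auto simp: K_def)
  have step1: "N (T x) (D 1 x v) \<le> K * N x v" if "x \<in> V" "v \<in> TS x" for x v
  proof -
    have "N (T x) (D 1 x v) \<le> K1 * N x v" using K1(2)[OF that] by simp
    also have "\<dots> \<le> K * N x v" by (intro mult_right_mono tnorm_nonneg that) (simp add: K_def)
    finally show ?thesis .
  qed
  have step2: "N x v \<le> K * N (T x) (D 1 x v)" if "x \<in> V" "v \<in> TS x" for x v
  proof -
    have in': "D 1 x v \<in> TS (T x)" using D_in[OF that(2), of 1] by simp
    have "N x v \<le> K2 * N (T x) (D 1 x v)"
      using K2(2)[of "T x" "D 1 x v"] that in' ED[OF that(2), of 1] by simp
    also have "\<dots> \<le> K * N (T x) (D 1 x v)" by (intro mult_right_mono tnorm_nonneg in') (simp add: K_def)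
    finally show ?thesis .
  qed
  have both: "N ((T ^^ M) x) (D M x v) \<le> K ^ M * N x v \<and> N x v \<le> K ^ M * N ((T ^^ M) x) (D M x v)"
    if "x \<in> seg M" "v \<in> TS x" for M x v
    using that
  proof (induction M)
    case (Suc M)
    have x: "x \<in> seg M" "(T ^^ M) x \<in> V" using Suc.prems by (auto simp: seg_def)
    let ?w = "D M x v"
    have w: "?w \<in> TS ((T ^^ M) x)" by (rule D_in[OF Suc.prems(2)])
    have eq: "D (Suc M) x v = D 1 ((T ^^ M) x) ?w" using D_add[OF Suc.prems(2), of M 1] by simp
    have "N (T ((T ^^ M) x)) (D 1 ((T ^^ M) x) ?w) \<le> K * N ((T ^^ M) x) ?w"
      by (rule step1[OF x(2) w])
    also have "\<dots> \<le> K * (K ^ M * N x v)"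
      using Suc.IH[OF x(1) Suc.prems(2)] K by (intro mult_left_mono) auto
    finally have 1: "N ((T ^^ Suc M) x) (D (Suc M) x v) \<le> K ^ Suc M * N x v"
      unfolding eq by (simp add: mult.assoc)
    have "N x v \<le> K ^ M * N ((T ^^ M) x) ?w" using Suc.IH[OF x(1) Suc.prems(2)] by simp
    also have "\<dots> \<le> K ^ M * (K * N (T ((T ^^ M) x)) (D 1 ((T ^^ M) x) ?w))"
      using K by (intro mult_left_mono step2[OF x(2) w]) auto
    finally have "N x v \<le> K ^ Suc M * N ((T ^^ Suc M) x) (D (Suc M) x v)"
      unfolding eq by (simp add: mult_ac)
    with 1 show ?case by blast
  qed (simp add: tangent_map_id)
  show thesis by (rule that[OF K(1)]) (use both in blast)+
qed

section \<open>The invariant splitting over \<open>\<Lambda>\<close> and vectors with bounded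
  half-orbits\<close>

lemma splitting:
  assumes "z \<in> \<Lambda>"
  shows "Eu z \<subseteq> TS z" "Es z \<subseteq> TS z" "(\<lambda>_. 0) \<in> Eu z" "(\<lambda>_. 0) \<in> Es z"
    and "v \<in> TS z \<Longrightarrow> \<exists>a\<in>Eu z. \<exists>b\<in>Es z. v = (\<lambda>c. a c + b c)"
    and "v \<in> Eu z \<Longrightarrow> v \<in> Es z \<Longrightarrow> v = (\<lambda>_. 0)"
    and "tangent_map A T z ` Eu z = Eu (T z)" "tangent_map A T z ` Es z = Es (T z)"
proof -
  have sub: "tangent_subspace A z (Eu z)" "tangent_subspace A z (Es z)"
    and dec: "\<forall>v\<in>tangent_space A z. \<exists>!(a, b). a \<in> Eu z \<and> b \<in> Es z \<and> v = (\<lambda>c. a c + b c)"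
    using basic assms by (simp_all add: hyperbolic_basic_set_def hyperbolic_splitting_def)
  show s: "Eu z \<subseteq> TS z" "Es z \<subseteq> TS z" and 0: "(\<lambda>_. 0) \<in> Eu z" "(\<lambda>_. 0) \<in> Es z"
    using sub by (simp_all add: tangent_subspace_def)
  show "\<exists>a\<in>Eu z. \<exists>b\<in>Es z. v = (\<lambda>c. a c + b c)" if "v \<in> TS z"
    using bspec[OF dec that] by blast
  show "v = (\<lambda>_. 0)" if v: "v \<in> Eu z" "v \<in> Es z"
  proof -
    define P where "P = (\<lambda>(a, b). a \<in> Eu z \<and> b \<in> Es z \<and> v = (\<lambda>c. a c + b c))"
    have "v \<in> TS z" using v s by blast
    then have "\<exists>!ab. P ab" unfolding P_def by (rule bspec[OF dec])
    moreover have "P (v, \<lambda>_. 0)" "P (\<lambda>_. 0, v)" using v 0 by (auto simp: P_def)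
    ultimately have "(v, \<lambda>_. 0) = (\<lambda>_. 0, v)" by blast
    then show ?thesis by (rule Pair_inject)
  qed
qed (use basic assms in \<open>simp_all add: hyperbolic_basic_set_def hyperbolic_splitting_def\<close>)

lemma D_image_\<Lambda>:
  assumes "z \<in> \<Lambda>"
  shows "D m z ` Eu z = Eu ((T ^^ m) z)" "D m z ` Es z = Es ((T ^^ m) z)"
proof (induction m)
  case 0
  have "D 0 z ` F = F" if "F \<subseteq> TS z" for F
  proof -
    have "D 0 z ` F = (\<lambda>v. v) ` F" by (intro image_cong refl D_0) (use that in blast)
    then show ?thesis by simp
  qed
  from this[OF splitting(1)[OF assms]] this[OF splitting(2)[OF assms]]
  show "D 0 z ` Eu z = Eu ((T ^^ 0) z)" "D 0 z ` Es z = Es ((T ^^ 0) z)"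
    unfolding funpow.simps(1) id_apply .
next
  case (Suc m)
  have step: "D (Suc m) z ` F = tangent_map A T ((T ^^ m) z) ` (D m z ` F)" if "F \<subseteq> TS z" for F
    unfolding image_image
  proof (intro image_cong refl)
    fix v assume "v \<in> F"
    then have "v \<in> TS z" using that by blast
    then show "D (Suc m) z v = tangent_map A T ((T ^^ m) z) (D m z v)"
      using D_add[of v z m 1] by simp
  qed
  have "(T ^^ Suc m) z = T ((T ^^ m) z)" by simp
  show "D (Suc m) z ` Eu z = Eu ((T ^^ Suc m) z)" "D (Suc m) z ` Es z = Es ((T ^^ Suc m) z)"
    using splitting(7,8)[OF T_\<Lambda>[OF assms, of m]] Suc
    by (simp_all only: step[OF splitting(1)[OF assms]] step[OF splitting(2)[OF assms]]
        \<open>(T ^^ Suc m) z = T ((T ^^ m) z)\<close>)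
qed

lemma hyperbolicity:
  obtains C where "0 < C"
    "\<And>x m v. x \<in> \<Lambda> \<Longrightarrow> v \<in> Es x \<Longrightarrow> N ((T ^^ m) x) (D m x v) \<le> C * \<theta> ^ m * N x v"
    "\<And>x m v. x \<in> \<Lambda> \<Longrightarrow> v \<in> Eu x \<Longrightarrow> N ((inv T ^^ m) x) (E m x v) \<le> C * \<theta> ^ m * N x v"
proof -
  have "\<exists>C>0. \<forall>x\<in>\<Lambda>. \<forall>m.
        (\<forall>v\<in>Es x. N ((T ^^ m) x) (D m x v) \<le> C * \<theta> ^ m * N x v) \<and>
        (\<forall>v\<in>Eu x. N ((inv T ^^ m) x) (E m x v) \<le> C * \<theta> ^ m * N x v)"
    using basic unfolding hyperbolic_basic_set_def hyperbolic_splitting_def by blast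
  then show thesis using that by blast
qed

text \<open>The forward orbit of the unstable component \<open>a\<close> is bounded, being the
  difference of two bounded orbits. Returning from time \<open>m\<close> contracts unstable vectors
  by \<open>C * \<theta> ^ m\<close>, so letting \<open>m\<close> grow forces \<open>a\<close> to
  vanish.\<close>

lemma forward_bounded_imp_stable:
  assumes z: "z \<in> \<Lambda>" and v: "v \<in> TS z" and B: "\<And>m. N ((T ^^ m) z) (D m z v) \<le> B"
  shows "v \<in> Es z"
proof -
  obtain C where C: "0 < C"
    "\<And>x m v. x \<in> \<Lambda> \<Longrightarrow> v \<in> Es x \<Longrightarrow> N ((T ^^ m) x) (D m x v) \<le> C * \<theta> ^ m * N x v"
    "\<And>x m v. x \<in> \<Lambda> \<Longrightarrow> v \<in> Eu x \<Longrightarrow> N ((inv T ^^ m) x) (E m x v) \<le> C * \<theta> ^ m * N x v"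
    using hyperbolicity by blast
  obtain a b where ab: "a \<in> Eu z" "b \<in> Es z" "v = (\<lambda>c. a c + b c)" using splitting(5)[OF z v] by blast
  have TSab: "a \<in> TS z" "b \<in> TS z" using ab splitting(1,2)[OF z] by auto
  \<comment> \<open>The bound that \<open>tnorm_add_sq_le\<close> gives for the difference of the
    orbit of \<open>v\<close>, bounded by \<open>B\<close>, and the orbit of \<open>b\<close>,
    bounded by \<open>C * N z b\<close>.\<close>
  define R where "R = sqrt (2 * (B\<^sup>2 + (C * N z b)\<^sup>2))"
  have "N z a \<le> (C * R) * \<theta> ^ m" for m
  proof -
    let ?y = "(T ^^ m) z" and ?v = "D m z v" and ?a = "D m z a"
    define b' where "b' = (\<lambda>c. (-1) *\<^sub>R b c)"
    have b': "b' \<in> TS z" "N ?y (D m z b') = N ?y (D m z b)"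
      unfolding b'_def using TSab tnorm_scale[OF D_in, of b z m "-1"]
      by (auto simp: tangent_map_scale[OF C1_Tm, where a = "-1", simplified] intro: tangent_space_scale[where a = "-1", simplified])
    have "a = (\<lambda>c. v c + b' c)" by (simp add: ab(3) b'_def)
    then have "?a = (\<lambda>c. ?v c + D m z b' c)" by (simp add: tangent_map_add[OF C1_Tm])
    then have "(N ?y ?a)\<^sup>2 \<le> 2 * ((N ?y ?v)\<^sup>2 + (N ?y (D m z b'))\<^sup>2)"
      using tnorm_add_sq_le[OF D_in[OF v] D_in[OF b'(1)], of m] by simp
    also have "\<dots> \<le> 2 * (B\<^sup>2 + (C * N z b)\<^sup>2)"
    proof -
      have "N ?y (D m z b) \<le> C * \<theta> ^ m * N z b" by (rule C(2)[OF z ab(2)])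
      also have "\<dots> \<le> C * 1 * N z b"
        using C(1) \<theta>_power_le tnorm_nonneg[OF TSab(2)] by (intro mult_right_mono mult_left_mono) auto
      finally have "N ?y (D m z b') \<le> C * N z b" using b'(2) by simp
      then show ?thesis
        using B[of m] tnorm_nonneg[OF D_in[OF v], of m] tnorm_nonneg[OF D_in[OF b'(1)], of m]
        by (intro mult_left_mono add_mono power_mono) auto
    qed
    finally have a_le: "N ?y ?a \<le> R" unfolding R_def by (rule real_le_rsqrt)
    have "?a \<in> Eu ?y" using D_image_\<Lambda>(1)[OF z, of m] ab(1) by blast
    then have "N z a \<le> C * \<theta> ^ m * N ?y ?a" using C(3)[OF T_\<Lambda>[OF z, of m], of ?a m] TSab by simp
    also have "\<dots> \<le> C * \<theta> ^ m * R" using C(1) \<theta> a_le by (intro mult_left_mono) auto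
    finally show ?thesis by (simp add: mult_ac)
  qed
  then have "N z a \<le> 0" by (rule geometric_bound_nonpos[OF \<theta>])
  then have "a = (\<lambda>_. 0)" using tnorm_pos[OF TSab(1)] by force
  then show ?thesis using ab by simp
qed

text \<open>The mirror image: the stable component has a bounded backward orbit, and stable vectors
  contract on the way forward from time \<open>- m\<close> to 0.\<close>

lemma backward_bounded_imp_unstable:
  assumes z: "z \<in> \<Lambda>" and v: "v \<in> TS z" and B: "\<And>m. N ((inv T ^^ m) z) (E m z v) \<le> B"
  shows "v \<in> Eu z"
proof -
  obtain C where C: "0 < C"
    "\<And>x m v. x \<in> \<Lambda> \<Longrightarrow> v \<in> Es x \<Longrightarrow> N ((T ^^ m) x) (D m x v) \<le> C * \<theta> ^ m * N x v"
    "\<And>x m v. x \<in> \<Lambda> \<Longrightarrow> v \<in> Eu x \<Longrightarrow> N ((inv T ^^ m) x) (E m x v) \<le> C * \<theta> ^ m * N x v"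
    using hyperbolicity by blast
  obtain a b where ab: "a \<in> Eu z" "b \<in> Es z" "v = (\<lambda>c. a c + b c)" using splitting(5)[OF z v] by blast
  have TSab: "a \<in> TS z" "b \<in> TS z" using ab splitting(1,2)[OF z] by auto
  define R where "R = sqrt (2 * (B\<^sup>2 + (C * N z a)\<^sup>2))"
  have "N z b \<le> (C * R) * \<theta> ^ m" for m
  proof -
    let ?y = "(inv T ^^ m) z" and ?v = "E m z v" and ?b = "E m z b"
    define a' where "a' = (\<lambda>c. (-1) *\<^sub>R a c)"
    have a': "a' \<in> TS z" "N ?y (E m z a') = N ?y (E m z a)"
      unfolding a'_def using TSab tnorm_scale[OF E_in, of a z m "-1"]
      by (auto simp: tangent_map_scale[OF C1_invm, where a = "-1", simplified] intro: tangent_space_scale[where a = "-1", simplified])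
    have "b = (\<lambda>c. v c + a' c)" by (simp add: ab(3) a'_def)
    then have "?b = (\<lambda>c. ?v c + E m z a' c)" by (simp add: tangent_map_add[OF C1_invm])
    then have "(N ?y ?b)\<^sup>2 \<le> 2 * ((N ?y ?v)\<^sup>2 + (N ?y (E m z a'))\<^sup>2)"
      using tnorm_add_sq_le[OF E_in[OF v] E_in[OF a'(1)], of m] by simp
    also have "\<dots> \<le> 2 * (B\<^sup>2 + (C * N z a)\<^sup>2)"
    proof -
      have "N ?y (E m z a) \<le> C * \<theta> ^ m * N z a" by (rule C(3)[OF z ab(1)])
      also have "\<dots> \<le> C * 1 * N z a"
        using C(1) \<theta>_power_le tnorm_nonneg[OF TSab(1)] by (intro mult_right_mono mult_left_mono) auto
      finally have "N ?y (E m z a') \<le> C * N z a" using a'(2) by simp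
      then show ?thesis
        using B[of m] tnorm_nonneg[OF E_in[OF v], of m] tnorm_nonneg[OF E_in[OF a'(1)], of m]
        by (intro mult_left_mono add_mono power_mono) auto
    qed
    finally have b_le: "N ?y ?b \<le> R" unfolding R_def by (rule real_le_rsqrt)
    have y: "?y \<in> \<Lambda>" by (rule inv_T_\<Lambda>[OF z])
    \<comment> \<open>Invariance is known only for forward images, so a preimage of \<open>b\<close>
      in \<open>Es ?y\<close> is taken first and then identified with \<open>?b\<close> by
      injectivity.\<close>
    have "?b \<in> Es ?y"
    proof -
      obtain w where w: "w \<in> Es ?y" "D m ?y w = b"
        using D_image_\<Lambda>(2)[OF y, of m] ab(2) by (metis funpow_inv_T(2) imageE)
      then have "w \<in> TS ?y" using splitting(2)[OF y] by blast
      then have "E m z b = w" using ED[of w ?y m] w(2) by simp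
      then show ?thesis using w(1) by simp
    qed
    then have "N z b \<le> C * \<theta> ^ m * N ?y ?b" using C(2)[OF y, of ?b m] TSab by simp
    also have "\<dots> \<le> C * \<theta> ^ m * R" using C(1) \<theta> b_le by (intro mult_left_mono) auto
    finally show ?thesis by (simp add: mult_ac)
  qed
  then have "N z b \<le> 0" by (rule geometric_bound_nonpos[OF \<theta>])
  then have "b = (\<lambda>_. 0)" using tnorm_pos[OF TSab(2)] by force
  then show ?thesis using ab by simp
qed

end

section \<open>Rates of the extended bundles along orbit segments in \<open>V\<close>\<close>

context hyperbolic_dynamics
begin

lemma seg_in_U:
  assumes "x \<in> seg M" "0 < M" shows "x \<in> U" "(T ^^ M) x \<in> U"
proof -
  obtain m where M: "M = Suc m" using assms(2) gr0_implies_Suc by blast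
  have "V \<union> T ` V \<subseteq> U" using ext by (simp add: extended_splitting_def)
  moreover have "(T ^^ 0) x \<in> V" "(T ^^ m) x \<in> V"
    using seg_V[OF assms(1), of 0] seg_V[OF assms(1), of m] M by simp_all
  ultimately show "x \<in> U" "(T ^^ M) x \<in> U" unfolding M by auto
qed

lemma bundle_U:
  assumes "x \<in> U"
  shows "Eu x \<subseteq> TS x" "Es x \<subseteq> TS x" "\<exists>v\<in>Eu x. v \<noteq> (\<lambda>_. 0)" "\<exists>v\<in>Es x. v \<noteq> (\<lambda>_. 0)"
proof -
  have sub: "tangent_subspace A x (Eu x)" "tangent_subspace A x (Es x)"
    and nz: "Eu x \<noteq> {\<lambda>_. 0}" "Es x \<noteq> {\<lambda>_. 0}"
    using ext assms by (simp_all add: extended_splitting_def continuous_subbundle_def)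
  from sub show "Eu x \<subseteq> TS x" "Es x \<subseteq> TS x" by (simp_all add: tangent_subspace_def)
  have "(\<lambda>_. 0) \<in> Eu x" "(\<lambda>_. 0) \<in> Es x" using sub by (simp_all add: tangent_subspace_def)
  with nz show "\<exists>v\<in>Eu x. v \<noteq> (\<lambda>_. 0)" "\<exists>v\<in>Es x. v \<noteq> (\<lambda>_. 0)" by blast+
qed

text \<open>Positive length matters: for \<open>M = 0\<close> the set \<open>seg M\<close> is
  everything, whereas the bundles are controlled only on \<open>U\<close>. Taking \<open>C\<close>
  at least 1 allows it to absorb trivial estimates later.\<close>

lemma rate_constant:
  obtains C where "1 \<le> C"
    "\<And>M x. x \<in> seg M \<Longrightarrow> 0 < M \<Longrightarrow> lam M x \<le> C * \<theta> ^ M"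
    "\<And>M x. x \<in> seg M \<Longrightarrow> 0 < M \<Longrightarrow> 1 / (C * \<theta> ^ M) \<le> nu M x"
proof -
  obtain C where C: "0 < C" "\<forall>m. \<forall>x\<in>U \<inter> (\<Inter>k<m. (T ^^ k) -` V).
        lam m x \<le> C * \<theta> ^ m \<and> nu m x \<ge> inverse C * inverse \<theta> ^ m"
    using ext unfolding extended_splitting_def by blast
  define C' where "C' = max 1 C"
  have "lam M x \<le> C' * \<theta> ^ M \<and> 1 / (C' * \<theta> ^ M) \<le> nu M x" if x: "x \<in> seg M" "0 < M" for M x
  proof -
    have "x \<in> U \<inter> (\<Inter>k<M. (T ^^ k) -` V)" using seg_in_U[OF x] seg_V[OF x(1)] by auto
    then have 1: "lam M x \<le> C * \<theta> ^ M" "inverse C * inverse \<theta> ^ M \<le> nu M x" using C(2) by blast+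
    have 2: "C * \<theta> ^ M \<le> C' * \<theta> ^ M" "0 < C * \<theta> ^ M" using \<theta> C by (auto simp: C'_def)
    have "1 / (C' * \<theta> ^ M) \<le> 1 / (C * \<theta> ^ M)" using 2 by (intro divide_left_mono) auto
    also have "\<dots> = inverse C * inverse \<theta> ^ M" by (simp add: field_simps)
    finally show ?thesis using 1 2 by linarith
  qed
  then show thesis by (intro that[of C']) (auto simp: C'_def)
qed

context
  fixes M x assumes x: "x \<in> seg M" and M: "0 < M"
begin

lemma stable_ratios_bdd:
  "bdd_above {N ((T ^^ M) x) (D M x v) / N x v | v. v \<in> TS x \<and> D M x v \<in> Es ((T ^^ M) x) - {\<lambda>_. 0}}"
proof -
  obtain K where K: "1 \<le> K"
    "\<And>M x v. x \<in> seg M \<Longrightarrow> v \<in> TS x \<Longrightarrow> N ((T ^^ M) x) (D M x v) \<le> K ^ M * N x v"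
    using segment_growth by metis
  show ?thesis
  proof (rule bdd_aboveI[of _ "K ^ M"])
    fix s assume "s \<in> {N ((T ^^ M) x) (D M x v) / N x v | v. v \<in> TS x \<and> D M x v \<in> Es ((T ^^ M) x) - {\<lambda>_. 0}}"
    then obtain v where v: "v \<in> TS x" "D M x v \<noteq> (\<lambda>_. 0)" "s = N ((T ^^ M) x) (D M x v) / N x v"
      by blast
    then have "v \<noteq> (\<lambda>_. 0)" by auto
    then show "s \<le> K ^ M"
      using K(2)[OF x v(1)] tnorm_pos[OF v(1)] v(3) by (simp add: divide_le_eq)
  qed
qed

text \<open>The supremum defining \<open>lam\<close> is meaningful only over a nonempty set; pulling
  back a nonzero vector of the extended bundle at the endpoint gives an element.\<close>

lemma stable_vector: "\<exists>v\<in>TS x. D M x v \<in> Es ((T ^^ M) x) - {\<lambda>_. 0}"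
proof -
  obtain w where w: "w \<in> Es ((T ^^ M) x)" "w \<noteq> (\<lambda>_. 0)" "w \<in> TS ((T ^^ M) x)"
    using bundle_U[OF seg_in_U(2)[OF x M]] by blast
  then have "E M ((T ^^ M) x) w \<in> TS x" "D M x (E M ((T ^^ M) x) w) = w"
    using E_in[OF w(3), of M] DE[OF w(3), of M] by simp_all
  then show ?thesis using w by (intro bexI[of _ "E M ((T ^^ M) x) w"]) simp_all
qed

lemma le_stable_rate:
  assumes "v \<in> TS x" "D M x v \<in> Es ((T ^^ M) x)"
  shows "N ((T ^^ M) x) (D M x v) \<le> lam M x * N x v"
proof (cases "v = (\<lambda>_. 0)")
  case False
  then have "D M x v \<in> Es ((T ^^ M) x) - {\<lambda>_. 0}" using assms D_nonzero by simp
  then have "N ((T ^^ M) x) (D M x v) / N x v \<le> lam M x"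
    unfolding stable_rate_def using assms(1) by (intro cSup_upper stable_ratios_bdd) blast
  then show ?thesis using tnorm_pos[OF assms(1) False] by (simp add: divide_le_eq)
qed simp

lemma stable_rate_le:
  assumes "\<And>v. v \<in> TS x \<Longrightarrow> D M x v \<in> Es ((T ^^ M) x) \<Longrightarrow> N ((T ^^ M) x) (D M x v) \<le> B * N x v"
  shows "lam M x \<le> B"
  unfolding stable_rate_def
proof (rule cSup_least)
  fix s assume "s \<in> {N ((T ^^ M) x) (D M x v) / N x v | v. v \<in> TS x \<and> D M x v \<in> Es ((T ^^ M) x) - {\<lambda>_. 0}}"
  then obtain v where v: "s = N ((T ^^ M) x) (D M x v) / N x v" "v \<in> TS x" "D M x v \<in> Es ((T ^^ M) x)"
    "D M x v \<noteq> (\<lambda>_. 0)" by blast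
  then have "0 < N x v" by (intro tnorm_pos) auto
  then show "s \<le> B" using assms[OF v(2,3)] v(1) by (simp add: divide_le_eq)
qed (use stable_vector in blast)

lemma stable_rate_pos: "0 < lam M x"
proof -
  obtain v where v: "v \<in> TS x" "D M x v \<in> Es ((T ^^ M) x)" "D M x v \<noteq> (\<lambda>_. 0)"
    using stable_vector by blast
  then have "0 < N ((T ^^ M) x) (D M x v)" by (intro tnorm_pos D_in)
  also have "\<dots> \<le> lam M x * N x v" by (rule le_stable_rate[OF v(1,2)])
  finally show ?thesis using tnorm_nonneg[OF v(1)] by (simp add: zero_less_mult_iff)
qed

lemma unstable_in_TS: "v \<in> Eu x \<Longrightarrow> v \<in> TS x"
  using bundle_U(1)[OF seg_in_U(1)[OF x M]] by blast

lemma unstable_rate_le: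
  assumes v: "v \<in> Eu x" shows "nu M x * N x v \<le> N ((T ^^ M) x) (D M x v)"
proof (cases "v = (\<lambda>_. 0)")
  case False
  have pos: "0 < N x v" by (rule tnorm_pos[OF unstable_in_TS[OF v] False])
  have "nu M x \<le> N ((T ^^ M) x) (D M x v) / N x v"
    unfolding unstable_rate_def
  proof (rule cInf_lower)
    show "bdd_below {N ((T ^^ M) x) (D M x v) / N x v | v. v \<in> Eu x - {\<lambda>_. 0}}"
      by (rule bdd_belowI[of _ 0]) (auto intro!: divide_nonneg_nonneg tnorm_nonneg D_in unstable_in_TS)
  qed (use v False in blast)
  then show ?thesis using pos by (simp add: le_divide_eq)
qed simp

lemma le_unstable_rate:
  assumes "\<And>v. v \<in> Eu x \<Longrightarrow> B * N x v \<le> N ((T ^^ M) x) (D M x v)"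
  shows "B \<le> nu M x"
  unfolding unstable_rate_def
proof (rule cInf_greatest)
  fix s assume "s \<in> {N ((T ^^ M) x) (D M x v) / N x v | v. v \<in> Eu x - {\<lambda>_. 0}}"
  then obtain v where v: "s = N ((T ^^ M) x) (D M x v) / N x v" "v \<in> Eu x" "v \<noteq> (\<lambda>_. 0)" by blast
  then have "0 < N x v" by (intro tnorm_pos unstable_in_TS)
  then show "B \<le> s" using assms[OF v(2)] v(1) by (simp add: le_divide_eq)
qed (use bundle_U(3)[OF seg_in_U(1)[OF x M]] in blast)

lemma unstable_rate_pos: "0 < nu M x"
proof -
  obtain C where "1 \<le> C" "1 / (C * \<theta> ^ M) \<le> nu M x" using rate_constant x M by metis
  moreover have "0 < 1 / (C * \<theta> ^ M)" using \<theta> \<open>1 \<le> C\<close> by simp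
  ultimately show ?thesis by linarith
qed

end

section \<open>Limits of long orbit segments and comparison with points of
  \<open>\<Lambda>\<close>\<close>

lemma compact_orbit_limit:
  assumes p: "\<And>n. p n \<in> V" and fwd: "\<And>i. eventually (\<lambda>n. (T ^^ i) (p n) \<in> V) sequentially"
    and bwd: "\<And>i. eventually (\<lambda>n. (inv T ^^ i) (p n) \<in> V) sequentially"
  obtains r z where "strict_mono r" "(p \<circ> r) \<longlonglongrightarrow> z" "z \<in> \<Lambda>"
proof -
  obtain z r where r: "strict_mono r" "(p \<circ> r) \<longlonglongrightarrow> z"
    using compact_imp_seq_compact[OF compact_V] p unfolding seq_compact_def by meson
  have "z \<in> \<Lambda>"
    by (rule \<Lambda>_limit[OF r(2)]) (use eventually_subseq[OF r(1) fwd] eventually_subseq[OF r(1) bwd] in auto)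
  with r that show thesis by blast
qed

lemma tendsto_tangent_bound_fwd:
  assumes t: "tendsto_tangent A p w z w'"
    and ev: "eventually (\<lambda>n. N ((T ^^ i) (p n)) (D i (p n) (w n)) \<le> B) sequentially"
  shows "N ((T ^^ i) z) (D i z w') \<le> B"
  using tendsto_upperbound[OF tendsto_tnorm[OF tendsto_tangent_map[OF C1_Tm t]] ev] by simp

lemma tendsto_tangent_bound_bwd:
  assumes t: "tendsto_tangent A p w z w'"
    and ev: "eventually (\<lambda>n. N ((inv T ^^ i) (p n)) (E i (p n) (w n)) \<le> B) sequentially"
  shows "N ((inv T ^^ i) z) (E i z w') \<le> B"
  using tendsto_upperbound[OF tendsto_tnorm[OF tendsto_tangent_map[OF C1_invm t]] ev] by simp

text \<open>The norm along an orbit segment in \<open>V\<close> cannot be maximal far from both ends: in the limit this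
  would give a nonzero vector over \<open>\<Lambda>\<close> with bounded full orbit, contradicting hyperbolicity.\<close>

lemma no_interior_maximum:
  obtains L where "\<And>M y u j. \<lbrakk>y \<in> seg M; u \<in> TS y; u \<noteq> (\<lambda>_. 0); L \<le> j; j + L \<le> M\<rbrakk> \<Longrightarrow>
    \<exists>i\<le>M. N ((T ^^ j) y) (D j y u) < N ((T ^^ i) y) (D i y u)"
proof (rule ccontr)
  assume "\<not> thesis"
  have "\<exists>M y u j. y \<in> seg M \<and> u \<in> TS y \<and> u \<noteq> (\<lambda>_. 0) \<and> Suc n \<le> j \<and> j + Suc n \<le> M \<and>
      (\<forall>i\<le>M. N ((T ^^ i) y) (D i y u) \<le> N ((T ^^ j) y) (D j y u))" for n
  proof (rule ccontr)
    assume "\<nexists>M y u j. y \<in> seg M \<and> u \<in> TS y \<and> u \<noteq> (\<lambda>_. 0) \<and> Suc n \<le> j \<and> j + Suc n \<le> M \<and>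
      (\<forall>i\<le>M. N ((T ^^ i) y) (D i y u) \<le> N ((T ^^ j) y) (D j y u))"
    then have *: "\<And>M y u j. \<lbrakk>y \<in> seg M; u \<in> TS y; u \<noteq> (\<lambda>_. 0); Suc n \<le> j; j + Suc n \<le> M\<rbrakk> \<Longrightarrow>
      \<exists>i\<le>M. N ((T ^^ j) y) (D j y u) < N ((T ^^ i) y) (D i y u)"
      unfolding not_le[symmetric] by blast
    have thesis by (rule that[of "Suc n"]) (rule *)
    with \<open>\<not> thesis\<close> show False by simp
  qed
  then obtain M y u j where y: "\<And>n. y n \<in> seg (M n)" and u: "\<And>n. u n \<in> TS (y n)"
    and nz: "\<And>n. u n \<noteq> (\<lambda>_. 0)" and j: "\<And>n. Suc n \<le> j n" "\<And>n. j n + Suc n \<le> M n"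
    and mx: "\<And>n i. i \<le> M n \<Longrightarrow> N ((T ^^ i) (y n)) (D i (y n) (u n)) \<le> N ((T ^^ j n) (y n)) (D (j n) (y n) (u n))"
    by metis
  define p where "p n = (T ^^ j n) (y n)" for n
  define v where "v n = D (j n) (y n) (u n)" for n
  define w where "w n = unit_tangent (p n) (v n)" for n
  have v: "v n \<in> TS (p n)" "v n \<noteq> (\<lambda>_. 0)" for n
    unfolding v_def p_def using D_in u D_nonzero nz by auto
  have w: "w n \<in> TS (p n)" "N (p n) (w n) = 1" for n
    unfolding w_def using v by (auto intro: unit_tangent_in tnorm_unit_tangent)
  have seg: "(T ^^ i) (p n) \<in> V" if "i \<le> n" for i n
    unfolding p_def funpow_T_add[symmetric] using that j[of n] by (intro seg_V[OF y]) simp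
  have seg': "(inv T ^^ i) (p n) \<in> V" if "i \<le> n" for i n
    unfolding p_def using that j[of n] funpow_inv_T_diff[of i "j n" "y n"]
    by (auto intro!: seg_V[OF y])
  have fwd: "N ((T ^^ i) (p n)) (D i (p n) (w n)) \<le> 1" if "i \<le> n" for i n
    using mx[of "j n + i" n] that j[of n] tnorm_pos[OF v, of n]
    unfolding w_def tnorm_map_unit_tangent[OF C1_Tm v(1)]
    by (simp add: D_add[OF u] funpow_T_add v_def p_def)
  have bwd: "N ((inv T ^^ i) (p n)) (E i (p n) (w n)) \<le> 1" if "i \<le> n" for i n
    using mx[of "j n - i" n] that j[of n] tnorm_pos[OF v, of n]
    unfolding w_def tnorm_map_unit_tangent[OF C1_invm v(1)]
    by (simp add: E_D_diff[OF u] funpow_inv_T_diff v_def p_def)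
  have evI: "eventually Q sequentially" if "\<And>n. i \<le> n \<Longrightarrow> Q n" for Q and i :: nat
    using that unfolding eventually_sequentially by blast
  obtain r z where r: "strict_mono r" "(p \<circ> r) \<longlonglongrightarrow> z" and z: "z \<in> \<Lambda>"
    by (rule compact_orbit_limit[of p]) (use seg[of 0] in simp, auto intro: evI seg seg')
  obtain q w' where q: "strict_mono q" "tendsto_tangent A (p \<circ> r \<circ> q) (w \<circ> r \<circ> q) z w'" "N z w' = 1"
    by (rule unit_tangents_compact[OF r(2), of "w \<circ> r"]) (use w in auto)
  have rq: "n \<le> r (q n)" for n using seq_suble[OF r(1)] seq_suble[OF q(1)] le_trans by meson
  have w': "w' \<in> TS z" using q(2) by (simp add: tendsto_tangent_def)
  have "w' \<in> Es z"
    by (rule forward_bounded_imp_stable[OF z w' tendsto_tangent_bound_fwd[OF q(2)]], rule evI)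
      (use fwd rq le_trans in \<open>unfold comp_apply, blast\<close>)
  moreover have "w' \<in> Eu z"
    by (rule backward_bounded_imp_unstable[OF z w' tendsto_tangent_bound_bwd[OF q(2)]], rule evI)
      (use bwd rq le_trans in \<open>unfold comp_apply, blast\<close>)
  ultimately show False using splitting(6)[OF z] q(3) by fastforce
qed

text \<open>The maximal norm along the segment is attained within \<open>L\<close> steps of one of
  the ends, and \<open>K ^ L\<close> from \<open>segment_growth\<close> compares it with the norm at
  that end.\<close>

lemma segment_maximum_near_ends:
  obtains B where "1 \<le> B"
    "\<And>M y u j. \<lbrakk>y \<in> seg M; u \<in> TS y; j \<le> M\<rbrakk> \<Longrightarrow>
      N ((T ^^ j) y) (D j y u) \<le> B * N y u \<or>  N ((T ^^ j) y) (D j y u) \<le> B * N ((T ^^ M) y) (D M y u)"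
proof -
  obtain K where K: "1 \<le> K"
    "\<And>M x v. x \<in> seg M \<Longrightarrow> v \<in> TS x \<Longrightarrow> N ((T ^^ M) x) (D M x v) \<le> K ^ M * N x v"
    "\<And>M x v. x \<in> seg M \<Longrightarrow> v \<in> TS x \<Longrightarrow> N x v \<le> K ^ M * N ((T ^^ M) x) (D M x v)"
    using segment_growth by blast
  obtain L where L: "\<And>M y u j. \<lbrakk>y \<in> seg M; u \<in> TS y; u \<noteq> (\<lambda>_. 0); L \<le> j; j + L \<le> M\<rbrakk> \<Longrightarrow>
    \<exists>i\<le>M. N ((T ^^ j) y) (D j y u) < N ((T ^^ i) y) (D i y u)"
    using no_interior_maximum by blast
  show thesis
  proof (rule that[of "K ^ L"])
    show "1 \<le> K ^ L" using K(1) by simp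
    fix M y u j assume y: "y \<in> seg M" and u: "u \<in> TS y" and j: "j \<le> M"
    define s where "s i = N ((T ^^ i) y) (D i y u)" for i
    obtain j0 where j0: "j0 \<le> M" "\<And>i. i \<le> M \<Longrightarrow> s i \<le> s j0"
    proof -
      have "Max (s ` {..M}) \<in> s ` {..M}" by (rule Max_in) auto
      then obtain j0 where "j0 \<le> M" "s j0 = Max (s ` {..M})" by (metis atMost_iff imageE)
      then show thesis using that by simp
    qed
    have s0: "0 \<le> s i" for i unfolding s_def by (rule tnorm_nonneg[OF D_in[OF u]])
    have pow: "K ^ i * s l \<le> K ^ L * s l" if "i \<le> L" for i l
      using that K(1) s0 by (intro mult_right_mono power_increasing) auto
    show "N ((T ^^ j) y) (D j y u) \<le> K ^ L * N y u \<or> N ((T ^^ j) y) (D j y u) \<le> K ^ L * N ((T ^^ M) y) (D M y u)"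
    proof (cases "u = (\<lambda>_. 0)")
      case False
      have "\<not> (L \<le> j0 \<and> j0 + L \<le> M)"
        using L[OF y u False, of j0] j0(2) unfolding s_def by (meson not_le)
      then consider "j0 \<le> L" | "M - j0 \<le> L" by linarith
      then have "s j0 \<le> K ^ L * s 0 \<or> s j0 \<le> K ^ L * s M"
      proof cases
        case 1
        have "s j0 \<le> K ^ j0 * s 0"
          using K(2)[OF seg_diff[OF y, of 0 j0], of u] u j0(1) by (simp add: s_def tangent_map_id)
        then show ?thesis using pow[OF 1, of 0] by linarith
      next
        case 2
        have "s j0 \<le> K ^ (M - j0) * s M"
          using K(3)[OF seg_diff[OF y, of j0 "M - j0"] D_in[OF u]] j0(1) D_add[OF u, of j0 "M - j0"]
            funpow_T_add[of j0 "M - j0" y] by (simp add: s_def)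
        then show ?thesis using pow[OF 2, of M] by linarith
      qed
      then show ?thesis using j0(2)[OF j] u by (auto simp: s_def tangent_map_id)
    qed simp
  qed
qed

text \<open>Here the rate bound for the extended bundle enters: it makes the norm at the end at most
  \<open>C\<close> times the initial one, so both alternatives of the previous lemma give a bound by
  the initial norm, uniform in the length of the segment.\<close>

lemma stable_orbits_bounded:
  obtains B where "1 \<le> B"
    "\<And>M y u j. \<lbrakk>y \<in> seg M; u \<in> TS y; D M y u \<in> Es ((T ^^ M) y); j \<le> M\<rbrakk> \<Longrightarrow>
      N ((T ^^ j) y) (D j y u) \<le> B * N y u"
proof -
  obtain B where B: "1 \<le> B"
    "\<And>M y u j. \<lbrakk>y \<in> seg M; u \<in> TS y; j \<le> M\<rbrakk> \<Longrightarrow>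
      N ((T ^^ j) y) (D j y u) \<le> B * N y u \<or>  N ((T ^^ j) y) (D j y u) \<le> B * N ((T ^^ M) y) (D M y u)"
    using segment_maximum_near_ends by blast
  obtain C where C: "1 \<le> C" "\<And>M x. x \<in> seg M \<Longrightarrow> 0 < M \<Longrightarrow> lam M x \<le> C * \<theta> ^ M"
    using rate_constant by metis
  show thesis
  proof (rule that[of "B * C"])
    have "1 * 1 \<le> B * C" using B(1) C(1) by (intro mult_mono) auto
    then show BC: "1 \<le> B * C" by simp
    fix M y u j assume y: "y \<in> seg M" and u: "u \<in> TS y" "D M y u \<in> Es ((T ^^ M) y)" and j: "j \<le> M"
    have n0: "0 \<le> N y u" by (rule tnorm_nonneg[OF u(1)])
    show "N ((T ^^ j) y) (D j y u) \<le> B * C * N y u"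
    proof (cases "M = 0")
      case True
      then show ?thesis using j u mult_right_mono[OF BC n0] by (simp add: tangent_map_id)
    next
      case False
      have "N ((T ^^ M) y) (D M y u) \<le> lam M y * N y u" using le_stable_rate[OF y _ u] False by simp
      also have "\<dots> \<le> C * \<theta> ^ M * N y u" using C(2)[OF y] False n0 by (intro mult_right_mono) auto
      also have "\<dots> \<le> C * 1 * N y u" using C(1) \<theta>_power_le n0 by (intro mult_right_mono mult_left_mono) auto
      finally have "B * N ((T ^^ M) y) (D M y u) \<le> B * (C * N y u)" using B(1) by (intro mult_left_mono) auto
      moreover have "B * N y u \<le> B * (C * N y u)" using B(1) C(1) n0 mult_right_mono[OF C(1) n0] by (intro mult_left_mono) auto
      ultimately show ?thesis using B(2)[OF y u(1) j] by (simp add: mult.assoc) linarith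
    qed
  qed
qed

text \<open>Dually, the lower bound on \<open>nu\<close> controls the initial norm by the final one,
  so the final norm dominates along the whole segment.\<close>

lemma unstable_orbits_bounded:
  obtains B where "1 \<le> B"
    "\<And>M y u j. \<lbrakk>y \<in> seg M; 0 < M; u \<in> Eu y; j \<le> M\<rbrakk> \<Longrightarrow>
      N ((T ^^ j) y) (D j y u) \<le> B * N ((T ^^ M) y) (D M y u)"
proof -
  obtain B where B: "1 \<le> B"
    "\<And>M y u j. \<lbrakk>y \<in> seg M; u \<in> TS y; j \<le> M\<rbrakk> \<Longrightarrow>
      N ((T ^^ j) y) (D j y u) \<le> B * N y u \<or>  N ((T ^^ j) y) (D j y u) \<le> B * N ((T ^^ M) y) (D M y u)"
    using segment_maximum_near_ends by blast
  obtain C where C: "1 \<le> C" "\<And>M x. x \<in> seg M \<Longrightarrow> 0 < M \<Longrightarrow> 1 / (C * \<theta> ^ M) \<le> nu M x"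
    using rate_constant by metis
  show thesis
  proof (rule that[of "B * C"])
    have "1 * 1 \<le> B * C" using B(1) C(1) by (intro mult_mono) auto
    then show "1 \<le> B * C" by simp
    fix M y u j assume y: "y \<in> seg M" and M: "0 < M" and u: "u \<in> Eu y" and j: "j \<le> M"
    have uT: "u \<in> TS y" by (rule unstable_in_TS[OF y M u])
    let ?e = "N ((T ^^ M) y) (D M y u)"
    have n0: "0 \<le> N y u" "0 \<le> ?e" using tnorm_nonneg uT D_in by auto
    have pos: "0 < C * \<theta> ^ M" using C \<theta> by simp
    have "1 / (C * \<theta> ^ M) * N y u \<le> nu M y * N y u" by (intro mult_right_mono C(2) y M n0)
    also have "\<dots> \<le> ?e" by (rule unstable_rate_le[OF y M u])
    finally have "N y u \<le> C * \<theta> ^ M * ?e" using pos by (simp add: divide_le_eq mult_ac)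
    also have "\<dots> \<le> C * 1 * ?e" using C(1) \<theta>_power_le n0 by (intro mult_right_mono mult_left_mono) auto
    finally have "B * N y u \<le> B * (C * ?e)" using B(1) by (intro mult_left_mono) auto
    moreover have "B * ?e \<le> B * (C * ?e)" using B(1) mult_right_mono[OF C(1) n0(2)] by (intro mult_left_mono) auto
    ultimately show "N ((T ^^ j) y) (D j y u) \<le> B * C * ?e"
      using B(2)[OF y uT j] by (simp add: mult.assoc) linarith
  qed
qed

text \<open>\<open>Es\<close> at the far end says nothing directly about the vector at
  \<open>p n\<close>. By \<open>stable_orbits_bounded\<close>, however, a limit of normalised
  violators has a bounded forward orbit, hence lies in \<open>Es z\<close>, where
  \<open>lam k z\<close> does bound the growth over \<open>k\<close> steps.\<close>

lemma eventually_stable_block: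
  assumes p: "p \<longlonglongrightarrow> z" and z: "z \<in> \<Lambda>" and seg: "\<And>n. p n \<in> seg (M n)"
    and M: "\<And>i. eventually (\<lambda>n. i \<le> M n) sequentially" and \<eta>: "0 < \<eta>" and k: "0 < k"
  shows "eventually (\<lambda>n. \<forall>u\<in>TS (p n). D (M n) (p n) u \<in> Es ((T ^^ M n) (p n)) \<longrightarrow>
    N ((T ^^ k) (p n)) (D k (p n) u) \<le> (1 + \<eta>) * lam k z * N (p n) u) sequentially"
proof (rule ccontr)
  assume "\<not> ?thesis"
  from not_eventually_sequentiallyD[OF this] obtain r where r: "strict_mono (r :: nat \<Rightarrow> nat)"
    "\<And>n. \<exists>u\<in>TS (p (r n)). D (M (r n)) (p (r n)) u \<in> Es ((T ^^ M (r n)) (p (r n))) \<and>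
      (1 + \<eta>) * lam k z * N (p (r n)) u < N ((T ^^ k) (p (r n))) (D k (p (r n)) u)"
    by (auto simp: not_le)
  then obtain u where u: "\<And>n. u n \<in> TS (p (r n))"
    "\<And>n. D (M (r n)) (p (r n)) (u n) \<in> Es ((T ^^ M (r n)) (p (r n)))"
    "\<And>n. (1 + \<eta>) * lam k z * N (p (r n)) (u n) < N ((T ^^ k) (p (r n))) (D k (p (r n)) (u n))"
    by metis
  obtain B where B: "\<And>M y u j. \<lbrakk>y \<in> seg M; u \<in> TS y; D M y u \<in> Es ((T ^^ M) y); j \<le> M\<rbrakk> \<Longrightarrow>
      N ((T ^^ j) y) (D j y u) \<le> B * N y u"
    using stable_orbits_bounded by metis
  have nz: "u n \<noteq> (\<lambda>_. 0)" for n using u(3)[of n] by auto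
  define w where "w n = unit_tangent (p (r n)) (u n)" for n
  have w: "w n \<in> TS (p (r n))" "N (p (r n)) (w n) = 1" for n
    unfolding w_def using u nz by (auto intro: unit_tangent_in tnorm_unit_tangent)
  obtain q w' where q: "strict_mono q" "tendsto_tangent A (p \<circ> r \<circ> q) (w \<circ> q) z w'" "N z w' = 1"
    by (rule unit_tangents_compact[OF LIMSEQ_subseq_LIMSEQ[OF p r(1)], of w]) (use w in auto)
  have w': "w' \<in> TS z" using q(2) by (simp add: tendsto_tangent_def)
  have "N ((T ^^ i) z) (D i z w') \<le> B" for i
  proof (rule tendsto_tangent_bound_fwd[OF q(2)])
    have "eventually (\<lambda>n. i \<le> M (r (q n))) sequentially"
      using eventually_subseq[OF strict_mono_compose[OF r(1) q(1)] M[of i]] by simp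
    then show "eventually (\<lambda>n. N ((T ^^ i) ((p \<circ> r \<circ> q) n)) (D i ((p \<circ> r \<circ> q) n) ((w \<circ> q) n)) \<le> B) sequentially"
    proof eventually_elim
      case (elim n)
      then show ?case
        using B[OF seg u(1,2) elim] tnorm_pos[OF u(1) nz, of "q n"]
        by (simp add: w_def tnorm_map_unit_tangent[OF C1_Tm u(1)] divide_le_eq)
    qed
  qed
  then have w's: "w' \<in> Es z" by (rule forward_bounded_imp_stable[OF z w'])
  have "D k z w' \<in> Es ((T ^^ k) z)" using D_image_\<Lambda>(2)[OF z, of k] w's by blast
  then have up: "N ((T ^^ k) z) (D k z w') \<le> lam k z"
    using le_stable_rate[OF \<Lambda>_seg[OF z] k w'] q(3) by simp
  \<comment> \<open>In the limit the violated inequality only becomes weak; the factor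
    \<open>1 + \<eta>\<close> together with positivity of \<open>lam k z\<close> still yields a
    contradiction.\<close>
  have "(1 + \<eta>) * lam k z \<le> N ((T ^^ k) z) (D k z w')"
  proof (rule tendsto_lowerbound[OF tendsto_tnorm[OF tendsto_tangent_map[OF C1_Tm q(2)]]])
    show "eventually (\<lambda>n. (1 + \<eta>) * lam k z \<le> N ((T ^^ k) ((p \<circ> r \<circ> q) n)) (D k ((p \<circ> r \<circ> q) n) ((w \<circ> q) n))) sequentially"
    proof (rule always_eventually, rule allI)
      fix n
      show "(1 + \<eta>) * lam k z \<le> N ((T ^^ k) ((p \<circ> r \<circ> q) n)) (D k ((p \<circ> r \<circ> q) n) ((w \<circ> q) n))"
        using u(3)[of "q n"] tnorm_pos[OF u(1) nz, of "q n"]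
        by (simp add: w_def tnorm_map_unit_tangent[OF C1_Tm u(1)] le_divide_eq)
    qed
  qed simp
  moreover have "0 < \<eta> * lam k z" using stable_rate_pos[OF \<Lambda>_seg[OF z] k] \<eta> by simp
  ultimately show False using up by (simp add: algebra_simps)
qed

text \<open>The time-reversed argument: vectors start in the extended \<open>Eu\<close> at
  \<open>x n\<close> and are examined after \<open>I n\<close> steps. Their past is bounded by their
  present norm, so normalised limits have bounded backward orbits and lie in
  \<open>Eu z\<close>.\<close>

lemma eventually_unstable_block:
  assumes p: "p \<longlonglongrightarrow> z" and z: "z \<in> \<Lambda>" and seg: "\<And>n. x n \<in> seg (I n)"
    and px: "\<And>n. p n = (T ^^ I n) (x n)" and I0: "\<And>n. 0 < I n"
    and I: "\<And>i. eventually (\<lambda>n. i \<le> I n) sequentially" and \<eta>: "0 < \<eta>" and k: "0 < k"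
  shows "eventually (\<lambda>n. \<forall>u\<in>Eu (x n). nu k z * N (p n) (D (I n) (x n) u) \<le>
    (1 + \<eta>) * N ((T ^^ k) (p n)) (D k (p n) (D (I n) (x n) u))) sequentially"
proof (rule ccontr)
  assume "\<not> ?thesis"
  from not_eventually_sequentiallyD[OF this] obtain r where r: "strict_mono (r :: nat \<Rightarrow> nat)"
    "\<And>n. \<exists>u\<in>Eu (x (r n)). (1 + \<eta>) * N ((T ^^ k) (p (r n))) (D k (p (r n)) (D (I (r n)) (x (r n)) u)) <
       nu k z * N (p (r n)) (D (I (r n)) (x (r n)) u)"
    by (auto simp: not_le)
  then obtain u where u: "\<And>n. u n \<in> Eu (x (r n))"
    "\<And>n. (1 + \<eta>) * N ((T ^^ k) (p (r n))) (D k (p (r n)) (D (I (r n)) (x (r n)) (u n))) <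
       nu k z * N (p (r n)) (D (I (r n)) (x (r n)) (u n))"
    by metis
  obtain B where B: "\<And>M y u j. \<lbrakk>y \<in> seg M; 0 < M; u \<in> Eu y; j \<le> M\<rbrakk> \<Longrightarrow>
      N ((T ^^ j) y) (D j y u) \<le> B * N ((T ^^ M) y) (D M y u)"
    using unstable_orbits_bounded by metis
  have uT: "u n \<in> TS (x (r n))" for n by (rule unstable_in_TS[OF seg I0 u(1)])
  define v where "v n = D (I (r n)) (x (r n)) (u n)" for n
  have v: "v n \<in> TS (p (r n))" for n unfolding v_def px by (rule D_in[OF uT])
  have nz: "v n \<noteq> (\<lambda>_. 0)" for n using u(2)[of n] by (auto simp: v_def[symmetric])
  define w where "w n = unit_tangent (p (r n)) (v n)" for n
  have w: "w n \<in> TS (p (r n))" "N (p (r n)) (w n) = 1" for n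
    unfolding w_def using v nz by (auto intro: unit_tangent_in tnorm_unit_tangent)
  obtain q w' where q: "strict_mono q" "tendsto_tangent A (p \<circ> r \<circ> q) (w \<circ> q) z w'" "N z w' = 1"
    by (rule unit_tangents_compact[OF LIMSEQ_subseq_LIMSEQ[OF p r(1)], of w]) (use w in auto)
  have w': "w' \<in> TS z" using q(2) by (simp add: tendsto_tangent_def)
  have "N ((inv T ^^ i) z) (E i z w') \<le> B" for i
  proof (rule tendsto_tangent_bound_bwd[OF q(2)])
    have "eventually (\<lambda>n. i \<le> I (r (q n))) sequentially"
      using eventually_subseq[OF strict_mono_compose[OF r(1) q(1)] I[of i]] by simp
    then show "eventually (\<lambda>n. N ((inv T ^^ i) ((p \<circ> r \<circ> q) n)) (E i ((p \<circ> r \<circ> q) n) ((w \<circ> q) n)) \<le> B) sequentially"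
    proof eventually_elim
      case (elim n)
      have "N ((inv T ^^ i) (p (r (q n)))) (E i (p (r (q n))) (v (q n))) \<le> B * N (p (r (q n))) (v (q n))"
        using B[OF seg I0 u(1), of "I (r (q n)) - i" "q n"] elim
        by (simp add: v_def px E_D_diff[OF uT] funpow_inv_T_diff)
      then show ?case
        using tnorm_pos[OF v nz, of "q n"]
        by (simp add: w_def tnorm_map_unit_tangent[OF C1_invm v] divide_le_eq)
    qed
  qed
  then have w'u: "w' \<in> Eu z" by (rule backward_bounded_imp_unstable[OF z w'])
  have lo: "nu k z \<le> N ((T ^^ k) z) (D k z w')"
    using unstable_rate_le[OF \<Lambda>_seg[OF z] k w'u] q(3) by simp
  have "N ((T ^^ k) z) (D k z w') \<le> nu k z / (1 + \<eta>)"
  proof (rule tendsto_tangent_bound_fwd[OF q(2)], rule always_eventually, rule allI)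
    fix n
    show "N ((T ^^ k) ((p \<circ> r \<circ> q) n)) (D k ((p \<circ> r \<circ> q) n) ((w \<circ> q) n)) \<le> nu k z / (1 + \<eta>)"
      using u(2)[of "q n"] tnorm_pos[OF v nz, of "q n"] \<eta>
      by (simp add: w_def tnorm_map_unit_tangent[OF C1_Tm v] v_def[symmetric] field_simps)
  qed
  with lo have "nu k z \<le> nu k z / (1 + \<eta>)" by linarith
  then have "nu k z * (1 + \<eta>) \<le> nu k z" using \<eta> by (simp add: le_divide_eq)
  moreover have "0 < \<eta> * nu k z" using unstable_rate_pos[OF \<Lambda>_seg[OF z] k] \<eta> by simp
  ultimately show False by (simp add: algebra_simps)
qed

text \<open>One \<open>z\<close> has to satisfy all three estimates, because only the combined
  weight at a point of \<open>\<Lambda>\<close> is controlled. This is why a single sequence of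
  blocks, each bad for every \<open>z\<close>, is refuted at its own limit point.\<close>

lemma block_shadowing:
  assumes \<eta>: "0 < \<eta>" and k: "0 < k" and \<phi>: "\<And>z. isCont \<phi> z"
  obtains L where "0 < L"
    "\<And>M x i. \<lbrakk>x \<in> seg M; L \<le> i; i + k + L \<le> M\<rbrakk> \<Longrightarrow> \<exists>z\<in>\<Lambda>.
      (\<forall>u\<in>TS x. D M x u \<in> Es ((T ^^ M) x) \<longrightarrow>
         N ((T ^^ (i + k)) x) (D (i + k) x u) \<le> (1 + \<eta>) * lam k z * N ((T ^^ i) x) (D i x u)) \<and>
      (\<forall>u\<in>Eu x. nu k z * N ((T ^^ i) x) (D i x u) \<le> (1 + \<eta>) * N ((T ^^ (i + k)) x) (D (i + k) x u)) \<and>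
      \<phi> ((T ^^ i) x) \<le> (\<phi> z + \<eta> :: real)"
proof (rule ccontr)
  let ?P = "\<lambda>M x i z. (\<forall>u\<in>TS x. D M x u \<in> Es ((T ^^ M) x) \<longrightarrow>
         N ((T ^^ (i + k)) x) (D (i + k) x u) \<le> (1 + \<eta>) * lam k z * N ((T ^^ i) x) (D i x u)) \<and>
      (\<forall>u\<in>Eu x. nu k z * N ((T ^^ i) x) (D i x u) \<le> (1 + \<eta>) * N ((T ^^ (i + k)) x) (D (i + k) x u)) \<and>
      \<phi> ((T ^^ i) x) \<le> \<phi> z + \<eta>"
  assume "\<not> thesis"
  have "\<exists>M x i. x \<in> seg M \<and> Suc n \<le> i \<and> i + k + Suc n \<le> M \<and> (\<forall>z\<in>\<Lambda>. \<not> ?P M x i z)" for n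
  proof (rule ccontr)
    assume "\<nexists>M x i. x \<in> seg M \<and> Suc n \<le> i \<and> i + k + Suc n \<le> M \<and> (\<forall>z\<in>\<Lambda>. \<not> ?P M x i z)"
    then have *: "\<And>M x i. \<lbrakk>x \<in> seg M; Suc n \<le> i; i + k + Suc n \<le> M\<rbrakk> \<Longrightarrow> \<exists>z\<in>\<Lambda>. ?P M x i z" by blast
    have thesis
    proof (rule that[of "Suc n"])
      show "0 < Suc n" by simp
    qed (rule *)
    with \<open>\<not> thesis\<close> show False by simp
  qed
  then obtain M x i where x: "\<And>n. x n \<in> seg (M n)" and i: "\<And>n. Suc n \<le> i n" "\<And>n. i n + k + Suc n \<le> M n"
    and neg: "\<And>n z. z \<in> \<Lambda> \<Longrightarrow> \<not> ?P (M n) (x n) (i n) z"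
    by metis
  define p where "p n = (T ^^ i n) (x n)" for n
  have evI: "eventually Q sequentially" if "\<And>n. j \<le> n \<Longrightarrow> Q n" for Q and j :: nat
    using that unfolding eventually_sequentially by blast
  have seg: "(T ^^ j) (p n) \<in> V" if "j \<le> n" for j n
    unfolding p_def funpow_T_add[symmetric] using that i[of n] by (intro seg_V[OF x]) simp
  have seg': "(inv T ^^ j) (p n) \<in> V" if "j \<le> n" for j n
    unfolding p_def using that i[of n] funpow_inv_T_diff[of j "i n" "x n"]
    by (auto intro!: seg_V[OF x])
  obtain r z where r: "strict_mono r" "(p \<circ> r) \<longlonglongrightarrow> z" and z: "z \<in> \<Lambda>"
    by (rule compact_orbit_limit[of p]) (use seg[of 0] in simp, auto intro: evI seg seg')
  have rn: "n \<le> r n" for n by (rule seq_suble[OF r(1)])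
  \<comment> \<open>The stable estimate is applied to the rest of the segment from the start of the
    block on, the unstable one below to the part before the block; both lengths tend to
    infinity.\<close>
  have "eventually (\<lambda>n. \<forall>u\<in>TS ((p \<circ> r) n). D (M (r n) - i (r n)) ((p \<circ> r) n) u \<in> Es ((T ^^ (M (r n) - i (r n))) ((p \<circ> r) n)) \<longrightarrow>
    N ((T ^^ k) ((p \<circ> r) n)) (D k ((p \<circ> r) n) u) \<le> (1 + \<eta>) * lam k z * N ((p \<circ> r) n) u) sequentially"
  proof (rule eventually_stable_block[OF r(2) z _ _ \<eta> k])
    show "(p \<circ> r) n \<in> seg (M (r n) - i (r n))" for n
      unfolding p_def comp_apply using i[of "r n"] by (intro seg_diff[OF x]) simp
    show "eventually (\<lambda>n. j \<le> M (r n) - i (r n)) sequentially" for j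
    proof (rule evI[of j])
      fix n assume "j \<le> n"
      then show "j \<le> M (r n) - i (r n)" using i[of "r n"] rn[of n] by linarith
    qed
  qed
  moreover have "eventually (\<lambda>n. \<forall>u\<in>Eu (x (r n)). nu k z * N ((p \<circ> r) n) (D (i (r n)) (x (r n)) u) \<le>
    (1 + \<eta>) * N ((T ^^ k) ((p \<circ> r) n)) (D k ((p \<circ> r) n) (D (i (r n)) (x (r n)) u))) sequentially"
  proof (rule eventually_unstable_block[OF r(2) z _ _ _ _ \<eta> k])
    show "x (r n) \<in> seg (i (r n))" for n using seg_diff[OF x[of "r n"], of 0 "i (r n)"] i[of "r n"] by simp
    show "0 < i (r n)" for n using i(1)[of "r n"] by simp
    show "eventually (\<lambda>n. j \<le> i (r n)) sequentially" for j
    proof (rule evI[of j])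
      fix n assume "j \<le> n"
      then show "j \<le> i (r n)" using i(1)[of "r n"] rn[of n] by linarith
    qed
  qed (simp add: p_def)
  moreover have "eventually (\<lambda>n. \<phi> ((p \<circ> r) n) < \<phi> z + \<eta>) sequentially"
    using isCont_tendsto_compose[OF \<phi> r(2)] \<eta> by (intro order_tendstoD(2)) auto
  ultimately have "eventually (\<lambda>n. ?P (M (r n)) (x (r n)) (i (r n)) z) sequentially"
  proof eventually_elim
    case (elim n)
    have *: "N ((T ^^ (i (r n) + k)) (x (r n))) (D (i (r n) + k) (x (r n)) u) =
        N ((T ^^ k) ((p \<circ> r) n)) (D k ((p \<circ> r) n) (D (i (r n)) (x (r n)) u))" if "u \<in> TS (x (r n))" for u
      by (simp add: D_add[OF that] funpow_T_add p_def)
    have le: "i (r n) \<le> M (r n)" "0 < M (r n)" using i(2)[of "r n"] by simp_all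
    have **: "D (M (r n) - i (r n)) ((p \<circ> r) n) (D (i (r n)) (x (r n)) u) = D (M (r n)) (x (r n)) u"
      "(T ^^ (M (r n) - i (r n))) ((p \<circ> r) n) = (T ^^ M (r n)) (x (r n))"
      if "u \<in> TS (x (r n))" for u
      using D_add[OF that, of "i (r n)" "M (r n) - i (r n)"] funpow_T_add[of "i (r n)" "M (r n) - i (r n)" "x (r n)"] le
      by (simp_all add: p_def)
    have in': "D (i (r n)) (x (r n)) u \<in> TS ((p \<circ> r) n)" if "u \<in> TS (x (r n))" for u
      using D_in[OF that] by (simp add: p_def)
    have uT: "u \<in> TS (x (r n))" if "u \<in> Eu (x (r n))" for u
      by (rule unstable_in_TS[OF x le(2) that])
    have px: "(T ^^ i (r n)) (x (r n)) = (p \<circ> r) n" by (simp add: p_def)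
    show ?case
    proof (intro conjI ballI impI)
      fix u assume u: "u \<in> TS (x (r n))" "D (M (r n)) (x (r n)) u \<in> Es ((T ^^ M (r n)) (x (r n)))"
      show "N ((T ^^ (i (r n) + k)) (x (r n))) (D (i (r n) + k) (x (r n)) u)
         \<le> (1 + \<eta>) * lam k z * N ((T ^^ i (r n)) (x (r n))) (D (i (r n)) (x (r n)) u)"
        unfolding *[OF u(1)] px using elim(1) in'[OF u(1)] **[OF u(1)] u(2) by auto
    next
      fix u assume u: "u \<in> Eu (x (r n))"
      show "nu k z * N ((T ^^ i (r n)) (x (r n))) (D (i (r n)) (x (r n)) u)
         \<le> (1 + \<eta>) * N ((T ^^ (i (r n) + k)) (x (r n))) (D (i (r n) + k) (x (r n)) u)"
        unfolding *[OF uT[OF u]] px using elim(2) u by blast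
    qed (use elim(3) px in simp)
  qed
  then have "eventually (\<lambda>n::nat. False) sequentially" by eventually_elim (use neg[OF z] in blast)
  then show False by simp
qed

end

section \<open>Growth rates\<close>

lemma chain_product_le:
  fixes s c :: "nat \<Rightarrow> real"
  assumes "\<And>l. l < n \<Longrightarrow> s (Suc l) \<le> c l * s l" "\<And>l. l < n \<Longrightarrow> 0 \<le> c l"
  shows "s n \<le> (\<Prod>l<n. c l) * s 0"
  using assms
proof (induction n)
  case (Suc n)
  have "s (Suc n) \<le> c n * s n" using Suc.prems by simp
  also have "\<dots> \<le> c n * ((\<Prod>l<n. c l) * s 0)" using Suc by (intro mult_left_mono) auto
  finally show ?case by (simp add: mult_ac)
qed simp

text \<open>\<open>P\<close> is the loss at the ends of a segment and \<open>e\<close> the loss per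
  block. Since \<open>p\<close> and \<open>- q\<close> are both at most \<open>p - q\<close>,
  raising the losses to that power covers both entries of the maximum.\<close>

lemma max_powr_prod_le:
  fixes l u :: "nat \<Rightarrow> real"
  assumes pos: "\<And>i. i < n \<Longrightarrow> 0 < l i" "\<And>i. i < n \<Longrightarrow> 0 < u i" "0 < a" and P: "1 \<le> P" and e: "1 \<le> e"
    and a: "a \<le> P * (\<Prod>i<n. e * l i)" and b: "(\<Prod>i<n. u i / e) / P \<le> b" and pq: "0 \<le> p" "q \<le> 0"
  shows "max (a powr p) (b powr q) \<le>
    P powr (p - q) * (\<Prod>i<n. e powr (p - q) * max (l i powr p) (u i powr q))"
proof (rule max.boundedI)
  have "a powr p \<le> (P * (\<Prod>i<n. e * l i)) powr p" using pos pq a by (intro powr_mono2) auto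
  also have "\<dots> = P powr p * (\<Prod>i<n. (e * l i) powr p)"
    using P e pos by (subst powr_mult) (auto intro!: prod_nonneg prod_powr_distrib mult_nonneg_nonneg less_imp_le)
  also have "\<dots> = P powr p * (\<Prod>i<n. e powr p * l i powr p)"
    using e pos by (intro arg_cong2[where f="(*)"] prod.cong) (auto simp: powr_mult less_imp_le)
  also have "\<dots> \<le> P powr (p - q) * (\<Prod>i<n. e powr (p - q) * max (l i powr p) (u i powr q))"
    using P e pq by (intro mult_mono prod_mono conjI mult_mono powr_mono) (auto intro!: prod_nonneg)
  finally show "a powr p \<le> P powr (p - q) * (\<Prod>i<n. e powr (p - q) * max (l i powr p) (u i powr q))" .
next
  have prodpos: "0 < (\<Prod>i<n. u i / e)" using pos e by (intro prod_pos) auto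
  have "b powr q \<le> ((\<Prod>i<n. u i / e) / P) powr q"
    using prodpos P pq b by (intro powr_mono2') auto
  also have "\<dots> = (\<Prod>i<n. u i / e) powr q / P powr q"
    by (rule powr_divide)
  also have "\<dots> = P powr (- q) * (\<Prod>i<n. (u i / e) powr q)"
    using pos e by (subst prod_powr_distrib) (auto simp: powr_minus_divide less_imp_le)
  also have "\<dots> = P powr (- q) * (\<Prod>i<n. e powr (- q) * u i powr q)"
    using e pos by (intro arg_cong2[where f="(*)"] prod.cong) (auto simp: powr_divide powr_minus_divide less_imp_le)
  also have "\<dots> \<le> P powr (p - q) * (\<Prod>i<n. e powr (p - q) * max (l i powr p) (u i powr q))"
    using P e pq by (intro mult_mono prod_mono conjI mult_mono powr_mono) (auto intro!: prod_nonneg)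
  finally show "b powr q \<le> P powr (p - q) * (\<Prod>i<n. e powr (p - q) * max (l i powr p) (u i powr q))" .
qed

lemma root_exponential_tendsto:
  fixes K a :: real
  assumes "0 < K" "0 < a"
  shows "(\<lambda>n. (K * a ^ n) powr (1 / real n)) \<longlonglongrightarrow> a"
proof -
  have "(\<lambda>n. K powr (1 / real n) * a) \<longlonglongrightarrow> K powr 0 * a"
    using assms by (intro tendsto_intros) (auto intro: lim_1_over_n)
  moreover have "eventually (\<lambda>n. K powr (1 / real n) * a = (K * a ^ n) powr (1 / real n)) sequentially"
    using eventually_gt_at_top[of 0]
    by eventually_elim (use assms in \<open>simp add: powr_mult powr_realpow[symmetric] powr_powr\<close>)
  ultimately show ?thesis using assms by (simp add: Lim_transform_eventually)
qed

lemma root_limit_le: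
  fixes s :: "nat \<Rightarrow> real"
  assumes lim: "(\<lambda>n. s n powr (1 / real n)) \<longlonglongrightarrow> \<rho>" and "0 < K" "0 < a"
    and ev: "eventually (\<lambda>n. 0 \<le> s n \<and> s n \<le> K * a ^ n) sequentially"
  shows "\<rho> \<le> a"
  by (rule tendsto_le[OF _ root_exponential_tendsto[OF assms(2,3)] lim])
    (use ev in \<open>auto elim!: eventually_mono intro: powr_mono2\<close>)

text \<open>The limit is the infimum of the roots; the second conclusion is this fact in the form
  used later, a block length that beats any given \<open>b\<close> above the limit. Zero values of
  \<open>s\<close> are allowed, and nothing is assumed about the index 0.\<close>

lemma fekete_submultiplicative:
  fixes s :: "nat \<Rightarrow> real"
  assumes nonneg: "\<And>n. 0 < n \<Longrightarrow> 0 \<le> s n"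
    and submult: "\<And>m n. 0 < m \<Longrightarrow> 0 < n \<Longrightarrow> s (m + n) \<le> s m * s n"
  obtains L where "(\<lambda>n. s n powr (1 / real n)) \<longlonglongrightarrow> L"
    "\<And>b. L < b \<Longrightarrow> 0 < b \<and> (\<exists>k>0. s k < b ^ k)"
proof -
  define R where "R = (\<lambda>n. s n powr (1 / real n)) ` {0<..}"
  define L where "L = Inf R"
  have R: "R \<noteq> {}" "bdd_below R" unfolding R_def by (auto intro: bdd_belowI[of _ 0])
  have L0: "0 \<le> L" unfolding L_def by (rule cInf_greatest[OF R(1)]) (auto simp: R_def)
  have L_le: "L \<le> s n powr (1 / real n)" if "0 < n" for n
    unfolding L_def by (rule cInf_lower[OF _ R(2)]) (use that in \<open>auto simp: R_def\<close>)
  have below: "\<exists>k>0. s k < b ^ k" if Lb: "L < b" for b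
  proof -
    obtain x where "x \<in> R" "x < b" using cInf_lessD[OF R(1), of b] Lb unfolding L_def by blast
    then obtain k where k: "0 < k" "s k powr (1 / real k) < b" unfolding R_def by auto
    have "s k = (s k powr (1 / real k)) ^ k"
      using k(1) nonneg[OF k(1)] by (cases "s k = 0") (auto simp: powr_realpow[symmetric] powr_powr)
    also have "\<dots> < b ^ k" using k by (intro power_strict_mono) auto
    finally show ?thesis using k(1) by blast
  qed
  have "(\<lambda>n. s n powr (1 / real n)) \<longlonglongrightarrow> L"
  proof (rule order_tendstoI)
    fix b assume "b < L"
    then show "eventually (\<lambda>n. b < s n powr (1 / real n)) sequentially"
      by (intro eventually_mono[OF eventually_gt_at_top[of 0]]) (rule less_le_trans[OF _ L_le])
  next
    fix b assume "L < b"
    then obtain a where a: "L < a" "a < b" using dense by blast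
    have a0: "0 < a" using a L0 by simp
    obtain k where k: "0 < k" "s k < a ^ k" using below[OF a(1)] by blast
    \<comment> \<open>Residues modulo \<open>k\<close> are taken in \<open>{1..k}\<close> to avoid
      the index 0; \<open>K\<close> absorbs the finitely many starting values, and the summand 1
      makes it positive.\<close>
    define K where "K = 1 + (\<Sum>r\<in>{1..k}. s r / a ^ r)"
    have terms: "0 \<le> s r / a ^ r" if "r \<in> {1..k}" for r using nonneg[of r] that a0 by simp
    have K0: "0 < K" unfolding K_def using terms by (intro add_pos_nonneg sum_nonneg) auto
    have r_le: "s r \<le> K * a ^ r" if "r \<in> {1..k}" for r
    proof -
      have "s r / a ^ r \<le> K"
        unfolding K_def using member_le_sum[of r "{1..k}" "\<lambda>r. s r / a ^ r"] that terms by auto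
      then show ?thesis using a0 by (simp add: divide_le_eq)
    qed
    have mult: "s (r + q * k) \<le> K * a ^ (r + q * k)" if "r \<in> {1..k}" for r q
    proof (induction q)
      case (Suc q)
      have "s (r + Suc q * k) = s ((r + q * k) + k)" by (simp add: algebra_simps)
      also have "\<dots> \<le> s (r + q * k) * s k" using that k(1) by (intro submult) auto
      also have "\<dots> \<le> (K * a ^ (r + q * k)) * a ^ k"
        using Suc k a0 K0 nonneg[OF k(1)] by (intro mult_mono) auto
      finally show ?case by (simp add: power_add mult_ac)
    qed (use r_le[OF that] in simp)
    have bound: "s n \<le> K * a ^ n" if "0 < n" for n
    proof -
      have "n = (1 + (n - 1) mod k) + ((n - 1) div k) * k" using that by simp
      moreover have "1 + (n - 1) mod k \<in> {1..k}" using k(1) by (simp add: Suc_leI)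
      ultimately show ?thesis using mult by metis
    qed
    have "eventually (\<lambda>n. (K * a ^ n) powr (1 / real n) < b) sequentially"
      by (rule order_tendstoD(2)[OF root_exponential_tendsto[OF K0 a0] a(2)])
    then show "eventually (\<lambda>n. s n powr (1 / real n) < b) sequentially"
      using eventually_gt_at_top[of 0]
    proof eventually_elim
      case (elim n)
      have "s n powr (1 / real n) \<le> (K * a ^ n) powr (1 / real n)"
        using bound[OF elim(2)] nonneg[OF elim(2)] by (intro powr_mono2) auto
      then show ?case using elim(1) by simp
    qed
  qed
  then show thesis using that[of L] below L0 by force
qed

section \<open>Submultiplicativity over \<open>\<Lambda>\<close> and growth of the weights on
  segments\<close>

context hyperbolic_dynamics
begin

lemma rate_weight_bounded:
  assumes "0 \<le> p" "q \<le> 0" "0 < k"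
  obtains B where "0 \<le> B" "\<And>x. x \<in> seg k \<Longrightarrow> rate_weight A h T Eu Es p q k x \<le> B"
proof -
  obtain C where C: "1 \<le> C"
    "\<And>M x. x \<in> seg M \<Longrightarrow> 0 < M \<Longrightarrow> lam M x \<le> C * \<theta> ^ M"
    "\<And>M x. x \<in> seg M \<Longrightarrow> 0 < M \<Longrightarrow> 1 / (C * \<theta> ^ M) \<le> nu M x"
    using rate_constant by blast
  show thesis
  proof (rule that[of "max ((C * \<theta> ^ k) powr p) ((1 / (C * \<theta> ^ k)) powr q)"])
    fix x assume x: "x \<in> seg k"
    have "lam k x powr p \<le> (C * \<theta> ^ k) powr p"
      using stable_rate_pos[OF x assms(3)] C(2)[OF x assms(3)] assms by (intro powr_mono2) auto
    moreover have "nu k x powr q \<le> (1 / (C * \<theta> ^ k)) powr q"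
      using C(1) \<theta> C(3)[OF x assms(3)] assms by (intro powr_mono2') auto
    ultimately show "rate_weight A h T Eu Es p q k x \<le>
        max ((C * \<theta> ^ k) powr p) ((1 / (C * \<theta> ^ k)) powr q)"
      unfolding rate_weight_def by linarith
  qed (simp add: le_max_iff_disj)
qed

lemma rate_weight_nonneg: "0 \<le> rate_weight A h T Eu Es p q k x"
  by (simp add: rate_weight_def max_def)

text \<open>Here invariance over \<open>\<Lambda>\<close> is essential: a vector that ends in
  \<open>Es\<close> or starts in \<open>Eu\<close> is in the same bundle at the intermediate time,
  so each of the two factors is a genuine rate.\<close>

lemma rate_weight_submult:
  assumes z: "z \<in> \<Lambda>" and pq: "0 \<le> p" "q \<le> 0" and m: "0 < m" and n: "0 < n"
  shows "rate_weight A h T Eu Es p q (m + n) z \<le>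
    rate_weight A h T Eu Es p q m z * rate_weight A h T Eu Es p q n ((T ^^ m) z)"
proof -
  let ?y = "(T ^^ m) z"
  have y: "?y \<in> \<Lambda>" by (rule T_\<Lambda>[OF z])
  have zs: "z \<in> seg M" and ys: "?y \<in> seg M" for M using \<Lambda>_seg z y by auto
  have mn: "0 < m + n" using m by simp
  note pos = stable_rate_pos[OF zs m] stable_rate_pos[OF ys n] unstable_rate_pos[OF zs m] unstable_rate_pos[OF ys n]
  have lam: "lam (m + n) z \<le> lam m z * lam n ?y"
  proof (rule stable_rate_le[OF zs mn])
    fix v assume v: "v \<in> TS z" "D (m + n) z v \<in> Es ((T ^^ (m + n)) z)"
    obtain v' where v': "v' \<in> Es z" "D (m + n) z v' = D (m + n) z v"
      using D_image_\<Lambda>(2)[OF z, of "m + n"] v(2) by (metis imageE)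
    \<comment> \<open>Invariance only provides some preimage in \<open>Es z\<close>; injectivity of
      the derivative identifies it with \<open>v\<close>.\<close>
    then have "v' = v" using ED[OF v(1), of "m + n"] ED[of v' z "m + n"] splitting(2)[OF z] by auto
    then have vs: "D m z v \<in> Es ?y" using v'(1) D_image_\<Lambda>(2)[OF z, of m] by blast
    have "N ((T ^^ n) ?y) (D n ?y (D m z v)) \<le> lam n ?y * N ?y (D m z v)"
      by (rule le_stable_rate[OF ys n D_in[OF v(1)]]) (use D_add[OF v(1), of m n] v(2) in \<open>simp add: funpow_T_add\<close>)
    also have "\<dots> \<le> lam n ?y * (lam m z * N z v)"
      using le_stable_rate[OF zs m v(1) vs] pos by (intro mult_left_mono) auto
    finally show "N ((T ^^ (m + n)) z) (D (m + n) z v) \<le> lam m z * lam n ?y * N z v"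
      by (simp add: D_add[OF v(1)] funpow_T_add mult_ac)
  qed
  have nu: "nu m z * nu n ?y \<le> nu (m + n) z"
  proof (rule le_unstable_rate[OF zs mn])
    fix v assume v: "v \<in> Eu z"
    then have vT: "v \<in> TS z" and vu: "D m z v \<in> Eu ?y"
      using splitting(1)[OF z] D_image_\<Lambda>(1)[OF z, of m] by blast+
    have "nu n ?y * (nu m z * N z v) \<le> nu n ?y * N ?y (D m z v)"
      using unstable_rate_le[OF zs m v] pos by (intro mult_left_mono) auto
    also have "\<dots> \<le> N ((T ^^ n) ?y) (D n ?y (D m z v))" by (rule unstable_rate_le[OF ys n vu])
    finally show "nu m z * nu n ?y * N z v \<le> N ((T ^^ (m + n)) z) (D (m + n) z v)"
      by (simp add: D_add[OF vT] funpow_T_add mult_ac)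
  qed
  have "lam (m + n) z powr p \<le> (lam m z * lam n ?y) powr p"
    using lam pq less_imp_le[OF stable_rate_pos[OF zs mn]] by (intro powr_mono2) auto
  then have 1: "lam (m + n) z powr p \<le> lam m z powr p * lam n ?y powr p"
    using pos by (simp add: powr_mult less_imp_le)
  have "nu (m + n) z powr q \<le> (nu m z * nu n ?y) powr q"
    using nu pq pos by (intro powr_mono2') auto
  then have 2: "nu (m + n) z powr q \<le> nu m z powr q * nu n ?y powr q"
    using pos by (simp add: powr_mult less_imp_le)
  show ?thesis unfolding rate_weight_def
    by (rule max.boundedI[OF order_trans[OF 1] order_trans[OF 2]]; intro mult_mono) (auto simp: max_def)
qed

text \<open>The bound on \<open>V\<close> from blocks of the fixed length \<open>k\<close>, for a
  general nonnegative continuous cocycle. Each block contributes at most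
  \<open>(1 + \<eta>) powr (p - q) * (S + \<eta> * B)\<close>, and the strict inequality in the
  hypothesis on \<open>a\<close> leaves room for this to stay below \<open>a ^ k\<close>.\<close>

lemma cocycle_growth:
  assumes pq: "0 \<le> p" "q \<le> 0" and k: "0 < k" and cont: "\<And>m z. isCont (\<phi> m) z"
    and nonneg: "\<And>m x. 0 \<le> \<phi> m x" and cocycle: "\<And>m n x. \<phi> (m + n) x = \<phi> m x * \<phi> n ((T ^^ m) x)"
    and S: "\<And>z. z \<in> \<Lambda> \<Longrightarrow> \<phi> k z * rate_weight A h T Eu Es p q k z \<le> S"
    and a: "0 < a" "S < (a :: real) ^ k"
  obtains K M0 where "0 < K"
    "\<And>M x. M0 \<le> M \<Longrightarrow> x \<in> seg M \<Longrightarrow> \<phi> M x * rate_weight A h T Eu Es p q M x \<le> K * a ^ M"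
proof -
  define w where "w = rate_weight A h T Eu Es p q"
  have w0: "0 \<le> w m x" for m x unfolding w_def by (rule rate_weight_nonneg)
  obtain B where B: "0 \<le> B" "\<And>x. x \<in> seg k \<Longrightarrow> w k x \<le> B"
    using rate_weight_bounded[OF pq k] unfolding w_def by blast
  \<comment> \<open>\<open>B\<close> bounds the weight itself and turns the additive error
    \<open>\<eta>\<close> of the cocycle into the error \<open>\<eta> * B\<close> of the
    product.\<close>
  have "((\<lambda>\<eta>. (1 + \<eta>) powr (p - q) * (S + \<eta> * B)) \<longlongrightarrow> (1 + 0) powr (p - q) * (S + 0 * B)) (at_right 0)"
    by (intro tendsto_intros) auto
  then have "((\<lambda>\<eta>. (1 + \<eta>) powr (p - q) * (S + \<eta> * B)) \<longlongrightarrow> S) (at_right 0)" by simp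
  from order_tendstoD(2)[OF this a(2)]
  have "eventually (\<lambda>\<eta>. 0 < \<eta> \<and> (1 + \<eta>) powr (p - q) * (S + \<eta> * B) < a ^ k) (at_right 0)"
    using eventually_at_right_less[of 0] by eventually_elim simp
  then obtain \<eta> where \<eta>: "0 < \<eta>" "(1 + \<eta>) powr (p - q) * (S + \<eta> * B) < a ^ k"
    by (metis (mono_tags, lifting) eventually_happens' trivial_limit_at_right_real)
  obtain L where L: "0 < L"
    "\<And>M x i. \<lbrakk>x \<in> seg M; L \<le> i; i + k + L \<le> M\<rbrakk> \<Longrightarrow> \<exists>z\<in>\<Lambda>.
      (\<forall>u\<in>TS x. D M x u \<in> Es ((T ^^ M) x) \<longrightarrow>
         N ((T ^^ (i + k)) x) (D (i + k) x u) \<le> (1 + \<eta>) * lam k z * N ((T ^^ i) x) (D i x u)) \<and>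
      (\<forall>u\<in>Eu x. nu k z * N ((T ^^ i) x) (D i x u) \<le> (1 + \<eta>) * N ((T ^^ (i + k)) x) (D (i + k) x u)) \<and>
      \<phi> k ((T ^^ i) x) \<le> \<phi> k z + \<eta>"
    using block_shadowing[OF \<eta>(1) k cont] by blast
  obtain K where K: "1 \<le> K"
    "\<And>M x v. x \<in> seg M \<Longrightarrow> v \<in> TS x \<Longrightarrow> N ((T ^^ M) x) (D M x v) \<le> K ^ M * N x v"
    "\<And>M x v. x \<in> seg M \<Longrightarrow> v \<in> TS x \<Longrightarrow> N x v \<le> K ^ M * N ((T ^^ M) x) (D M x v)"
    using segment_growth by blast
  obtain F where F: "1 \<le> F" "\<And>x. x \<in> V \<Longrightarrow> \<phi> 1 x \<le> F"
  proof -
    have "bounded (\<phi> 1 ` V)"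
      by (intro compact_imp_bounded compact_continuous_image continuous_at_imp_continuous_on ballI cont compact_V)
    then obtain F0 where "\<And>x. x \<in> V \<Longrightarrow> norm (\<phi> 1 x) \<le> F0" unfolding bounded_iff by blast
    then show thesis using that[of "max 1 F0"] by (force simp: abs_le_iff)
  qed
  have \<phi>_le: "\<phi> m x \<le> F ^ m" if "x \<in> seg m" for m x
    using that
  proof (induction m)
    case 0
    \<comment> \<open>No value at time 0 is assumed; the cocycle identity leaves only 0 and
      1.\<close>
    have "\<phi> 0 x * (1 - \<phi> 0 x) = 0" using cocycle[of 0 0 x] by (simp add: algebra_simps)
    then show ?case by auto
  next
    case (Suc m)
    have "\<phi> (Suc m) x = \<phi> m x * \<phi> 1 ((T ^^ m) x)" using cocycle[of m 1 x] by simp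
    also have "\<dots> \<le> F ^ m * F"
    proof (intro mult_mono)
      show "\<phi> m x \<le> F ^ m" using Suc by (simp add: seg_def)
      show "\<phi> 1 ((T ^^ m) x) \<le> F" using seg_V[OF Suc.prems, of m] by (intro F(2)) simp
    qed (use F nonneg in auto)
    finally show ?case by (simp add: mult.commute)
  qed
  \<comment> \<open>An upper bound for the number of steps outside the blocks: \<open>L\<close> at
    each end and fewer than \<open>k\<close> left over by the division. The factor \<open>a'\<close>
    pays for the powers of \<open>a\<close> missing at these steps, whether \<open>a\<close> is
    below or above 1.\<close>
  define J where "J = 2 * L + k"
  define a' where "a' = max 1 (1 / a)"
  define b where "b = (1 + \<eta>) powr (p - q) * (S + \<eta> * B)"
  show thesis
  proof (rule that[of "F ^ J * (K ^ J) powr (p - q) * a' ^ J" J])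
    show "0 < F ^ J * (K ^ J) powr (p - q) * a' ^ J"
      using F(1) K(1) by (simp add: a'_def less_max_iff_disj)
    fix M x assume M: "J \<le> M" and x: "x \<in> seg M"
    define n where "n = (M - 2 * L) div k"
    have nk: "n * k \<le> M - 2 * L" unfolding n_def by simp
    have nk': "M - 2 * L < n * k + k"
      using div_mod_decomp[of "M - 2 * L" k] mod_less_divisor[OF k, of "M - 2 * L"] unfolding n_def by linarith
    have ix: "L + l * k + k + L \<le> M" if "l < n" for l
    proof -
      have "l * k + k \<le> n * k" using that by (metis Suc_leI add.commute mult_Suc mult_le_mono1)
      then show ?thesis using nk M unfolding J_def by linarith
    qed
    have "\<exists>z\<in>\<Lambda>.
      (\<forall>u\<in>TS x. D M x u \<in> Es ((T ^^ M) x) \<longrightarrow>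
         N ((T ^^ (L + l * k + k)) x) (D (L + l * k + k) x u) \<le> (1 + \<eta>) * lam k z * N ((T ^^ (L + l * k)) x) (D (L + l * k) x u)) \<and>
      (\<forall>u\<in>Eu x. nu k z * N ((T ^^ (L + l * k)) x) (D (L + l * k) x u) \<le> (1 + \<eta>) * N ((T ^^ (L + l * k + k)) x) (D (L + l * k + k) x u)) \<and>
      \<phi> k ((T ^^ (L + l * k)) x) \<le> \<phi> k z + \<eta>" if "l < n" for l
      by (rule L(2)[OF x _ ix[OF that]]) simp
    then obtain Z where Z: "\<And>l. l < n \<Longrightarrow> Z l \<in> \<Lambda>"
      "\<And>l u. l < n \<Longrightarrow> u \<in> TS x \<Longrightarrow> D M x u \<in> Es ((T ^^ M) x) \<Longrightarrow>
         N ((T ^^ (L + l * k + k)) x) (D (L + l * k + k) x u) \<le> (1 + \<eta>) * lam k (Z l) * N ((T ^^ (L + l * k)) x) (D (L + l * k) x u)"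
      "\<And>l u. l < n \<Longrightarrow> u \<in> Eu x \<Longrightarrow> nu k (Z l) * N ((T ^^ (L + l * k)) x) (D (L + l * k) x u) \<le> (1 + \<eta>) * N ((T ^^ (L + l * k + k)) x) (D (L + l * k + k) x u)"
      "\<And>l. l < n \<Longrightarrow> \<phi> k ((T ^^ (L + l * k)) x) \<le> \<phi> k (Z l) + \<eta>"
      by metis
    have Suc_ix: "L + Suc l * k = L + l * k + k" for l by simp
    define r where "r = M - (L + n * k)"
    have rM: "M = L + n * k + r" and rJ: "L + r \<le> J"
      using nk nk' M unfolding r_def J_def by linarith+
    have M0: "0 < M" using L(1) M unfolding J_def by simp
    have KJ: "1 \<le> K ^ J" using K(1) by simp
    have pos: "0 < lam k (Z l)" "0 < nu k (Z l)" if "l < n" for l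
      using stable_rate_pos[OF \<Lambda>_seg k] unstable_rate_pos[OF \<Lambda>_seg k] Z(1)[OF that] by auto
    have xL: "x \<in> seg L" using seg_diff[OF x, of 0 L] rM by simp
    have xr: "(T ^^ (L + n * k)) x \<in> seg r" using seg_diff[OF x, of "L + n * k" r] rM by simp
    have D_end: "D r ((T ^^ (L + n * k)) x) (D (L + n * k) x u) = D M x u" if "u \<in> TS x" for u
      using D_add[OF that, of "L + n * k" r] rM by simp
    have T_end: "(T ^^ r) ((T ^^ (L + n * k)) x) = (T ^^ M) x"
      using funpow_T_add[of "L + n * k" r x] rM by simp
    have lam_le: "lam M x \<le> K ^ J * (\<Prod>l<n. (1 + \<eta>) * lam k (Z l))"
    proof (rule stable_rate_le[OF x M0])
      fix u assume u: "u \<in> TS x" "D M x u \<in> Es ((T ^^ M) x)"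
      let ?P = "\<Prod>l<n. (1 + \<eta>) * lam k (Z l)"
      have P0: "0 \<le> ?P" using pos \<eta>(1) by (intro prod_nonneg) (auto intro!: mult_nonneg_nonneg less_imp_le)
      define s where "s l = N ((T ^^ (L + l * k)) x) (D (L + l * k) x u)" for l
      have "s n \<le> ?P * s 0"
        by (rule chain_product_le) (use Z(2)[OF _ u] pos \<eta>(1) in \<open>auto simp: s_def Suc_ix less_imp_le simp del: mult_Suc\<close>)
      also have "\<dots> \<le> ?P * (K ^ L * N x u)"
        using K(2)[OF xL u(1)] P0 by (intro mult_left_mono) (auto simp: s_def)
      finally have sn: "s n \<le> ?P * (K ^ L * N x u)" .
      have "N ((T ^^ M) x) (D M x u) \<le> K ^ r * s n"
        using K(2)[OF xr D_in[OF u(1)]] unfolding D_end[OF u(1)] T_end s_def .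
      also have "\<dots> \<le> K ^ r * (?P * (K ^ L * N x u))" using sn K(1) by (intro mult_left_mono) auto
      also have "\<dots> = K ^ (L + r) * (?P * N x u)" by (simp add: power_add)
      also have "\<dots> \<le> K ^ J * (?P * N x u)"
        using K(1) rJ P0 tnorm_nonneg[OF u(1)] by (intro mult_right_mono power_increasing mult_nonneg_nonneg) auto
      finally show "N ((T ^^ M) x) (D M x u) \<le> K ^ J * ?P * N x u" by simp
    qed
    have nu_ge: "(\<Prod>l<n. nu k (Z l) / (1 + \<eta>)) / K ^ J \<le> nu M x"
    proof (rule le_unstable_rate[OF x M0])
      fix u assume u: "u \<in> Eu x"
      have uT: "u \<in> TS x" by (rule unstable_in_TS[OF x M0 u])
      let ?P = "\<Prod>l<n. nu k (Z l) / (1 + \<eta>)"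
      have P0: "0 < ?P" using pos \<eta>(1) by (intro prod_pos) auto
      define s where "s l = N ((T ^^ (L + l * k)) x) (D (L + l * k) x u)" for l
      have step: "s l \<le> inverse (nu k (Z l) / (1 + \<eta>)) * s (Suc l)" if "l < n" for l
        using Z(3)[OF that u] pos[OF that] \<eta>(1) unfolding s_def Suc_ix by (simp add: field_simps)
      \<comment> \<open>Negation turns the chain of lower bounds into the upper bounds that
        \<open>chain_product_le\<close> expects; that lemma asks for nonnegative factors
        only.\<close>
      have "- s n \<le> (\<Prod>l<n. nu k (Z l) / (1 + \<eta>)) * (- s 0)"
      proof (rule chain_product_le[where s = "\<lambda>l. - s l"])
        fix l assume "l < n"
        then show "- s (Suc l) \<le> nu k (Z l) / (1 + \<eta>) * - s l"
          using step[of l] pos[of l] \<eta>(1) by (simp add: field_simps)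
      qed (use pos \<eta>(1) in \<open>auto simp: less_imp_le\<close>)
      then have sn: "?P * s 0 \<le> s n" by simp
      have "?P * N x u \<le> ?P * (K ^ L * s 0)"
        using K(3)[OF xL uT] P0 by (intro mult_left_mono) (auto simp: s_def)
      also have "\<dots> = K ^ L * (?P * s 0)" by simp
      also have "\<dots> \<le> K ^ L * s n" using sn K(1) by (intro mult_left_mono) auto
      also have "\<dots> \<le> K ^ L * (K ^ r * N ((T ^^ M) x) (D M x u))"
        using K(3)[OF xr D_in[OF uT]] K(1) unfolding D_end[OF uT] T_end s_def by (intro mult_left_mono) auto
      also have "\<dots> = K ^ (L + r) * N ((T ^^ M) x) (D M x u)" by (simp add: power_add)
      also have "\<dots> \<le> K ^ J * N ((T ^^ M) x) (D M x u)"
        using K(1) rJ tnorm_nonneg[OF D_in[OF uT]] by (intro mult_right_mono power_increasing) auto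
      finally show "?P / K ^ J * N x u \<le> N ((T ^^ M) x) (D M x u)"
        using KJ by (simp add: divide_le_eq mult_ac)
    qed
    have w_le: "w M x \<le> (K ^ J) powr (p - q) * (\<Prod>l<n. (1 + \<eta>) powr (p - q) * w k (Z l))"
      unfolding w_def rate_weight_def
      by (rule max_powr_prod_le[OF _ _ stable_rate_pos[OF x M0] KJ _ lam_le nu_ge pq]) (use pos \<eta>(1) in auto)
    have \<phi>M: "\<phi> M x \<le> F ^ J * (\<Prod>l<n. \<phi> k (Z l) + \<eta>)"
    proof -
      define s where "s l = \<phi> (L + l * k) x" for l
      let ?P = "\<Prod>l<n. \<phi> k (Z l) + \<eta>"
      have P0: "0 \<le> ?P" using nonneg \<eta>(1) by (intro prod_nonneg) (auto intro!: add_nonneg_nonneg less_imp_le)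
      have "s n \<le> ?P * s 0"
      proof (rule chain_product_le)
        fix l assume l: "l < n"
        have "s (Suc l) = \<phi> k ((T ^^ (L + l * k)) x) * s l"
          unfolding s_def Suc_ix cocycle by simp
        also have "\<dots> \<le> (\<phi> k (Z l) + \<eta>) * s l"
          using Z(4)[OF l] nonneg by (intro mult_right_mono) (auto simp: s_def)
        finally show "s (Suc l) \<le> (\<phi> k (Z l) + \<eta>) * s l" .
        show "0 \<le> \<phi> k (Z l) + \<eta>" using nonneg[of k "Z l"] \<eta>(1) by linarith
      qed
      also have "\<dots> \<le> ?P * F ^ L" using \<phi>_le[OF xL] P0 by (intro mult_left_mono) (auto simp: s_def)
      finally have sn: "s n \<le> ?P * F ^ L" .
      have "\<phi> M x = s n * \<phi> r ((T ^^ (L + n * k)) x)"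
        using cocycle[of "L + n * k" r x] rM by (simp add: s_def)
      also have "\<dots> \<le> (?P * F ^ L) * F ^ r"
        using sn \<phi>_le[OF xr] nonneg P0 F(1) by (intro mult_mono) auto
      also have "\<dots> = ?P * F ^ (L + r)" by (simp add: power_add)
      also have "\<dots> \<le> ?P * F ^ J" using P0 F(1) rJ by (intro mult_left_mono power_increasing) auto
      finally show ?thesis by (simp add: mult_ac)
    qed
    \<comment> \<open>Needed to raise \<open>b \<le> a ^ k\<close> to the power \<open>n\<close>;
      the sign of \<open>S\<close> comes from any point of the nonempty set
      \<open>\<Lambda>\<close>.\<close>
    have b0: "0 \<le> b"
    proof -
      obtain z where z: "z \<in> \<Lambda>" using \<Lambda>_nonempty by blast
      have "0 \<le> \<phi> k z * w k z" using nonneg w0 by simp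
      also have "\<dots> \<le> S" using S[OF z] by (simp add: w_def)
      finally show ?thesis using \<eta>(1) B(1) by (simp add: b_def)
    qed
    have "\<phi> M x * w M x \<le> (F ^ J * (\<Prod>l<n. \<phi> k (Z l) + \<eta>)) *
        ((K ^ J) powr (p - q) * (\<Prod>l<n. (1 + \<eta>) powr (p - q) * w k (Z l)))"
      using \<phi>M w_le nonneg w0 order_trans[OF nonneg \<phi>M] by (intro mult_mono) auto
    also have "\<dots> = F ^ J * (K ^ J) powr (p - q) *
        (\<Prod>l<n. (1 + \<eta>) powr (p - q) * ((\<phi> k (Z l) + \<eta>) * w k (Z l)))"
      by (simp add: prod.distrib)
    also have "\<dots> \<le> F ^ J * (K ^ J) powr (p - q) * (\<Prod>l<n. b)"
    proof (intro mult_left_mono prod_mono conjI)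
      fix l assume "l \<in> {..<n}"
      then have zl: "Z l \<in> \<Lambda>" using Z(1) by simp
      have "(\<phi> k (Z l) + \<eta>) * w k (Z l) \<le> S + \<eta> * B"
      proof -
        have "\<phi> k (Z l) * w k (Z l) \<le> S" using S[OF zl] by (simp add: w_def)
        moreover have "\<eta> * w k (Z l) \<le> \<eta> * B"
          using B(2)[OF \<Lambda>_seg[OF zl]] \<eta>(1) by (intro mult_left_mono) auto
        ultimately show ?thesis by (simp add: distrib_right)
      qed
      then show "(1 + \<eta>) powr (p - q) * ((\<phi> k (Z l) + \<eta>) * w k (Z l)) \<le> b"
        unfolding b_def by (intro mult_left_mono) auto
      show "0 \<le> (1 + \<eta>) powr (p - q) * ((\<phi> k (Z l) + \<eta>) * w k (Z l))"
        using nonneg[of k "Z l"] w0 \<eta>(1) by simp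
    qed (use F(1) in auto)
    finally have main: "\<phi> M x * w M x \<le> F ^ J * (K ^ J) powr (p - q) * (\<Prod>l<n. b)" .
    have "(\<Prod>l<n. b) \<le> (a ^ k) ^ n"
      using \<eta>(2) b0 by (simp add: b_def power_mono)
    also have "(a ^ k) ^ n \<le> a' ^ J * a ^ M"
    proof -
      have sum: "M = n * k + (L + r)" using rM by simp
      have "(a ^ k) ^ n = a ^ (n * k)" by (simp add: power_mult[symmetric] mult.commute)
      also have "\<dots> = (1 / a) ^ (L + r) * a ^ M"
        using a(1) by (simp add: sum power_add field_simps)
      also have "\<dots> \<le> a' ^ (L + r) * a ^ M"
        using a(1) by (intro mult_right_mono power_mono) (auto simp: a'_def)
      also have "\<dots> \<le> a' ^ J * a ^ M"
        using a(1) rJ by (intro mult_right_mono power_increasing) (auto simp: a'_def)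
      finally show ?thesis .
    qed
    finally have "F ^ J * (K ^ J) powr (p - q) * (\<Prod>l<n. b) \<le>
        F ^ J * (K ^ J) powr (p - q) * (a' ^ J * a ^ M)"
      using F(1) by (intro mult_left_mono) auto
    with main show "\<phi> M x * rate_weight A h T Eu Es p q M x \<le> F ^ J * (K ^ J) powr (p - q) * a' ^ J * a ^ M"
      by (simp add: w_def mult.assoc)
  qed
qed

end

section \<open>Comparison of the two rates\<close>

locale transfer_weights = hyperbolic_dynamics A h T \<Lambda> V U Eu Es \<theta> + riemannian_vol A h vol
  for A :: "('x::{t2_space, second_countable_topology}, 'd::finite) chart set" and h T \<Lambda> V U Eu Es \<theta> vol +
  fixes g :: "'x \<Rightarrow> complex" and \<delta> p q :: real
  assumes g: "g \<in> Cr_functions_supported_in A \<delta> V" and q: "q \<le> 0" and p: "0 \<le> p"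
begin

lemma isCont_g: "isCont g x"
proof (rule continuous_at_sequentiallyI)
  fix u assume u: "u \<longlonglongrightarrow> x"
  obtain c where c: "c \<in> charts_at A x" using charts_at_nonempty by blast
  then have cA: "c \<in> A" "x \<in> fst c" by (auto simp: charts_at_iff)
  have "continuous_on (snd c ` fst c) (g \<circ> chart_inv c)"
    using g cA Ck_holder_on_imp_continuous_on unfolding Cr_functions_supported_in_def Cr_on_def by blast
  then have "isCont (g \<circ> chart_inv c) (snd c x)"
    using cA open_chart_image continuous_on_eq_continuous_at by blast
  moreover have "(\<lambda>n. snd c (u n)) \<longlonglongrightarrow> snd c x"
    using isCont_tendsto_compose[OF isCont_chart u] cA by blast
  ultimately have "(\<lambda>n. (g \<circ> chart_inv c) (snd c (u n))) \<longlonglongrightarrow> (g \<circ> chart_inv c) (snd c x)"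
    by (rule isCont_tendsto_compose)
  moreover have "eventually (\<lambda>n. (g \<circ> chart_inv c) (snd c (u n)) = g (u n)) sequentially"
    using eventually_chart[OF u c] by eventually_elim (use cA in simp)
  ultimately show "(\<lambda>n. g (u n)) \<longlonglongrightarrow> g x" using cA by (auto elim: Lim_transform_eventually)
qed

lemma g_support: "g x \<noteq> 0 \<Longrightarrow> x \<in> V"
  using g closure_subset[of "{x. g x \<noteq> 0}"] interior_subset[of V]
  unfolding Cr_functions_supported_in_def by blast

lemma birkhoff_prod_support: "birkhoff_prod T g m x \<noteq> 0 \<Longrightarrow> x \<in> seg m"
  by (auto simp: birkhoff_prod_def seg_def intro: g_support)

lemma birkhoff_prod_add:
  "birkhoff_prod T g (m + n) x = birkhoff_prod T g m x * birkhoff_prod T g n ((T ^^ m) x)"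
proof (induction n)
  case (Suc n)
  then show ?case unfolding birkhoff_prod_def by (simp add: funpow_T_add[symmetric] add.commute mult.assoc)
qed (simp add: birkhoff_prod_def)

text \<open>With \<open>s\<close> equal to 1/t this is the weight in R without the rates. It is a
  continuous multiplicative cocycle on all of the manifold, unlike the rates.\<close>

definition \<phi> :: "real \<Rightarrow> nat \<Rightarrow> 'x \<Rightarrow> real" where
  "\<phi> s m x = abs_det A h (T ^^ m) x powr (- s) * norm (birkhoff_prod T g m x)"

lemma abs_det_iterate_pos: "0 < abs_det A h (T ^^ m) x"
  by (rule abs_det_pos[OF C1_Tm C1_invm inv_T_comp(1)])

lemma \<phi>_cocycle: "\<phi> s (m + n) x = \<phi> s m x * \<phi> s n ((T ^^ m) x)"
proof -
  have "abs_det A h (T ^^ (m + n)) x = abs_det A h (T ^^ n) ((T ^^ m) x) * abs_det A h (T ^^ m) x"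
    using abs_det_comp[OF C1_Tm C1_Tm, of n m x] by (simp add: funpow_add[symmetric] add.commute)
  then show ?thesis
    using abs_det_iterate_pos[of m x] abs_det_iterate_pos[of n "(T ^^ m) x"]
    by (simp add: \<phi>_def powr_mult birkhoff_prod_add norm_mult)
qed

lemma \<phi>_nonneg: "0 \<le> \<phi> s m x"
  by (simp add: \<phi>_def)

lemma isCont_\<phi>: "isCont (\<phi> s m) x"
proof -
  have "isCont (\<lambda>x. g ((T ^^ k) x)) x" for k
    by (rule isCont_o2[OF C1_map_continuous[OF C1_Tm] isCont_g])
  then have "isCont (birkhoff_prod T g m) x"
    unfolding birkhoff_prod_def[abs_def] by (intro continuous_prod)
  then show ?thesis
    unfolding \<phi>_def[abs_def]
    by (intro continuous_intros isCont_abs_det C1_Tm) (use abs_det_iterate_pos[of m x] in auto)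
qed

abbreviation w where "w \<equiv> rate_weight A h T Eu Es p q"

lemma closed_seg: "closed (seg m)"
proof -
  have "closed ((T ^^ k) -` V)" for k
    using C1_Tm[of k] closed_V unfolding C1_map_def by (blast intro: closed_vimage)
  moreover have "seg m = (\<Inter>k\<in>{..<m}. (T ^^ k) -` V)" by (auto simp: seg_def)
  ultimately show ?thesis by auto
qed

text \<open>All sets \<open>seg m\<close> with positive \<open>m\<close> lie in \<open>V\<close>,
  and \<open>T ^^ m\<close> maps them into the image of \<open>V\<close> under \<open>T\<close>; so
  one constant from the change of variables bound works for every \<open>m\<close>.\<close>

lemma integral_jacobian_bounded:
  obtains K where "0 < K"
    "\<And>m. 0 < m \<Longrightarrow> (\<integral>\<^sup>+ x. ennreal (1 + abs_det A h (T ^^ m) x) * indicator (seg m) x \<partial>normalised vol) \<le> ennreal K"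
proof -
  obtain a where a: "a < \<infinity>"
    "\<And>k. k \<in> borel_measurable borel \<Longrightarrow> (\<integral>\<^sup>+ x. k x \<partial>normalised vol) = a * (\<integral>\<^sup>+ x. k x \<partial>vol)"
    using nn_integral_normalised by blast
  have cTV: "compact (T ` V)"
    using C1_T compact_V unfolding C1_map_def by (metis compact_continuous_image continuous_on_subset subset_UNIV)
  obtain K where K: "K < \<infinity>"
    "\<And>f f' B. \<lbrakk>C1_map A f; C1_map A f'; f' \<circ> f = id; f \<circ> f' = id; B \<in> sets borel; B \<subseteq> V; f ` B \<subseteq> T ` V\<rbrakk> \<Longrightarrow>
       (\<integral>\<^sup>+ x. ennreal (abs_det A h f x) * indicator B x \<partial>vol) \<le> K"
    using nn_integral_abs_det_bound[OF compact_V cTV] by blast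
  define b where "b = a * (emeasure vol V + K)"
  have "b < \<infinity>"
    using a(1) K(1) emeasure_vol_compact_finite[OF compact_V]
    by (simp add: b_def ennreal_mult_less_top)
  then obtain b' where b': "b = ennreal b'" "0 \<le> b'" by (cases b) auto
  show thesis
  \<comment> \<open>The added 1 only makes the constant positive, as needed for taking
    roots.\<close>
  proof (rule that[of "b' + 1"])
    fix m :: nat assume m: "0 < m"
    have [measurable]: "seg m \<in> sets borel" using closed_seg by simp
    have [measurable]: "abs_det A h (T ^^ m) \<in> borel_measurable borel"
      by (intro borel_measurable_continuous_onI continuous_at_imp_continuous_on ballI isCont_abs_det C1_Tm)
    obtain m' where m': "m = Suc m'" using m gr0_implies_Suc by blast
    have sub: "seg m \<subseteq> V" using seg_V[of _ m 0] m by auto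
    have img: "(T ^^ m) ` seg m \<subseteq> T ` V" using seg_V[of _ m m'] unfolding m' by auto
    have "(\<integral>\<^sup>+ x. ennreal (1 + abs_det A h (T ^^ m) x) * indicator (seg m) x \<partial>vol) =
        (\<integral>\<^sup>+ x. indicator (seg m) x + ennreal (abs_det A h (T ^^ m) x) * indicator (seg m) x \<partial>vol)"
      using abs_det_nonneg[OF C1_Tm] by (intro nn_integral_cong) (auto simp: indicator_def)
    also have "\<dots> = emeasure vol (seg m) + (\<integral>\<^sup>+ x. ennreal (abs_det A h (T ^^ m) x) * indicator (seg m) x \<partial>vol)"
      by (subst nn_integral_add) auto
    also have "\<dots> \<le> emeasure vol V + K"
      using compact_V by (intro add_mono emeasure_mono sub K(2)[OF C1_Tm C1_invm inv_T_comp] img)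
        (auto simp: compact_imp_closed)
    finally have "a * (\<integral>\<^sup>+ x. ennreal (1 + abs_det A h (T ^^ m) x) * indicator (seg m) x \<partial>vol) \<le> b"
      unfolding b_def by (intro mult_left_mono) auto
    then show "(\<integral>\<^sup>+ x. ennreal (1 + abs_det A h (T ^^ m) x) * indicator (seg m) x \<partial>normalised vol) \<le> ennreal (b' + 1)"
      using b' by (subst a(2)) (auto intro: order_trans ennreal_leI)
  qed (use b' in simp)
qed

text \<open>The integrand is \<open>abs_det\<close> to the power \<open>s\<close> times the weight
  controlled by \<open>growth\<close>. As \<open>s\<close> lies in [0,1], that power is at most 1
  plus the Jacobian, whose integral over \<open>seg m\<close> is bounded uniformly in
  \<open>m\<close>.\<close>

lemma rho_le_of_growth:
  assumes s: "0 \<le> s" "s \<le> 1" and conv: "convergent (rho_seq A h vol Eu Es p q T g)"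
    and a: "0 < a" and K: "0 < K" and growth: "\<And>m x. M0 \<le> m \<Longrightarrow> x \<in> seg m \<Longrightarrow> \<phi> s m x * w m x \<le> K * a ^ m"
  shows "rho A h vol Eu Es p q T g \<le> a"
proof -
  define I where "I m = (\<integral>x. norm (birkhoff_prod T g m x) * w m x \<partial>normalised vol)" for m
  obtain J where J: "0 < J"
    "\<And>m. 0 < m \<Longrightarrow> (\<integral>\<^sup>+ x. ennreal (1 + abs_det A h (T ^^ m) x) * indicator (seg m) x \<partial>normalised vol) \<le> ennreal J"
    using integral_jacobian_bounded by blast
  have I0: "0 \<le> I m" for m
    unfolding I_def by (intro integral_nonneg_AE AE_I2 mult_nonneg_nonneg rate_weight_nonneg) auto
  have bound: "I m \<le> (K * J) * a ^ m" if m: "M0 \<le> m" "0 < m" for m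
  proof (cases "integrable (normalised vol) (\<lambda>x. norm (birkhoff_prod T g m x) * w m x)")
    \<comment> \<open>The integral of a nonintegrable function is 0 by convention. The bound is then
      trivial, and measurability of the rates need not be established.\<close>
    case False
    then have "I m = 0" unfolding I_def by (rule not_integrable_integral_eq)
    then show ?thesis using K J a by simp
  next
    case True
    have "ennreal (I m) = (\<integral>\<^sup>+ x. ennreal (norm (birkhoff_prod T g m x) * w m x) \<partial>normalised vol)"
      unfolding I_def using True by (intro nn_integral_eq_integral[symmetric]) (auto simp: rate_weight_nonneg)
    also have "\<dots> \<le> (\<integral>\<^sup>+ x. ennreal (K * a ^ m) * (ennreal (1 + abs_det A h (T ^^ m) x) * indicator (seg m) x) \<partial>normalised vol)"
    proof (rule nn_integral_mono)
      fix x
      show "ennreal (norm (birkhoff_prod T g m x) * w m x) \<le>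
          ennreal (K * a ^ m) * (ennreal (1 + abs_det A h (T ^^ m) x) * indicator (seg m) x)"
      proof (cases "birkhoff_prod T g m x = 0")
        case False
        let ?d = "abs_det A h (T ^^ m) x"
        have x: "x \<in> seg m" by (rule birkhoff_prod_support[OF False])
        have d: "0 < ?d" by (rule abs_det_iterate_pos)
        have d_le: "?d powr s \<le> 1 + ?d"
        proof (cases "?d \<le> 1")
          case True
          then have "?d powr s \<le> 1 powr s" using s d by (intro powr_mono2) auto
          then show ?thesis using d by simp
        next
          case False
          then have "?d powr s \<le> ?d powr 1" using s by (intro powr_mono) auto
          then show ?thesis using d by simp
        qed
        have "norm (birkhoff_prod T g m x) * w m x = ?d powr s * (\<phi> s m x * w m x)"
          using d by (simp add: \<phi>_def powr_minus field_simps)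
        also have "\<dots> \<le> (1 + ?d) * (K * a ^ m)"
          by (rule mult_mono[OF d_le growth[OF m(1) x]])
            (use d in \<open>auto intro!: mult_nonneg_nonneg \<phi>_nonneg rate_weight_nonneg\<close>)
        finally have "ennreal (norm (birkhoff_prod T g m x) * w m x) \<le> ennreal ((1 + ?d) * (K * a ^ m))"
          by (rule ennreal_leI)
        also have "\<dots> = ennreal (K * a ^ m) * ennreal (1 + ?d)"
          using d by (simp only: ennreal_mult' mult.commute[of "ennreal (K * a ^ m)"])
        finally show ?thesis using x by simp
      qed simp
    qed
    also have "\<dots> = ennreal (K * a ^ m) * (\<integral>\<^sup>+ x. ennreal (1 + abs_det A h (T ^^ m) x) * indicator (seg m) x \<partial>normalised vol)"
    proof (rule nn_integral_cmult)
      have [measurable]: "seg m \<in> sets borel" using closed_seg by simp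
      have [measurable]: "abs_det A h (T ^^ m) \<in> borel_measurable borel"
        by (intro borel_measurable_continuous_onI continuous_at_imp_continuous_on ballI isCont_abs_det C1_Tm)
      have "(\<lambda>x. ennreal (1 + abs_det A h (T ^^ m) x) * indicator (seg m) x) \<in> borel_measurable borel" by measurable
      then show "(\<lambda>x. ennreal (1 + abs_det A h (T ^^ m) x) * indicator (seg m) x) \<in> borel_measurable (normalised vol)"
        by (simp add: normalised_def measurable_def)
    qed
    also have "\<dots> \<le> ennreal (K * a ^ m) * ennreal J" by (intro mult_left_mono J(2) m(2)) simp
    also have "\<dots> = ennreal (K * J * a ^ m)" using K J a by (simp add: ennreal_mult'[symmetric] mult_ac)
    finally show ?thesis using K J a by (simp add: ennreal_le_iff)
  qed
  have "(\<lambda>m. I m powr (1 / real m)) \<longlonglongrightarrow> rho A h vol Eu Es p q T g"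
    using conv unfolding rho_def convergent_LIMSEQ_iff rho_seq_def[abs_def] I_def .
  then show ?thesis
  proof (rule root_limit_le)
    show "0 < K * J" using K J by simp
    show "eventually (\<lambda>n. 0 \<le> I n \<and> I n \<le> K * J * a ^ n) sequentially"
      using eventually_ge_at_top[of M0] eventually_gt_at_top[of 0]
      by eventually_elim (use I0 bound in auto)
  qed (rule a)
qed

lemma rho_le_R_bound:
  assumes t: "1 \<le> t" and conv: "convergent (rho_seq A h vol Eu Es p q T g)"
  shows "rho A h vol Eu Es p q T g \<le> R_bound A h \<Lambda> Eu Es p q t T g"
proof -
  \<comment> \<open>For \<open>t = \<infinity>\<close> this is 0, in agreement with the convention
    in the definition of R.\<close>
  define s where "s = real_of_ereal (1 / t)"
  have s: "0 \<le> s" "s \<le> 1"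
    using t by (cases t; auto simp: s_def one_ereal_def)+
  define S where "S m = (SUP x\<in>\<Lambda>. \<phi> s m x * w m x)" for m
  have bdd: "bdd_above ((\<lambda>x. \<phi> s m x * w m x) ` \<Lambda>)" if m: "0 < m" for m
  proof -
    have "bounded (\<phi> s m ` \<Lambda>)"
      by (intro compact_imp_bounded compact_continuous_image continuous_at_imp_continuous_on ballI isCont_\<phi> compact_\<Lambda>)
    then obtain F where F: "\<And>x. x \<in> \<Lambda> \<Longrightarrow> norm (\<phi> s m x) \<le> F" unfolding bounded_iff by blast
    obtain B where B: "0 \<le> B" "\<And>x. x \<in> seg m \<Longrightarrow> w m x \<le> B"
      using rate_weight_bounded[OF p q m] by blast
    show ?thesis
    proof (rule bdd_aboveI2)
      fix x assume x: "x \<in> \<Lambda>"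
      have "\<phi> s m x \<le> F" using F[OF x] by (simp add: abs_le_iff)
      then show "\<phi> s m x * w m x \<le> F * B"
        using B(2)[OF \<Lambda>_seg[OF x]] order_trans[OF \<phi>_nonneg] by (intro mult_mono rate_weight_nonneg) auto
    qed
  qed
  have S_ge: "\<phi> s m x * w m x \<le> S m" if "x \<in> \<Lambda>" "0 < m" for x m
    unfolding S_def by (rule cSUP_upper[OF that(1) bdd[OF that(2)]])
  have S_nonneg: "0 \<le> S m" if "0 < m" for m
  proof -
    obtain z where "z \<in> \<Lambda>" using \<Lambda>_nonempty by blast
    then show ?thesis using S_ge[OF _ that] mult_nonneg_nonneg[OF \<phi>_nonneg rate_weight_nonneg] order_trans by meson
  qed
  have S_submult: "S (m + n) \<le> S m * S n" if mn: "0 < m" "0 < n" for m n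
    unfolding S_def[of "m + n"]
  proof (rule cSUP_least[OF \<Lambda>_nonempty])
    fix z assume z: "z \<in> \<Lambda>"
    have "\<phi> s (m + n) z * w (m + n) z \<le> (\<phi> s m z * \<phi> s n ((T ^^ m) z)) * (w m z * w n ((T ^^ m) z))"
      unfolding \<phi>_cocycle
      by (intro mult_left_mono rate_weight_submult z p q mn mult_nonneg_nonneg \<phi>_nonneg)
    also have "\<dots> = (\<phi> s m z * w m z) * (\<phi> s n ((T ^^ m) z) * w n ((T ^^ m) z))" by simp
    also have "\<dots> \<le> S m * S n"
      by (intro mult_mono S_ge z T_\<Lambda> mn S_nonneg mult_nonneg_nonneg \<phi>_nonneg rate_weight_nonneg)
    finally show "\<phi> s (m + n) z * w (m + n) z \<le> S m * S n" .
  qed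
  obtain R where R: "(\<lambda>n. S n powr (1 / real n)) \<longlonglongrightarrow> R" "\<And>b. R < b \<Longrightarrow> 0 < b \<and> (\<exists>k>0. S k < b ^ k)"
    using fekete_submultiplicative[of S] S_nonneg S_submult by blast
  \<comment> \<open>Only the convergence provided by Fekete's lemma gives the \<open>lim\<close> in
    \<open>R_bound\<close> a meaning.\<close>
  have "R_bound A h \<Lambda> Eu Es p q t T g = R"
    using limI[OF R(1)] unfolding R_bound_def S_def \<phi>_def s_def .
  moreover have "rho A h vol Eu Es p q T g \<le> R"
  \<comment> \<open>Passing to \<open>b\<close> strictly above \<open>R\<close> yields a block
    length \<open>k\<close> with \<open>S k < b ^ k\<close>, the strict inequality that
    \<open>cocycle_growth\<close> requires.\<close>
  proof (rule dense_ge)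
    fix b assume "R < b"
    from R(2)[OF this] obtain k where b: "0 < b" and k: "0 < k" "S k < b ^ k" by blast
    obtain K M0 where K: "0 < K" "\<And>M x. M0 \<le> M \<Longrightarrow> x \<in> seg M \<Longrightarrow> \<phi> s M x * w M x \<le> K * b ^ M"
      using cocycle_growth[OF p q k(1), of "\<phi> s" "S k" b] isCont_\<phi> \<phi>_nonneg \<phi>_cocycle S_ge k b by metis
    show "rho A h vol Eu Es p q T g \<le> b" by (rule rho_le_of_growth[OF s conv b K])
  qed
  ultimately show ?thesis by simp
qed

end

theorem mainTheorem4:
  fixes A :: "('x::{t2_space, second_countable_topology}, 'd::finite) chart set"
    and h :: "('x, 'd) metric"
    and vol :: "'x measure"
    and T :: "'x \<Rightarrow> 'x"
    and \<Lambda> V U :: "'x set"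
    and Eu Es :: "'x \<Rightarrow> ('x, 'd) tangent set"
    and g :: "'x \<Rightarrow> complex"
    and r \<theta> p q \<delta> :: real
  assumes "riemannian_manifold A h"
    and "riemannian_volume A h vol"
    and "1 < r" and "Cr_diffeomorphism A r T"
    and "hyperbolic_basic_set A h T \<Lambda> \<theta> Eu Es"
    and "isolating_neighbourhood T \<Lambda> V"
    and "extended_splitting A h T V U \<theta> Eu Es"
    and "q \<le> 0" and "0 \<le> p"
    and "0 < \<delta>" and "g \<in> Cr_functions_supported_in A \<delta> V"
    and "convergent (rho_seq A h vol Eu Es p q T g)"
  shows "rho A h vol Eu Es p q T g \<le> (INF t\<in>{1..\<infinity>}. R_bound A h \<Lambda> Eu Es p q t T g)"
proof -
  interpret manifold A
    using assms(1) by unfold_locales (simp add: riemannian_manifold_def)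
  have "C1_map A T" "C1_map A (inv T)" "bij T"
    using assms(3,4) Cr_map_imp_C1_map[of r] by (auto simp: Cr_diffeomorphism_def)
  then interpret transfer_weights A h T \<Lambda> V U Eu Es \<theta> vol g \<delta> p q
    using assms by unfold_locales
  show ?thesis
    by (rule cINF_greatest) (auto intro: rho_le_R_bound assms(12))
qed

end
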